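(* Let $g$ be a real analytic $2\pi$-periodic function with zero mean and least period $2\pi$, and let $n=n(g)$. Let $\chi^{[k]}(\mu)$, $k<0$, be the analytic functions of $\mu$ appearing in the formula $$\Delta_{\mathrm{in}}(z,\tau,\mu)=\sum_{k<0}\chi^{[k]}(\mu)\, e^{ik(z-\tau+\mu\mathfrak{g}(z,\tau,\mu))}$$ for the difference $\Delta_{\mathrm{in}}=\psi^--\psi^+$ of the two distinguished solutions of the inner equation, and let $\Delta_{\mathrm{in}}^{[k]}(z,\mu)$ be the $k$-th Fourier coefficient of $\Delta_{\mathrm{in}}$, i.e. $\Delta_{\mathrm{in}}(z,\tau,\mu)=\sum_{k\in\mathbb{Z}}\Delta_{\mathrm{in}}^{[k]}(z,\mu)e^{ik\tau}$. Then: 1. $\partial_\mu^j\chi^{[-1]}(0)=0$ for $j=1,\dots,n-1$, and therefore $$\chi^{[-1]}(\mu)=\chi^{[-1]}_n\mu^n+\mathcal{O}(\mu^{n+1}).$$ 2. The coefficient $\chi_n^{[-1]}$, which only depends on the Fourier coefficients $\{g^{[k]}\}_{k\in\mathbb{Z}}$, with the dependence being analytic, is given by $$\chi_n^{[-1]}=\frac{1}{n!}\lim_{z\to-i\infty}e^{iz}\,\partial_\mu^n\Delta_{\mathrm{in}}^{[1]}(z,\mu)\big|_{\mu=0}.$$ Furthermore, in the special cases $n=1,2$ one has $$\chi_1^{[-1]}=4\pi g^{[1]}\quad (n=1),\qquad \chi_2^{[-1]}=-\frac{4\pi}{3}\sum_{k>1}\frac{g^{[k]}g^{[1-k]}}{k(1-k)}\quad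 (n=2),$$ and in the latter case $\chi_2^{[-1]}=\frac{2\pi}{3}(G^2)^{[1]}$, where $G$ is a primitive of $g$ and $(G^2)^{[1]}$ is the first Fourier coefficient of $G^2$.
   Context: Fourier coefficients: $g(\tau)=\sum_{k\in\mathbb{Z}}g^{[k]}e^{ik\tau}$. Set $G_1=\{m\in\mathbb{Z}: g^{[m]}\neq0\}$ and, for $\ell\ge1$, $G_\ell=\{m_1+\dots+m_\ell : m_j\in G_1\}$. Then $n(g)=\min\{\ell\in\mathbb{N},\ \ell\ge 1: 1\in G_\ell\}$ (this is well defined because $g$ is real and has least period $2\pi$). Domains: for $\varrho,\theta>0$, $\mathcal{D}^{\mathrm{in},-}_{\varrho,\theta}=\{z\in\mathbb{C}: |\Im z|>\theta\,\Re z+\varrho\}$, $\mathcal{D}^{\mathrm{in},+}_{\varrho,\theta}=\{z: -z\in\mathcal{D}^{\mathrm{in},-}_{\varrho,\theta}\}$, $\mathcal{D}^{\mathrm{in}}_{\varrho,\theta}=\mathcal{D}^{\mathrm{in},+}_{\varrho,\theta}\cap\mathcal{D}^{\mathrm{in},-}_{\varrho,\theta}\cap\{\Im z<0\}$; $B_{\mu_0}=\{\mu\in\mathbb{C}:|\mu|<\mu_0\}$; $\mathbb{T}_\sigma=\{\tau\in\mathbb{C}: \Re\tau\in\mathbb{T}=\mathbb{R}/2\pi\mathbb{Z},\ |\Im\tau|<\sigma\}$. Inner equation: $$\partial_\tau\psi+\partial_z\psi=\tfrac18 z^2(\partial_z\psi)^2-2\mu\frac{g(\tau)}{z^2}.$$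 Known result (taken as given, it defines the objects in the claim): fix $\mu_0>0$ and $0<\arctan\theta<\pi/2$. There exist $\varrho_0,\sigma>0$ and $M=M(\varrho_0,\mu_0,\theta)$ such that for all $\varrho\ge\varrho_0$ the inner equation has analytic solutions $\psi^\pm(z,\tau,\mu)$ on $\mathcal{D}^{\mathrm{in},\pm}_{\varrho,\theta}\times\mathbb{T}_\sigma\times B_{\mu_0}$ ($2\pi$-periodic in $\tau$), whose derivatives are uniquely determined by $|\partial_z\psi^\pm(z,\tau,\mu)|<M|\mu|/|z|^3$. Moreover there is an analytic function $\mathfrak{g}(z,\tau,\mu)$ on $\mathcal{D}^{\mathrm{in}}_{\varrho,\theta}\times\mathbb{T}_\sigma\times B_{\mu_0}$ with $|\mathfrak{g}|\le M|z|^{-1}$ and analytic functions $\chi^{[k]}(\mu)$, $k<0$, on $B_{\mu_0}$ such that $\Delta_{\mathrm{in}}:=\psi^--\psi^+$ satisfies on $\mathcal{D}^{\mathrm{in}}_{\varrho,\theta}\times\mathbb{T}_\sigma\times B_{\mu_0}$ the formula stated in the claim. The constants $\mu_0,\theta,\varrho\geq\varrho_0,\sigma$ are fixed so that this holds. *)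

theory Defs
  imports "HOL-Complex_Analysis.Complex_Analysis" "HOL-Library.Landau_Symbols"
begin

section \<open>Periodic functions and Fourier coefficients\<close>

definition real_analytic :: "(real \<Rightarrow> real) \<Rightarrow> bool" where
  "real_analytic f \<longleftrightarrow>
     (\<forall>x. \<exists>r>0. \<exists>a :: nat \<Rightarrow> real. \<forall>t. \<bar>t - x\<bar> < r \<longrightarrow> (\<lambda>m. a m * (t - x) ^ m) sums f t)"

definition least_period :: "real \<Rightarrow> (real \<Rightarrow> real) \<Rightarrow> bool" where
  "least_period T f \<longleftrightarrow> T > 0 \<and> (\<forall>t. f (t + T) = f t) \<and>
     (\<forall>S. 0 < S \<and> S < T \<longrightarrow> \<not> (\<forall>t. f (t + S) = f t))"

definition fourier_coeff :: "(real \<Rightarrow> complex) \<Rightarrow> int \<Rightarrow> complex" where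
  "fourier_coeff f k =
     1 / (2 * pi) * integral {0..2 * pi} (\<lambda>t. f t * exp (- (\<i> * of_int k * of_real t)))"

definition fourier_coeffs :: "(real \<Rightarrow> real) \<Rightarrow> int \<Rightarrow> complex" where
  "fourier_coeffs g = fourier_coeff (\<lambda>t. of_real (g t))"

definition forcing :: "(real \<Rightarrow> real) \<Rightarrow> bool" where
  "forcing g \<longleftrightarrow> real_analytic g \<and> least_period (2 * pi) g \<and> integral {0..2 * pi} g = 0"

text \<open>\<open>harmonics g l\<close> is the set \<open>G\<^sub>l\<close> of sums of \<open>l\<close> (not necessarily distinct) elements of
  \<open>G\<^sub>1 = {m. g\<^bsup>[m]\<^esup> \<noteq> 0}\<close>.\<close>

definition harmonics :: "(real \<Rightarrow> real) \<Rightarrow> nat \<Rightarrow> int set" where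
  "harmonics g l = {sum_list ms | ms. length ms = l \<and> set ms \<subseteq> {m. fourier_coeffs g m \<noteq> 0}}"

definition n_of :: "(real \<Rightarrow> real) \<Rightarrow> nat" where
  "n_of g = (LEAST l. l \<ge> 1 \<and> 1 \<in> harmonics g l)"


section \<open>Domains\<close>

definition D_minus :: "real \<Rightarrow> real \<Rightarrow> complex set" where
  "D_minus \<rho> \<theta> = {z. \<bar>Im z\<bar> > \<theta> * Re z + \<rho>}"

definition D_plus :: "real \<Rightarrow> real \<Rightarrow> complex set" where
  "D_plus \<rho> \<theta> = {z. - z \<in> D_minus \<rho> \<theta>}"

definition D_in :: "real \<Rightarrow> real \<Rightarrow> complex set" where
  "D_in \<rho> \<theta> = D_plus \<rho> \<theta> \<inter> D_minus \<rho> \<theta> \<inter> {z. Im z < 0}"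

text \<open>Functions on the complex torus of width \<open>\<sigma>\<close> are represented by functions on the strip
  that are \<open>2\<pi>\<close>-periodic (see \<open>analytic_periodic\<close>).\<close>

definition strip :: "real \<Rightarrow> complex set" where
  "strip \<sigma> = {\<tau>. \<bar>Im \<tau>\<bar> < \<sigma>}"

text \<open>The filter \<open>z \<rightarrow> -i\<infinity>\<close>: the imaginary part tends to minus infinity within \<open>D_in \<rho> \<theta>\<close>.\<close>

definition to_minus_i_infinity :: "real \<Rightarrow> real \<Rightarrow> complex filter" where
  "to_minus_i_infinity \<rho> \<theta> = inf (filtercomap Im at_bot) (principal (D_in \<rho> \<theta>))"

text \<open>Joint analyticity on an open set of \<open>\<complex>\<^sup>3\<close>: complex Frechet differentiability at every point.\<close>

definition holomorphic3 :: "(complex \<Rightarrow> complex \<Rightarrow> complex \<Rightarrow> complex) \<Rightarrow>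
    (complex \<times> complex \<times> complex) set \<Rightarrow> bool" where
  "holomorphic3 f S \<longleftrightarrow> open S \<and> (\<forall>p\<in>S. \<exists>a b c.
     ((\<lambda>(z, \<tau>, \<mu>). f z \<tau> \<mu>) has_derivative (\<lambda>(u, v, w). a * u + b * v + c * w)) (at p))"

text \<open>Analytic functions on \<open>D \<times> \<T>\<^sub>\<sigma> \<times> B\<close>.\<close>

definition analytic_periodic :: "(complex \<Rightarrow> complex \<Rightarrow> complex \<Rightarrow> complex) \<Rightarrow>
    complex set \<Rightarrow> real \<Rightarrow> real \<Rightarrow> bool" where
  "analytic_periodic f D \<sigma> \<mu>0 \<longleftrightarrow>
     holomorphic3 f (D \<times> strip \<sigma> \<times> ball 0 \<mu>0) \<and>
     (\<forall>z\<in>D. \<forall>\<tau>\<in>strip \<sigma>. \<forall>\<mu>\<in>ball 0 \<mu>0. f z (\<tau> + 2 * pi) \<mu> = f z \<tau> \<mu>)"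


section \<open>The inner equation\<close>

text \<open>Here \<open>\<gamma>\<close> is the holomorphic extension of the forcing to the strip. The derivative bound is
  not strict, since a strict one could not hold at \<open>\<mu> = 0\<close>.\<close>

definition inner_solution :: "(complex \<Rightarrow> complex) \<Rightarrow> complex set \<Rightarrow> real \<Rightarrow> real \<Rightarrow> real \<Rightarrow>
    (complex \<Rightarrow> complex \<Rightarrow> complex \<Rightarrow> complex) \<Rightarrow> bool" where
  "inner_solution \<gamma> D \<sigma> \<mu>0 M \<psi> \<longleftrightarrow>
     analytic_periodic \<psi> D \<sigma> \<mu>0 \<and>
     (\<forall>z\<in>D. \<forall>\<tau>\<in>strip \<sigma>. \<forall>\<mu>\<in>ball 0 \<mu>0.
        deriv (\<lambda>t. \<psi> z t \<mu>) \<tau> + deriv (\<lambda>w. \<psi> w \<tau> \<mu>) z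
          = 1 / 8 * z\<^sup>2 * (deriv (\<lambda>w. \<psi> w \<tau> \<mu>) z)\<^sup>2 - 2 * \<mu> * (\<gamma> \<tau> / z\<^sup>2)) \<and>
     (\<forall>z\<in>D. \<forall>\<tau>\<in>strip \<sigma>. \<forall>\<mu>\<in>ball 0 \<mu>0.
        norm (deriv (\<lambda>w. \<psi> w \<tau> \<mu>) z) \<le> M * norm \<mu> / norm z ^ 3)"

definition Delta_in :: "(complex \<Rightarrow> complex \<Rightarrow> complex \<Rightarrow> complex) \<Rightarrow>
    (complex \<Rightarrow> complex \<Rightarrow> complex \<Rightarrow> complex) \<Rightarrow> complex \<Rightarrow> complex \<Rightarrow> complex \<Rightarrow> complex" where
  "Delta_in \<psi>m \<psi>p z \<tau> \<mu> = \<psi>m z \<tau> \<mu> - \<psi>p z \<tau> \<mu>"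

definition Delta_coeff :: "(complex \<Rightarrow> complex \<Rightarrow> complex \<Rightarrow> complex) \<Rightarrow>
    (complex \<Rightarrow> complex \<Rightarrow> complex \<Rightarrow> complex) \<Rightarrow> int \<Rightarrow> complex \<Rightarrow> complex \<Rightarrow> complex" where
  "Delta_coeff \<psi>m \<psi>p k z \<mu> = fourier_coeff (\<lambda>t. Delta_in \<psi>m \<psi>p z (of_real t) \<mu>) k"

text \<open>The condition \<open>0 < \<theta>\<close> is the same as \<open>0 < arctan \<theta> < \<pi>/2\<close>. Only the negative indices of
  \<open>chi\<close> are relevant.\<close>

definition inner_data :: "(real \<Rightarrow> real) \<Rightarrow> real \<Rightarrow> real \<Rightarrow> real \<Rightarrow> real \<Rightarrow> real \<Rightarrow>
    (complex \<Rightarrow> complex \<Rightarrow> complex \<Rightarrow> complex) \<Rightarrow> (complex \<Rightarrow> complex \<Rightarrow> complex \<Rightarrow> complex) \<Rightarrow>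
    (complex \<Rightarrow> complex \<Rightarrow> complex \<Rightarrow> complex) \<Rightarrow> (int \<Rightarrow> complex \<Rightarrow> complex) \<Rightarrow> bool" where
  "inner_data g \<mu>0 \<theta> \<rho> \<sigma> M \<psi>m \<psi>p \<gg> chi \<longleftrightarrow>
     \<mu>0 > 0 \<and> \<theta> > 0 \<and> \<rho> > 0 \<and> \<sigma> > 0 \<and>
     (\<exists>\<gamma>. \<gamma> holomorphic_on strip \<sigma> \<and> (\<forall>t. \<gamma> (of_real t) = of_real (g t)) \<and>
        inner_solution \<gamma> (D_minus \<rho> \<theta>) \<sigma> \<mu>0 M \<psi>m \<and>
        inner_solution \<gamma> (D_plus \<rho> \<theta>) \<sigma> \<mu>0 M \<psi>p) \<and>
     analytic_periodic \<gg> (D_in \<rho> \<theta>) \<sigma> \<mu>0 \<and>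
     (\<forall>z\<in>D_in \<rho> \<theta>. \<forall>\<tau>\<in>strip \<sigma>. \<forall>\<mu>\<in>ball 0 \<mu>0. norm (\<gg> z \<tau> \<mu>) \<le> M / norm z) \<and>
     (\<forall>k<0. chi k holomorphic_on ball 0 \<mu>0) \<and>
     (\<forall>z\<in>D_in \<rho> \<theta>. \<forall>\<tau>\<in>strip \<sigma>. \<forall>\<mu>\<in>ball 0 \<mu>0.
        ((\<lambda>k. chi k \<mu> * exp (\<i> * of_int k * (z - \<tau> + \<mu> * \<gg> z \<tau> \<mu>)))
           has_sum Delta_in \<psi>m \<psi>p z \<tau> \<mu>) {k. k < 0})"


section \<open>Analytic functions of the Fourier coefficients\<close>

text \<open>\<open>coeff_space s\<close> is the complex Banach space of the coefficient sequences \<open>a\<close> of zero mean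
  functions that are analytic on \<open>\<bar>Im \<tau>\<bar> < s\<close>, with finite norm
  \<open>\<Sum>\<^sub>k \<bar>a k\<bar> e\<^bsup>s\<bar>k\<bar>\<^esup>\<close>. The coefficients of every real analytic \<open>2\<pi>\<close>-periodic
  function of zero mean belong to it for some \<open>s > 0\<close>.\<close>

definition coeff_space :: "real \<Rightarrow> (int \<Rightarrow> complex) set" where
  "coeff_space s = {a. a 0 = 0 \<and> (\<lambda>k. norm (a k) * exp (s * \<bar>of_int k\<bar>)) summable_on UNIV}"

definition coeff_norm :: "real \<Rightarrow> (int \<Rightarrow> complex) \<Rightarrow> real" where
  "coeff_norm s a = (\<Sum>\<^sub>\<infinity>k\<in>UNIV. norm (a k) * exp (s * \<bar>of_int k\<bar>))"

text \<open>\<open>A\<close> is an \<open>m\<close>-linear form on \<open>coeff_space s\<close> of norm at most \<open>C\<close>; its \<open>m\<close> arguments are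
  given as a list.\<close>

definition multilinear_form :: "real \<Rightarrow> nat \<Rightarrow> real \<Rightarrow> ((int \<Rightarrow> complex) list \<Rightarrow> complex) \<Rightarrow> bool" where
  "multilinear_form s m C A \<longleftrightarrow>
     (\<forall>xs. length xs = m \<and> set xs \<subseteq> coeff_space s \<longrightarrow>
        norm (A xs) \<le> C * (\<Prod>i<m. coeff_norm s (xs ! i)) \<and>
        (\<forall>i<m. \<forall>u\<in>coeff_space s. \<forall>v\<in>coeff_space s. \<forall>\<alpha> \<beta>.
           A (xs[i := (\<lambda>k. \<alpha> * u k + \<beta> * v k)]) = \<alpha> * A (xs[i := u]) + \<beta> * A (xs[i := v])))"

text \<open>Analyticity in the sense of Banach spaces: around every point, \<open>F\<close> is the sum of a power
  series of bounded homogeneous polynomials with positive radius of convergence.\<close>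

definition coeff_analytic :: "real \<Rightarrow> ((int \<Rightarrow> complex) \<Rightarrow> complex) \<Rightarrow> bool" where
  "coeff_analytic s F \<longleftrightarrow>
     (\<forall>a\<in>coeff_space s. \<exists>C>0. \<exists>R>0. \<exists>A.
        (\<forall>m. multilinear_form s m (C * R ^ m) (A m)) \<and>
        (\<forall>x\<in>coeff_space s. R * coeff_norm s x < 1 \<longrightarrow>
           (\<lambda>m. A m (replicate m x)) sums F (\<lambda>k. a k + x k)))"

end

theory Submission imports Defs
begin

text \<open>
  The coefficient \<open>\<chi>\<^bsup>[-1]\<^esup>\<close> is the amplitude of the slowest exponential in the difference
  \<open>\<Delta> = \<psi>\<^sup>- - \<psi>\<^sup>+\<close>. By hypothesis \<open>\<Delta>\<close> is a power series in \<open>e\<^bsup>-iw\<^esup>\<close> with \<open>w = z - \<tau> + \<mu>\<gg>\<close>, and \<open>\<gg>\<close> is of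
  order \<open>1/z\<close>, so that the first Fourier coefficient of \<open>e\<^bsup>iz\<^esup>\<Delta>\<close> tends to \<open>\<chi>\<^bsup>[-1]\<^esup>(\<mu>)\<close> as \<open>z \<rightarrow> -i\<infinity>\<close>. The convergence
  is uniform in \<open>\<mu>\<close>, so that it holds for all derivatives at \<open>\<mu> = 0\<close> as well (\<open>coefficient_limit\<close>).
  What remains is to find the expansion of the two solutions in powers of \<open>\<mu>\<close>.

  The coefficient \<open>u\<close> of \<open>\<mu>\<^sup>j e\<^bsup>ik\<tau>\<^esup>\<close> in a solution satisfies a linear equation \<open>u' + iku = f\<close>. For
  \<open>j = 1\<close> the source \<open>f\<close> is \<open>-2g\<^bsup>[k]\<^esup>/z\<^sup>2\<close>; for \<open>j > 1\<close> it is quadratic in the coefficients of lower order. A bounded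
  solution with \<open>k \<noteq> 0\<close> is unique on a domain that contains with each point a ray on which \<open>e\<^bsup>ikz\<^esup>\<close> decays.
  Hence all these coefficients are determined by \<open>g\<close>, and they are given by a recursion that only
  involves the half-planes \<open>half 1\<close> and \<open>half (-1)\<close> (\<open>solution_modes\<close>).

  On the negative imaginary axis the two bounded solutions of the linear equation with the same source
  differ by a multiple of \<open>e\<^bsup>-ikz\<^esup>\<close>, which is zero for \<open>k < 0\<close> and of size \<open>e\<^bsup>-ky\<^esup>\<close> at \<open>z = -iy\<close> for
  \<open>k > 0\<close>. Only the frequency \<open>k = 1\<close> contributes at the order \<open>e\<^bsup>-y\<^esup>\<close>. By the definition of \<open>n(g)\<close>
  this frequency does not occur in the source at orders below \<open>n\<close>, so the corresponding derivatives of
  \<open>\<chi>\<^bsup>[-1]\<^esup>\<close> vanish. The branches of everything that enters the order \<open>n\<close> differ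
  by \<open>O(e\<^bsup>-3y/2\<^esup>)\<close> only, and the derivative of order \<open>n\<close> is \<open>n!\<close> times the limit of \<open>e\<^sup>y\<close> times the difference of the branches
  at \<open>k = 1\<close> (\<open>coefficient_of_minimal_order\<close>).

  For the analytic dependence on the Fourier coefficients, the recursion is polarized: it takes a list
  of sequences instead of \<open>n\<close> copies of one sequence, and it discards the frequency \<open>1\<close> at all orders
  before the last, so that the limit exists for arbitrary sequences. The limit, \<open>splitting\<close>, is then a bounded
  \<open>n\<close>-linear form, and \<open>F n a\<close> is its value at \<open>n\<close> copies of \<open>a\<close>, a continuous homogeneous polynomial.

  For \<open>n = 1\<close> the limit is a residue of \<open>e\<^bsup>iz\<^esup>/z\<^sup>2\<close> (\<open>inverse_square_jump\<close>). For \<open>n = 2\<close> it suffices, by bilinearity,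
  to evaluate it at pairs of unit sequences, that is, for one product of two bounded solutions; the source
  can then be reduced to a multiple of \<open>1/z\<^sup>2\<close> (\<open>splitting_unit_seqs\<close>).
\<close>

section \<open>Fourier coefficients\<close>

lemma fourier_integrable:
  assumes "continuous_on {0..2*pi} f"
  shows "(\<lambda>t. f t * exp (- (\<i> * of_int k * of_real t))) integrable_on {0..2*pi}"
  by (intro integrable_continuous_interval continuous_intros assms)

lemma fourier_coeff_add:
  assumes "continuous_on {0..2*pi} f" "continuous_on {0..2*pi} g"
  shows "fourier_coeff (\<lambda>t. f t + g t) k = fourier_coeff f k + fourier_coeff g k"
  unfolding fourier_coeff_def
  using integral_add[OF fourier_integrable[OF assms(1)] fourier_integrable[OF assms(2)], of k k]
  by (simp add: distrib_right distrib_left)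

lemma fourier_coeff_diff:
  assumes "continuous_on {0..2*pi} f" "continuous_on {0..2*pi} g"
  shows "fourier_coeff (\<lambda>t. f t - g t) k = fourier_coeff f k - fourier_coeff g k"
  unfolding fourier_coeff_def
  using integral_diff[OF fourier_integrable[OF assms(1)] fourier_integrable[OF assms(2)], of k k]
  by (simp add: left_diff_distrib right_diff_distrib)

lemma fourier_coeff_cmult:
  "fourier_coeff (\<lambda>t. c * f t) k = c * fourier_coeff f k"
  unfolding fourier_coeff_def
  using integral_mult_right[of "{0..2*pi}" c "\<lambda>t. f t * exp (- (\<i> * of_int k * of_real t))"]
  by (simp add: algebra_simps)

lemma fourier_coeff_cdiv:
  "fourier_coeff (\<lambda>t. f t / c) k = fourier_coeff f k / c"
  using fourier_coeff_cmult[of "1 / c" f k] by simp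

lemma fourier_coeff_zero [simp]: "fourier_coeff (\<lambda>t. 0) k = 0"
  unfolding fourier_coeff_def by simp

lemma fourier_coeff_sum:
  assumes "finite A" "\<And>i. i \<in> A \<Longrightarrow> continuous_on {0..2*pi} (f i)"
  shows "fourier_coeff (\<lambda>t. \<Sum>i\<in>A. f i t) k = (\<Sum>i\<in>A. fourier_coeff (f i) k)"
  using assms
proof (induction A rule: finite_induct)
  case (insert x F)
  then show ?case
    by (simp add: fourier_coeff_add continuous_on_sum)
qed simp

lemma norm_fourier_coeff_le:
  assumes "continuous_on {0..2*pi} f" "\<And>t. t \<in> {0..2*pi} \<Longrightarrow> norm (f t) \<le> B"
  shows "norm (fourier_coeff f k) \<le> B"
proof -
  have "norm (integral {0..2*pi} (\<lambda>t. f t * exp (- (\<i> * of_int k * of_real t)))) \<le> B * (2*pi - 0)"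
    by (rule integral_bound) (use assms in \<open>auto intro!: continuous_intros simp: norm_mult\<close>)
  then show ?thesis
    unfolding fourier_coeff_def by (simp add: norm_mult norm_divide field_simps)
qed

lemma integral_exp_int:
  fixes k :: int
  shows "integral {0..2*pi} (\<lambda>t. exp (\<i> * of_int k * of_real t)) = (if k = 0 then 2 * pi else 0)"
proof (cases "k = 0")
  case False
  have "((\<lambda>t. exp (\<i> * of_int k * of_real t)) has_integral
      exp (\<i> * of_int k * of_real (2*pi)) / (\<i> * of_int k) - exp (\<i> * of_int k * of_real 0) / (\<i> * of_int k)) {0..2*pi}"
    using False
    by (intro fundamental_theorem_of_calculus)
      (auto intro!: derivative_eq_intros has_vector_derivative_real_field simp: field_simps)
  moreover have "exp (\<i> * of_int k * of_real (2*pi)) = 1"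
    using exp_integer_2pi[of "of_int k"] by (simp add: mult_ac)
  ultimately show ?thesis using False by (simp add: integral_unique)
qed (simp add: scaleR_conv_of_real)

lemma fourier_coeff_exp:
  "fourier_coeff (\<lambda>t. exp (\<i> * of_int l * of_real t)) k = (if k = l then 1 else 0)"
proof -
  have "(\<lambda>t. exp (\<i> * of_int l * of_real t) * exp (- (\<i> * of_int k * of_real t)))
      = (\<lambda>t. exp (\<i> * of_int (l - k) * of_real t))"
    by (simp add: exp_add[symmetric] algebra_simps)
  then show ?thesis unfolding fourier_coeff_def using integral_exp_int[of "l - k"]
    by (auto simp: scaleR_conv_of_real)
qed

lemma fourier_coeff_shift:
  "fourier_coeff (\<lambda>t. exp (\<i> * of_int l * of_real t) * f t) k = fourier_coeff f (k - l)"
proof -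
  have "exp (\<i> * of_int l * of_real t) * f t * exp (- (\<i> * of_int k * of_real t))
      = f t * exp (- (\<i> * of_int (k - l) * of_real t))" for t
    by (simp add: left_diff_distrib right_diff_distrib exp_diff exp_minus divide_inverse mult_ac)
  then show ?thesis unfolding fourier_coeff_def by presburger
qed

lemma continuous_on_fourier_coeff:
  fixes F :: "'a::topological_space \<Rightarrow> real \<Rightarrow> complex"
  assumes "continuous_on (X \<times> UNIV) (\<lambda>(x, t). F x t)"
  shows "continuous_on X (\<lambda>x. fourier_coeff (F x) k)"
proof -
  have "continuous_on X (\<lambda>x. integral (cbox 0 (2*pi)) (\<lambda>t. F x t * exp (- (\<i> * of_int k * of_real t))))"
  proof (rule integral_continuous_on_param)
    have "continuous_on (X \<times> cbox 0 (2*pi)) (\<lambda>p. (case p of (x, t) \<Rightarrow> F x t) * exp (- (\<i> * of_int k * of_real (snd p))))"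
      by (intro continuous_intros continuous_on_subset[OF assms]) auto
    then show "continuous_on (X \<times> cbox 0 (2*pi)) (\<lambda>(x, t). F x t * exp (- (\<i> * of_int k * of_real t)))"
      by (simp add: case_prod_unfold)
  qed
  then show ?thesis unfolding fourier_coeff_def by (auto intro!: continuous_intros)
qed

lemma has_field_derivative_fourier_coeff:
  fixes F F' :: "complex \<Rightarrow> real \<Rightarrow> complex"
  assumes "open U" "x0 \<in> U"
    and deriv: "\<And>x t. x \<in> U \<Longrightarrow> ((\<lambda>x. F x t) has_field_derivative F' x t) (at x)"
    and cont: "\<And>x. x \<in> U \<Longrightarrow> continuous_on {0..2*pi} (F x)"
    and cont': "continuous_on (U \<times> UNIV) (\<lambda>(x, t). F' x t)"
  shows "((\<lambda>x. fourier_coeff (F x) k) has_field_derivative fourier_coeff (F' x0) k) (at x0)"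
proof -
  obtain r where r: "r > 0" "ball x0 r \<subseteq> U" using assms by (meson openE)
  have "((\<lambda>x. integral (cbox 0 (2*pi)) (\<lambda>t. F x t * exp (- (\<i> * of_int k * of_real t)))) has_field_derivative
       integral (cbox 0 (2*pi)) (\<lambda>t. F' x0 t * exp (- (\<i> * of_int k * of_real t)))) (at x0 within ball x0 r)"
  proof (rule leibniz_rule_field_derivative)
    fix x and t :: real assume "x \<in> ball x0 r"
    then have "((\<lambda>x. F x t) has_field_derivative F' x t) (at x within ball x0 r)"
      using r deriv has_field_derivative_at_within by blast
    then show "((\<lambda>x. F x t * exp (- (\<i> * of_int k * of_real t))) has_field_derivative
        F' x t * exp (- (\<i> * of_int k * of_real t))) (at x within ball x0 r)"
      by (rule DERIV_cmult_right)
  next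
    fix x assume "x \<in> ball x0 r"
    then show "(\<lambda>t. F x t * exp (- (\<i> * of_int k * of_real t))) integrable_on cbox 0 (2*pi)"
      using fourier_integrable[OF cont, of x k] r by auto
  next
    have "continuous_on (ball x0 r \<times> cbox 0 (2*pi)) (\<lambda>p. (case p of (x, t) \<Rightarrow> F' x t) * exp (- (\<i> * of_int k * of_real (snd p))))"
      by (intro continuous_intros continuous_on_subset[OF cont']) (use r in auto)
    then show "continuous_on (ball x0 r \<times> cbox 0 (2*pi)) (\<lambda>(x, t). F' x t * exp (- (\<i> * of_int k * of_real t)))"
      by (simp add: case_prod_unfold)
  qed (use r in auto)
  then have "((\<lambda>x. integral {0..2*pi} (\<lambda>t. F x t * exp (- (\<i> * of_int k * of_real t)))) has_field_derivative
       integral {0..2*pi} (\<lambda>t. F' x0 t * exp (- (\<i> * of_int k * of_real t)))) (at x0)"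
    using r by (simp add: at_within_open[OF centre_in_ball[THEN iffD2] open_ball])
  then show ?thesis unfolding fourier_coeff_def by (rule DERIV_cmult)
qed

lemma fourier_coeff_swap:
  assumes "continuous_on UNIV (\<lambda>(t, s). F t s)"
  shows "fourier_coeff (\<lambda>t. fourier_coeff (\<lambda>s. F t s) j) k = fourier_coeff (\<lambda>s. fourier_coeff (\<lambda>t. F t s) k) j"
proof -
  let ?e = "\<lambda>k t. exp (- (\<i> * of_int k * of_real t))"
  have "continuous_on (cbox (0,0) (2*pi,2*pi)) (\<lambda>p. (case p of (t, s) \<Rightarrow> F t s) * ?e j (snd p) * ?e k (fst p))"
    by (intro continuous_intros continuous_on_subset[OF assms]) auto
  then have "integral {0..2*pi} (\<lambda>t. integral {0..2*pi} (\<lambda>s. F t s * ?e j s * ?e k t))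
      = integral {0..2*pi} (\<lambda>s. integral {0..2*pi} (\<lambda>t. F t s * ?e j s * ?e k t))"
    using integral_swap_continuous[of 0 0 "2*pi" "2*pi" "\<lambda>t s. F t s * ?e j s * ?e k t"]
    by (simp add: case_prod_unfold)
  moreover have "integral {0..2*pi} (\<lambda>t. c * integral {0..2*pi} (\<lambda>s. F t s * ?e j s) * ?e k t)
      = c * integral {0..2*pi} (\<lambda>t. integral {0..2*pi} (\<lambda>s. F t s * ?e j s * ?e k t))" for c
  proof -
    have "c * integral {0..2*pi} (\<lambda>s. F t s * ?e j s) * ?e k t = c * integral {0..2*pi} (\<lambda>s. F t s * ?e j s * ?e k t)" for t
      by (subst integral_mult_left) (rule mult.assoc)
    then show ?thesis by (simp only: integral_mult_right)
  qed
  moreover have "integral {0..2*pi} (\<lambda>s. c * integral {0..2*pi} (\<lambda>t. F t s * ?e k t) * ?e j s)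
      = c * integral {0..2*pi} (\<lambda>s. integral {0..2*pi} (\<lambda>t. F t s * ?e j s * ?e k t))" for c
  proof -
    have "F t s * ?e j s * ?e k t = F t s * ?e k t * ?e j s" for t s by (simp only: mult_ac)
    then have "c * integral {0..2*pi} (\<lambda>t. F t s * ?e k t) * ?e j s = c * integral {0..2*pi} (\<lambda>t. F t s * ?e j s * ?e k t)" for s
      by (simp only: integral_mult_left) (rule mult.assoc)
    then show ?thesis by (simp only: integral_mult_right)
  qed
  ultimately show ?thesis
    unfolding fourier_coeff_def by (simp only:)
qed

lemma fourier_coeff_deriv:
  assumes deriv: "\<And>t. (h has_vector_derivative h' t) (at t)"
    and cont: "continuous_on UNIV h'" and per: "h (2*pi) = h 0"
  shows "fourier_coeff h' k = \<i> * of_int k * fourier_coeff h k"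
proof -
  let ?e = "\<lambda>t. exp (- (\<i> * of_int k * of_real t))"
  have conth: "continuous_on UNIV h"
    by (meson continuous_at_imp_continuous_on deriv has_vector_derivative_continuous)
  have e: "(?e has_vector_derivative - (\<i> * of_int k) * ?e t) (at t within S)" for t S
    by (auto intro!: derivative_eq_intros has_vector_derivative_real_field)
  have "((\<lambda>t. h' t * ?e t - \<i> * of_int k * (h t * ?e t)) has_integral (h (2*pi) * ?e (2*pi) - h 0 * ?e 0)) {0..2*pi}"
  proof (rule fundamental_theorem_of_calculus)
    fix t :: real
    have "((\<lambda>t. h t * ?e t) has_vector_derivative (h t * (- (\<i> * of_int k) * ?e t) + h' t * ?e t)) (at t within {0..2*pi})"
      by (rule has_vector_derivative_mult[OF has_vector_derivative_at_within[OF deriv] e])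
    then show "((\<lambda>t. h t * ?e t) has_vector_derivative (h' t * ?e t - \<i> * of_int k * (h t * ?e t))) (at t within {0..2*pi})"
      by (simp add: algebra_simps)
  qed simp
  moreover have "?e (2*pi) = 1"
    using exp_integer_2pi[of "of_int k"] by (simp add: exp_minus mult_ac)
  ultimately have "integral {0..2*pi} (\<lambda>t. h' t * ?e t - \<i> * of_int k * (h t * ?e t)) = 0"
    using per by (simp add: integral_unique)
  moreover have "integral {0..2*pi} (\<lambda>t. h' t * ?e t - \<i> * of_int k * (h t * ?e t))
     = integral {0..2*pi} (\<lambda>t. h' t * ?e t) - \<i> * of_int k * integral {0..2*pi} (\<lambda>t. h t * ?e t)"
    by (subst integral_diff)
      (auto intro!: integrable_continuous_interval continuous_intros continuous_on_subset[OF cont] continuous_on_subset[OF conth])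
  ultimately show ?thesis unfolding fourier_coeff_def by simp
qed

text \<open>Cauchy's formula on the circle of radius \<open>r\<close>. In this form the expansions in \<open>\<mu>\<close> and in \<open>\<tau>\<close>
  are treated by the same facts.\<close>

lemma taylor_coeff_eq_fourier_coeff:
  assumes hol: "h holomorphic_on ball c R" and r: "0 < r" "r < R"
  shows "(deriv ^^ j) h c / fact j = fourier_coeff (\<lambda>s. h (c + of_real r * exp (\<i> * of_real s))) (int j) / of_real r ^ j"
proof -
  have cb: "cball c r \<subseteq> ball c R" using r by auto
  have "((\<lambda>u. h u / (u - c) ^ Suc j) has_contour_integral (2 * pi * \<i>) / fact j * (deriv ^^ j) h c) (circlepath c r)"
    by (rule Cauchy_has_contour_integral_higher_derivative_circlepath)
      (use r cb in \<open>auto intro: holomorphic_on_imp_continuous_on holomorphic_on_subset[OF hol]\<close>)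
  then have "((\<lambda>t. h (c + of_real r * cis t) / (c + of_real r * cis t - c) ^ Suc j * of_real r * \<i> * cis t)
      has_integral (2 * pi * \<i>) / fact j * (deriv ^^ j) h c) {0..2*pi}"
    unfolding circlepath_def by (subst (asm) has_contour_integral_part_circlepath_iff) simp_all
  then have "((\<lambda>x. \<i> / of_real r ^ j * (h (c + of_real r * exp (\<i> * of_real x)) * exp (- (\<i> * of_int (int j) * of_real x)))) has_integral (2 * pi * \<i>) / fact j * (deriv ^^ j) h c) {0..2*pi}"
  proof (rule has_integral_eq[rotated])
    fix x :: real
    have e: "exp (- (\<i> * of_int (int j) * of_real x)) = 1 / cis x ^ j"
      unfolding cis_conv_exp by (simp add: exp_minus inverse_eq_divide exp_of_nat_mult[symmetric] mult_ac)
    have "H / (R * C) ^ Suc j * R * \<i> * C = \<i> / R ^ j * (H * (1 / C ^ j))" if "R \<noteq> 0" "C \<noteq> 0" for H R C :: complex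
      using that by (simp add: power_mult_distrib)
    from this[of "of_real r" "cis x"] show "h (c + of_real r * cis x) / (c + of_real r * cis x - c) ^ Suc j * of_real r * \<i> * cis x =
      \<i> / of_real r ^ j * (h (c + of_real r * exp (\<i> * of_real x)) * exp (- (\<i> * of_int (int j) * of_real x)))"
      using r unfolding e cis_conv_exp[symmetric] by simp
  qed
  then have "integral {0..2*pi} (\<lambda>x. \<i> / of_real r ^ j * (h (c + of_real r * exp (\<i> * of_real x)) * exp (- (\<i> * of_int (int j) * of_real x)))) = (2 * pi * \<i>) / fact j * (deriv ^^ j) h c"
    by (rule integral_unique)
  then have *: "\<i> / of_real r ^ j * integral {0..2*pi} (\<lambda>x. h (c + of_real r * exp (\<i> * of_real x)) * exp (- (\<i> * of_int (int j) * of_real x)))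
     = (2 * pi * \<i>) / fact j * (deriv ^^ j) h c"
    by (simp only: integral_mult_right)
  have gen: "D / F = 1 / (2 * pi) * X / R" if "\<i> / R * X = (2 * pi * \<i>) / F * D" "R \<noteq> 0" "F \<noteq> 0" for R X F D :: complex
    using that by (simp add: divide_simps mult_ac)
  from gen[OF *] show ?thesis unfolding fourier_coeff_def using r by simp
qed

lemma cis_eq_cis_imp:
  assumes "cis a = cis b"
  obtains n :: int where "a = b + 2 * pi * of_int n"
proof -
  have "sin a = sin b \<and> cos a = cos b" using assms by (simp add: complex_eq_iff)
  then show ?thesis using that sin_cos_eq_iff[of a b] by (auto simp: mult_ac)
qed

lemma periodic_int:
  fixes f :: "real \<Rightarrow> 'a"
  assumes "\<And>t. f (t + 2 * pi) = f t"
  shows "f (t + 2 * pi * of_int n) = f t"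
proof -
  have nat: "f (t + 2 * pi * of_nat m) = f t" for t m
  proof (induction m)
    case (Suc m)
    have "f (t + 2 * pi * of_nat (Suc m)) = f ((t + 2 * pi * of_nat m) + 2 * pi)"
      by (simp add: algebra_simps)
    then show ?case using assms Suc by simp
  qed simp
  show ?thesis
  proof (cases "n \<ge> 0")
    case True
    then show ?thesis using nat[of t "nat n"] by simp
  next
    case False
    then show ?thesis using nat[of "t + 2 * pi * of_int n" "nat (- n)"] by (simp add: algebra_simps)
  qed
qed

definition null_fourier :: "(real \<Rightarrow> complex) \<Rightarrow> bool" where
  "null_fourier f \<longleftrightarrow> continuous_on UNIV f \<and> (\<forall>t. f (t + 2 * pi) = f t) \<and> (\<forall>k. fourier_coeff f k = 0)"

lemma null_fourier_add: "null_fourier f \<Longrightarrow> null_fourier g \<Longrightarrow> null_fourier (\<lambda>t. f t + g t)"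
  unfolding null_fourier_def
  by (auto intro!: continuous_intros simp: fourier_coeff_add[OF continuous_on_subset continuous_on_subset])

lemma null_fourier_cmult: "null_fourier f \<Longrightarrow> null_fourier (\<lambda>t. c * f t)"
  unfolding null_fourier_def by (auto intro!: continuous_intros simp: fourier_coeff_cmult)

lemma null_fourier_shift: "null_fourier f \<Longrightarrow> null_fourier (\<lambda>t. exp (\<i> * of_int l * of_real t) * f t)"
proof -
  have "exp (\<i> * of_int l * (of_real t + of_real (2 * pi))) = exp (\<i> * of_int l * of_real t)" for t
    using exp_integer_2pi[of "of_int l"] by (simp add: distrib_left exp_add mult_ac)
  then show "null_fourier f \<Longrightarrow> ?thesis"
    unfolding null_fourier_def
    by (auto intro!: continuous_intros simp: fourier_coeff_shift)
qed

text \<open>The functions whose Fourier coefficients all vanish are stable under multiplication by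
  \<open>e\<^bsup>\<plusminus>it\<^esup>\<close>, hence by all polynomials on the unit circle. As these are dense in the continuous
  functions, such a function is orthogonal to itself (\<open>null_fourier_imp_zero\<close>).\<close>

lemma null_fourier_polynomial:
  fixes p :: "complex \<Rightarrow> real"
  assumes "real_polynomial_function p" "null_fourier f"
  shows "null_fourier (\<lambda>t. of_real (p (cis t)) * f t)"
  using assms
proof (induction p arbitrary: f rule: real_polynomial_function.induct)
  case (linear h)
  interpret h: bounded_linear h by fact
  have "h (cis t) = cos t * h 1 + sin t * h \<i>" for t
  proof -
    have "cis t = cos t *\<^sub>R 1 + sin t *\<^sub>R \<i>" by (simp add: complex_eq_iff)
    then show ?thesis by (simp only: h.add h.scaleR) simp
  qed
  moreover have "complex_of_real (cos t) = (exp (\<i> * of_int 1 * of_real t) + exp (\<i> * of_int (-1) * of_real t)) / 2"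
    "complex_of_real (sin t) = - \<i> * (exp (\<i> * of_int 1 * of_real t) - exp (\<i> * of_int (-1) * of_real t)) / 2" for t
    by (simp_all add: cos_of_real[symmetric] sin_of_real[symmetric] cos_exp_eq sin_exp_eq field_simps)
  moreover have "((P + Q) / 2 * a + (- \<i> * (P - Q) / 2) * b) * c = ((a - \<i> * b) / 2) * (P * c) + ((a + \<i> * b) / 2) * (Q * c)"
    for P Q a b c :: complex
    by (simp add: field_simps)
  ultimately have "of_real (h (cis t)) * f t = ((h 1 - \<i> * h \<i>) / 2) * (exp (\<i> * of_int 1 * of_real t) * f t)
      + ((h 1 + \<i> * h \<i>) / 2) * (exp (\<i> * of_int (-1) * of_real t) * f t)" for t
    by (simp only: of_real_add of_real_mult)
  then show ?case
    by (simp only:) (intro null_fourier_add null_fourier_cmult null_fourier_shift linear)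
next
  case (const c)
  then show ?case by (intro null_fourier_cmult)
next
  case (add p q)
  then show ?case using null_fourier_add[OF add.IH(1)[OF add.prems] add.IH(2)[OF add.prems]]
    by (simp add: distrib_right)
next
  case (mult p q)
  then show ?case using mult.IH(1)[OF mult.IH(2)[OF mult.prems]] by (simp add: mult_ac)
qed

text \<open>At a point of the negative real axis, where \<open>Arg\<close> jumps, it can be replaced by \<open>Arg2pi\<close>: the two
  differ by a multiple of the period.\<close>

lemma continuous_on_periodic_Arg:
  fixes f :: "real \<Rightarrow> 'a::topological_space"
  assumes "continuous_on UNIV f" "\<And>t. f (t + 2 * pi) = f t"
  shows "continuous_on (- {0}) (\<lambda>z. f (Arg z))"
proof -
  have eq: "f (Arg z) = f (Arg2pi z)" if "z \<noteq> 0" for z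
  proof -
    have "cis (Arg z) = cis (Arg2pi z)"
      using that by (metis Arg2pi_eq cis_Arg cis_conv_exp sgn_eq nonzero_mult_div_cancel_left norm_eq_zero of_real_eq_0_iff)
    then obtain n where "Arg z = Arg2pi z + 2 * pi * of_int n" by (rule cis_eq_cis_imp)
    then show ?thesis using periodic_int[of f] assms(2) by simp
  qed
  have cf: "continuous (at x) f" for x using assms(1) by (simp add: continuous_on_eq_continuous_at)
  have "continuous (at z) (\<lambda>z. f (Arg z))" if "z \<noteq> 0" for z
  proof (cases "z \<in> \<real>\<^sub>\<le>\<^sub>0")
    case False
    then show ?thesis
      using continuous_at_compose[OF continuous_at_Arg cf] by (simp add: o_def)
  next
    case True
    with that have "z \<notin> \<real>\<^sub>\<ge>\<^sub>0"
      by (auto simp: complex_nonneg_Reals_iff complex_nonpos_Reals_iff complex_eq_iff)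
    then have "continuous (at z) (\<lambda>z. f (Arg2pi z))"
      using continuous_at_compose[OF continuous_at_Arg2pi cf] by (simp add: o_def)
    moreover have "\<forall>\<^sub>F w in nhds z. f (Arg2pi w) = f (Arg w)"
    proof -
      have "\<forall>\<^sub>F w in nhds z. w \<in> - {0}" by (rule eventually_nhds_in_open) (use that in auto)
      then show ?thesis by eventually_elim (simp add: eq)
    qed
    ultimately show ?thesis using isCont_cong[of "\<lambda>w. f (Arg2pi w)" "\<lambda>w. f (Arg w)" z] by simp
  qed
  then show ?thesis by (simp add: continuous_at_imp_continuous_on)
qed

lemma null_fourier_imp_zero:
  assumes "null_fourier f"
  shows "f t = 0"
proof -
  have cont: "continuous_on UNIV f" and per: "\<And>t. f (t + 2 * pi) = f t"
    using assms by (auto simp: null_fourier_def)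
  have F: "f (Arg (cis t)) = f t" for t
  proof -
    have "cis (Arg (cis t)) = cis t" by (subst cis_Arg) (auto simp: sgn_eq)
    then obtain n where "Arg (cis t) = t + 2 * pi * of_int n" by (rule cis_eq_cis_imp)
    then show ?thesis using periodic_int[of f] per by simp
  qed
  have contF: "continuous_on (sphere 0 1) (\<lambda>z. cnj (f (Arg z)))"
    by (intro continuous_intros continuous_on_subset[OF continuous_on_periodic_Arg[OF cont per]]) auto
  obtain B where B: "\<And>t. t \<in> {0..2*pi} \<Longrightarrow> norm (f t) \<le> B" "B > 0"
  proof -
    have "bounded (f ` {0..2*pi})"
      by (intro compact_imp_bounded compact_continuous_image continuous_on_subset[OF cont]) auto
    then show ?thesis using that unfolding bounded_pos by force
  qed
  have cf: "continuous_on {0..2*pi} f" by (rule continuous_on_subset[OF cont]) auto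
  have small: "norm (fourier_coeff (\<lambda>t. cnj (f t) * f t) 0) \<le> e * B" if e: "e > 0" for e
  proof -
    obtain g where g: "polynomial_function g" "\<And>x. x \<in> sphere 0 1 \<Longrightarrow> norm (cnj (f (Arg x)) - g x) < e"
      using Stone_Weierstrass_polynomial_function[OF compact_sphere contF e] by auto
    have rp: "real_polynomial_function (\<lambda>x. Re (g x))" "real_polynomial_function (\<lambda>x. Im (g x))"
      using g(1) bounded_linear_Re bounded_linear_Im by (auto simp: polynomial_function_def o_def)
    have "null_fourier (\<lambda>t. of_real (Re (g (cis t))) * f t + \<i> * (of_real (Im (g (cis t))) * f t))"
      by (intro null_fourier_add null_fourier_cmult null_fourier_polynomial rp assms)
    also have "(\<lambda>t. of_real (Re (g (cis t))) * f t + \<i> * (of_real (Im (g (cis t))) * f t)) = (\<lambda>t. g (cis t) * f t)"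
      by (simp add: fun_eq_iff complex_eq_iff algebra_simps)
    finally have n: "null_fourier (\<lambda>t. g (cis t) * f t)" .
    then have cg: "continuous_on {0..2*pi} (\<lambda>t. g (cis t) * f t)"
      by (auto simp: null_fourier_def intro: continuous_on_subset)
    have "fourier_coeff (\<lambda>t. cnj (f t) * f t) 0 = fourier_coeff (\<lambda>t. cnj (f t) * f t) 0 - fourier_coeff (\<lambda>t. g (cis t) * f t) 0"
      using n by (simp add: null_fourier_def)
    also have "\<dots> = fourier_coeff (\<lambda>t. cnj (f t) * f t - g (cis t) * f t) 0"
      by (intro fourier_coeff_diff[symmetric] continuous_intros cf cg)
    also have "norm \<dots> \<le> e * B"
    proof (rule norm_fourier_coeff_le)
      fix t assume t: "t \<in> {0..2*pi}"
      have "norm (cnj (f t) - g (cis t)) \<le> e" using g(2)[of "cis t"] F[of t] by simp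
      then have "norm (cnj (f t) - g (cis t)) * norm (f t) \<le> e * B"
        using B t e by (intro mult_mono) auto
      then show "norm (cnj (f t) * f t - g (cis t) * f t) \<le> e * B"
        by (simp add: norm_mult[symmetric] algebra_simps)
    qed (intro continuous_intros cf cg)
    finally show ?thesis .
  qed
  have "norm (fourier_coeff (\<lambda>t. cnj (f t) * f t) 0) \<le> 0"
  proof (rule field_le_epsilon)
    fix e :: real assume "e > 0"
    then show "norm (fourier_coeff (\<lambda>t. cnj (f t) * f t) 0) \<le> 0 + e"
      using small[of "e / B"] B by simp
  qed
  moreover have "fourier_coeff (\<lambda>t. cnj (f t) * f t) 0 = of_real (1 / (2 * pi) * integral {0..2*pi} (\<lambda>t. (norm (f t))\<^sup>2))"
  proof -
    have "((\<lambda>t. complex_of_real ((norm (f t))\<^sup>2)) has_integral of_real (integral {0..2*pi} (\<lambda>t. (norm (f t))\<^sup>2))) {0..2*pi}"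
      by (intro has_integral_of_real integrable_integral integrable_continuous_interval continuous_intros cf)
    then have "integral {0..2*pi} (\<lambda>t. complex_of_real ((norm (f t))\<^sup>2)) = of_real (integral {0..2*pi} (\<lambda>t. (norm (f t))\<^sup>2))"
      by (rule integral_unique)
    moreover have "cnj (f t) * f t = complex_of_real ((norm (f t))\<^sup>2)" for t
      using complex_norm_square[of "f t"] by (simp add: mult.commute)
    ultimately show ?thesis unfolding fourier_coeff_def by simp
  qed
  ultimately have "integral {0..2*pi} (\<lambda>t. (norm (f t))\<^sup>2) = 0" by simp
  then have z: "\<forall>t\<in>{0..2*pi}. (norm (f t))\<^sup>2 = 0"
    by (subst (asm) integral_eq_0_iff) (auto intro!: continuous_intros cf)
  obtain n :: int where n: "t + 2 * pi * of_int n \<in> {0..2*pi}"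
  proof -
    have "- of_int \<lfloor>t / (2*pi)\<rfloor> * (2 * pi) + t \<ge> 0 \<and> - of_int \<lfloor>t / (2*pi)\<rfloor> * (2 * pi) + t \<le> 2 * pi"
      using floor_divide_lower[of "2*pi" t] floor_divide_upper[of "2*pi" t] by (simp add: algebra_simps)
    then show ?thesis using that[of "- \<lfloor>t / (2*pi)\<rfloor>"] by (simp add: algebra_simps)
  qed
  have "f (t + 2 * pi * of_int n) = 0" using z n by auto
  then show ?thesis using periodic_int[of f t n] per by simp
qed

lemma fourier_coeff_uniform_limit:
  assumes "uniform_limit {0..2*pi} F f net" "net \<noteq> bot"
    "\<And>n. continuous_on {0..2*pi} (F n)"
  shows "continuous_on {0..2*pi} f" "((\<lambda>n. fourier_coeff (F n) k) \<longlongrightarrow> fourier_coeff f k) net"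
proof -
  show cf: "continuous_on {0..2*pi} f"
    by (rule uniform_limit_theorem[OF _ assms(1) assms(2)]) (use assms(3) in auto)
  show "((\<lambda>n. fourier_coeff (F n) k) \<longlongrightarrow> fourier_coeff f k) net"
  proof (rule tendstoI)
    fix e :: real assume "e > 0"
    then have "\<forall>\<^sub>F n in net. \<forall>x\<in>{0..2*pi}. dist (F n x) (f x) < e / 2"
      using assms(1) half_gt_zero unfolding uniform_limit_iff by blast
    then show "\<forall>\<^sub>F n in net. dist (fourier_coeff (F n) k) (fourier_coeff f k) < e"
    proof eventually_elim
      case (elim n)
      have "norm (fourier_coeff (\<lambda>t. F n t - f t) k) \<le> e / 2"
        by (rule norm_fourier_coeff_le) (use elim assms(3) cf in \<open>auto intro!: continuous_intros simp: dist_norm less_imp_le\<close>)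
      then show ?case using \<open>e > 0\<close> by (simp add: fourier_coeff_diff[OF assms(3) cf] dist_norm)
    qed
  qed
qed

text \<open>The sum of the series is a continuous function with the same Fourier coefficients as \<open>f\<close>.\<close>

lemma fourier_series:
  assumes cont: "continuous_on UNIV f" and per: "\<And>t. f (t + 2 * pi) = f t"
    and summable: "(\<lambda>k. norm (fourier_coeff f k)) summable_on UNIV"
  shows "((\<lambda>k. fourier_coeff f k * exp (\<i> * of_int k * of_real t)) has_sum f t) UNIV"
    and "uniform_limit UNIV (\<lambda>A t. \<Sum>k\<in>A. fourier_coeff f k * exp (\<i> * of_int k * of_real t)) f (finite_subsets_at_top UNIV)"
proof -
  define S where "S t = (\<Sum>\<^sub>\<infinity>k. fourier_coeff f k * exp (\<i> * of_int k * of_real t))" for t :: real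
  let ?P = "\<lambda>A t. \<Sum>k\<in>A. fourier_coeff f k * exp (\<i> * of_int k * of_real t)"
  have ul: "uniform_limit UNIV ?P S (finite_subsets_at_top UNIV)"
    unfolding S_def
    by (rule Weierstrass_m_test_general[OF _ summable]) (simp add: norm_mult)
  have contP: "continuous_on X (?P A)" for A X by (intro continuous_intros)
  have contS: "continuous_on UNIV S"
    by (rule uniform_limit_theorem[OF _ ul]) (use contP in auto)
  have "fourier_coeff S k = fourier_coeff f k" for k
  proof (rule tendsto_unique)
    show "((\<lambda>A. fourier_coeff (?P A) k) \<longlongrightarrow> fourier_coeff S k) (finite_subsets_at_top UNIV)"
      by (rule fourier_coeff_uniform_limit(2)) (use contP in \<open>auto intro: uniform_limit_on_subset[OF ul]\<close>)
    have "\<forall>\<^sub>F A in finite_subsets_at_top UNIV. k \<in> A \<and> finite A"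
      by (rule eventually_finite_subsets_at_top_weakI[THEN eventually_conj[rotated]])
        (auto simp: eventually_finite_subsets_at_top intro!: exI[of _ "{k}"])
    then have "\<forall>\<^sub>F A in finite_subsets_at_top UNIV. fourier_coeff (?P A) k = fourier_coeff f k"
    proof eventually_elim
      case (elim A)
      then show ?case
        by (subst fourier_coeff_sum)
          (auto intro!: continuous_intros simp: fourier_coeff_cmult fourier_coeff_exp if_distrib cong: if_cong)
    qed
    then show "((\<lambda>A. fourier_coeff (?P A) k) \<longlongrightarrow> fourier_coeff f k) (finite_subsets_at_top UNIV)"
      by (rule tendsto_eventually)
  qed simp
  moreover have "S (t + 2 * pi) = S t" for t
  proof -
    have "exp (\<i> * of_int k * (of_real t + 2 * of_real pi)) = exp (\<i> * of_int k * of_real t)" for k :: int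
      using exp_integer_2pi[of "of_int k"] by (simp add: distrib_left exp_add mult_ac)
    then show ?thesis unfolding S_def by simp
  qed
  ultimately have "null_fourier (\<lambda>t. f t - S t)"
    unfolding null_fourier_def using cont contS per
    by (auto intro!: continuous_intros simp: fourier_coeff_diff[OF continuous_on_subset continuous_on_subset])
  then have fS: "f = S" using null_fourier_imp_zero by fastforce
  show "uniform_limit UNIV ?P f (finite_subsets_at_top UNIV)" using ul fS by simp
  then have "((\<lambda>A. ?P A t) \<longlongrightarrow> f t) (finite_subsets_at_top UNIV)"
    by (rule tendsto_uniform_limitI) auto
  then show "((\<lambda>k. fourier_coeff f k * exp (\<i> * of_int k * of_real t)) has_sum f t) UNIV"
    by (simp add: has_sum_def)
qed

text \<open>The uniformly convergent Fourier series of \<open>f\<close>, multiplied by \<open>g\<close>, can be integrated term by term.\<close>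

lemma fourier_coeff_mult:
  assumes cont: "continuous_on UNIV f" and per: "\<And>t. f (t + 2 * pi) = f t"
    and summable: "(\<lambda>k. norm (fourier_coeff f k)) summable_on UNIV"
    and contg: "continuous_on UNIV g"
  shows "((\<lambda>l. fourier_coeff f l * fourier_coeff g (k - l)) has_sum fourier_coeff (\<lambda>t. f t * g t) k) UNIV"
proof -
  let ?P = "\<lambda>A t. \<Sum>k\<in>A. fourier_coeff f k * exp (\<i> * of_int k * of_real t)"
  have cg: "continuous_on {0..2*pi} g" by (rule continuous_on_subset[OF contg]) auto
  have ul: "uniform_limit {0..2*pi} (\<lambda>A t. ?P A t * g t) (\<lambda>t. f t * g t) (finite_subsets_at_top UNIV)"
  proof (rule uniform_lim_mult)
    show "uniform_limit {0..2*pi} ?P f (finite_subsets_at_top UNIV)"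
      by (rule uniform_limit_on_subset[OF fourier_series(2)[OF cont per summable]]) auto
    show "bounded (f ` {0..2*pi})" "bounded (g ` {0..2*pi})"
      by (intro compact_imp_bounded compact_continuous_image cg continuous_on_subset[OF cont]; simp)+
  qed (rule uniform_limit_const)
  have "((\<lambda>A. fourier_coeff (\<lambda>t. ?P A t * g t) k) \<longlongrightarrow> fourier_coeff (\<lambda>t. f t * g t) k) (finite_subsets_at_top UNIV)"
    by (rule fourier_coeff_uniform_limit(2)[OF ul]) (auto intro!: continuous_intros cg)
  moreover have "fourier_coeff (\<lambda>t. ?P A t * g t) k = (\<Sum>l\<in>A. fourier_coeff f l * fourier_coeff g (k - l))" if "finite A" for A
  proof -
    have "(\<lambda>t. ?P A t * g t) = (\<lambda>t. \<Sum>l\<in>A. fourier_coeff f l * (exp (\<i> * of_int l * of_real t) * g t))"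
      by (simp add: sum_distrib_right mult.assoc)
    moreover have "fourier_coeff (\<lambda>t. \<Sum>l\<in>A. fourier_coeff f l * (exp (\<i> * of_int l * of_real t) * g t)) k
        = (\<Sum>l\<in>A. fourier_coeff (\<lambda>t. fourier_coeff f l * (exp (\<i> * of_int l * of_real t) * g t)) k)"
      by (rule fourier_coeff_sum) (auto intro!: continuous_intros cg that)
    ultimately show ?thesis by (simp only: fourier_coeff_cmult fourier_coeff_shift)
  qed
  ultimately show ?thesis
    unfolding has_sum_def
    by (subst (asm) tendsto_cong) (auto intro!: eventually_finite_subsets_at_top_weakI)
qed

section \<open>The linear equation on a half-plane\<close>

lemma norm_diff_le_of_derivative_le:
  fixes h :: "real \<Rightarrow> complex"
  assumes "a \<le> b"
    and h: "\<And>t. t \<in> {a..b} \<Longrightarrow> (h has_vector_derivative h' t) (at t)"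
    and G: "\<And>t. t \<in> {a..b} \<Longrightarrow> (G has_real_derivative G' t) (at t)"
    and le: "\<And>t. t \<in> {a..b} \<Longrightarrow> norm (h' t) \<le> G' t"
  shows "norm (h b - h a) \<le> G b - G a"
proof -
  have 1: "(h' has_integral h b - h a) {a..b}"
    using assms(1) h by (intro fundamental_theorem_of_calculus) (auto intro: has_vector_derivative_at_within)
  have 2: "(G' has_integral G b - G a) {a..b}"
    using assms(1) G
    by (intro fundamental_theorem_of_calculus)
      (auto simp: has_real_derivative_iff_has_vector_derivative[symmetric] intro: has_field_derivative_at_within)
  have "norm (integral {a..b} h') \<le> integral {a..b} G'"
    using 1 2 le by (intro integral_norm_bound_integral) (auto intro: has_integral_integrable)
  then show ?thesis using 1 2 by (simp add: integral_unique)
qed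

lemma tendsto_exp_minus_at_top:
  fixes \<kappa> :: real
  assumes "\<kappa> > 0"
  shows "((\<lambda>t. exp (- (\<kappa> * t))) \<longlongrightarrow> 0) at_top"
proof -
  have "filterlim (\<lambda>t. - (\<kappa> * t)) at_bot at_top"
    using assms by (intro filterlim_uminus_at_top[THEN iffD1] filterlim_tendsto_pos_mult_at_top[OF tendsto_const]) (auto simp: filterlim_ident)
  then show ?thesis by (rule filterlim_compose[OF exp_at_bot])
qed

text \<open>The increment of \<open>p\<close> after the time \<open>s\<close> is bounded by the integral of \<open>K e\<^bsup>-\<kappa>t\<^esup>\<close> over \<open>t \<ge> s\<close>.\<close>

lemma exponential_decay_limit:
  fixes p :: "real \<Rightarrow> complex"
  assumes p: "\<And>t. t \<ge> a \<Longrightarrow> (p has_vector_derivative p' t) (at t)"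
    and le: "\<And>t. t \<ge> a \<Longrightarrow> norm (p' t) \<le> K * exp (- (\<kappa> * t))" and \<kappa>: "\<kappa> > 0"
  obtains L where "(p \<longlongrightarrow> L) at_top" "\<And>t. t \<ge> a \<Longrightarrow> norm (p t - L) \<le> K / \<kappa> * exp (- (\<kappa> * t))"
proof -
  have "0 \<le> norm (p' a)" by simp
  also have "\<dots> \<le> K * exp (- (\<kappa> * a))" using le by simp
  finally have K: "K \<ge> 0" by (simp add: zero_le_mult_iff)
  have incr: "norm (p t - p s) \<le> K / \<kappa> * exp (- (\<kappa> * s))" if "a \<le> s" "s \<le> t" for s t
  proof -
    have "norm (p t - p s) \<le> - (K / \<kappa>) * exp (- (\<kappa> * t)) - (- (K / \<kappa>) * exp (- (\<kappa> * s)))"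
      by (rule norm_diff_le_of_derivative_le[where h' = p' and G' = "\<lambda>t. K * exp (- (\<kappa> * t))"])
        (use that \<kappa> p le in \<open>auto intro!: derivative_eq_intros simp: field_simps\<close>)
    moreover have "K / \<kappa> * exp (- (\<kappa> * t)) \<ge> 0" using K \<kappa> by simp
    ultimately show ?thesis by (simp add: algebra_simps)
  qed
  have lim0: "((\<lambda>s. K / \<kappa> * exp (- (\<kappa> * s))) \<longlongrightarrow> 0) at_top"
    by (rule tendsto_mult_right_zero[OF tendsto_exp_minus_at_top[OF \<kappa>]])
  have "Cauchy (\<lambda>n. p (real n))"
  proof (rule CauchyI)
    fix e :: real assume e: "e > 0"
    have "\<forall>\<^sub>F s in at_top. K / \<kappa> * exp (- (\<kappa> * s)) < e / 2 \<and> s \<ge> a"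
      using order_tendstoD(2)[OF lim0, of "e / 2"] e eventually_ge_at_top by (auto intro: eventually_conj)
    then obtain s0 where s0: "\<And>s. s \<ge> s0 \<Longrightarrow> K / \<kappa> * exp (- (\<kappa> * s)) < e / 2 \<and> s \<ge> a"
      unfolding eventually_at_top_linorder by blast
    define s where "s = max s0 a"
    have s: "s \<ge> a" "K / \<kappa> * exp (- (\<kappa> * s)) < e / 2" using s0[of s] by (auto simp: s_def)
    obtain N where N: "real N \<ge> s" using real_arch_simple by blast
    have "norm (p (real m) - p (real n)) < e" if "m \<ge> N" "n \<ge> N" for m n
    proof -
      have "norm (p (real m) - p s) < e / 2" "norm (p (real n) - p s) < e / 2"
        using incr[OF s(1), of "real m"] incr[OF s(1), of "real n"] s(2) N that by linarith+
      then show ?thesis using norm_triangle_ineq4[of "p (real m) - p s" "p (real n) - p s"] by simp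
    qed
    then show "\<exists>M. \<forall>m\<ge>M. \<forall>n\<ge>M. norm (p (real m) - p (real n)) < e" by blast
  qed
  then obtain L where L: "(\<lambda>n. p (real n)) \<longlonglongrightarrow> L" using Cauchy_convergent_iff convergent_def by blast
  have bound: "norm (p s - L) \<le> K / \<kappa> * exp (- (\<kappa> * s))" if "s \<ge> a" for s
  proof -
    have "(\<lambda>n. norm (p (real n) - p s)) \<longlonglongrightarrow> norm (L - p s)"
      by (intro tendsto_intros L)
    moreover have "\<forall>\<^sub>F n in sequentially. norm (p (real n) - p s) \<le> K / \<kappa> * exp (- (\<kappa> * s))"
      using eventually_ge_at_top[of "nat \<lceil>s\<rceil>"]
    proof eventually_elim
      case (elim n)
      then have "s \<le> real n" by linarith
      then show ?case by (rule incr[OF that])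
    qed
    ultimately have "norm (L - p s) \<le> K / \<kappa> * exp (- (\<kappa> * s))"
      by (rule tendsto_upperbound) auto
    then show ?thesis by (simp add: norm_minus_commute)
  qed
  have "((\<lambda>s. p s - L) \<longlongrightarrow> 0) at_top"
    by (rule Lim_null_comparison[OF _ lim0])
      (use eventually_ge_at_top[of a] in eventually_elim, use bound in auto)
  then have "(p \<longlongrightarrow> L) at_top" by (simp add: LIM_zero_iff)
  then show ?thesis using that bound by blast
qed

text \<open>The point at depth \<open>y\<close> on the negative imaginary axis, along which the two solutions are compared.\<close>

abbreviation down :: "real \<Rightarrow> complex" where
  "down y \<equiv> - (\<i> * of_real y)"

text \<open>The domains of the recursion for \<open>\<psi>\<^sup>-\<close> (\<open>e = 1\<close>, unbounded to the left) and for \<open>\<psi>\<^sup>+\<close>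
  (\<open>e = -1\<close>, unbounded to the right). Both contain the negative imaginary axis below \<open>-i\<close>.\<close>

definition half :: "real \<Rightarrow> complex set" where
  "half e = {z. e * Re z + Im z < -1}"

text \<open>A direction in which \<open>half e\<close> extends to infinity and \<open>e\<^bsup>ikz\<^esup>\<close> decays: downwards if \<open>k < 0\<close>, and otherwise
  outwards with a rise so small, by the factor \<open>1/2\<close>, that the boundary is not met.\<close>

definition ray :: "real \<Rightarrow> int \<Rightarrow> complex" where
  "ray e k = (if k < 0 then - \<i> else Complex (- e) (1 / 2))"

lemma open_half: "open (half e)"
  unfolding half_def by (intro open_Collect_less continuous_intros)

lemma convex_half: "convex (half e)"
proof -
  have "half e = {z. (Complex e 1) \<bullet> z < -1}" by (auto simp: half_def inner_complex_def)
  then show ?thesis by (simp add: convex_halfspace_lt)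
qed

lemma half_nonzero: "z \<in> half e \<Longrightarrow> z \<noteq> 0"
  by (auto simp: half_def)

lemma minus_imaginary_in_half: "y > 1 \<Longrightarrow> down y \<in> half e"
  by (auto simp: half_def)

lemma Re_ray: "e \<in> {1, -1} \<Longrightarrow> Re (\<i> * of_int k * ray e k) \<le> - (\<bar>of_int k\<bar> / 2)"
  by (auto simp: ray_def)

lemma norm_exp_ray_le:
  assumes "e \<in> {1, -1}" "t \<ge> 0"
  shows "norm (exp (\<i> * of_int k * (of_real t * ray e k))) \<le> exp (- (\<bar>of_int k\<bar> / 2 * t))"
proof -
  have "Re (\<i> * of_int k * (of_real t * ray e k)) = t * Re (\<i> * of_int k * ray e k)"
    by (simp add: algebra_simps)
  also have "\<dots> \<le> t * - (\<bar>of_int k\<bar> / 2)" by (rule mult_left_mono[OF Re_ray]) (use assms in auto)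
  finally show ?thesis by (simp add: norm_exp_eq_Re mult_ac)
qed

lemma norm_ray: "e \<in> {1, -1} \<Longrightarrow> norm (ray e k) \<le> 2" "ray e k \<noteq> 0"
proof -
  have "norm (Complex (- e) (1 / 2)) \<le> 2" if "e \<in> {1, -1}"
    using cmod_le[of "Complex (- e) (1 / 2)"] that by auto
  then show "e \<in> {1, -1} \<Longrightarrow> norm (ray e k) \<le> 2" by (auto simp: ray_def)
qed (auto simp: ray_def complex_eq_iff)

lemma ray_in_half:
  assumes "e \<in> {1, -1}" "z \<in> half e" "t \<ge> 0"
  shows "z + of_real t * ray e k \<in> half e"
  using assms by (auto simp: half_def ray_def algebra_simps)

lemma half_norm_ge:
  assumes "e \<in> {1, -1}" "z \<in> half e"
  shows "norm z > 1 / 2"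
  using assms abs_Re_le_cmod[of z] abs_Im_le_cmod[of z] by (auto simp: half_def)

text \<open>Moving along the ray by \<open>t\<close> also moves the point away from the boundary of \<open>half e\<close>, by an amount
  proportional to \<open>t\<close>; hence \<open>t \<le> 4 |w|\<close> at the endpoint \<open>w\<close>.\<close>

lemma norm_le_norm_ray:
  assumes e: "e \<in> {1, -1}" and z: "z \<in> half e" and t: "t \<ge> 0"
  shows "norm z \<le> 9 * norm (z + of_real t * ray e k)"
proof -
  let ?w = "z + of_real t * ray e k"
  have "t / 2 \<le> \<bar>Re ?w\<bar> + \<bar>Im ?w\<bar>" using e z t
    by (auto simp: half_def ray_def abs_if split: if_splits)
  also have "\<dots> \<le> 2 * norm ?w" using abs_Re_le_cmod[of ?w] abs_Im_le_cmod[of ?w] by linarith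
  finally have *: "t \<le> 4 * norm ?w" by simp
  have "norm z \<le> norm ?w + norm (of_real t * ray e k)"
    by (metis add_diff_cancel_right' norm_triangle_ineq4)
  also have "\<dots> \<le> norm ?w + t * 2"
    using norm_ray(1)[OF e, of k] t by (simp add: norm_mult mult_left_mono)
  finally show ?thesis using * by linarith
qed

lemma bounded_of_decay:
  assumes "e \<in> {1, -1}" "z \<in> half e" "norm a \<le> C / norm z ^ 2"
  shows "norm a \<le> 4 * C"
proof -
  have nz: "norm z > 0" using half_norm_ge[OF assms(1,2)] by linarith
  have "0 \<le> C / norm z ^ 2" by (rule order_trans[OF norm_ge_zero assms(3)])
  then have C: "C \<ge> 0" using nz by (simp add: zero_le_divide_iff)
  have "(1 / 2) ^ 2 \<le> norm z ^ 2" by (rule power_mono) (use half_norm_ge[OF assms(1,2)] in auto)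
  then have "C / norm z ^ 2 \<le> C / (1/4)"
    using C by (intro divide_left_mono) (auto simp: power2_eq_square)
  then show ?thesis using assms(3) by simp
qed

definition decays :: "real \<Rightarrow> real \<Rightarrow> (complex \<Rightarrow> complex) \<Rightarrow> bool" where
  "decays e C f \<longleftrightarrow> f holomorphic_on half e \<and> (\<forall>z\<in>half e. norm (f z) \<le> C / norm z ^ 2)"

lemma decays_nonneg:
  assumes "decays e C f"
  shows "C \<ge> 0"
proof -
  have z: "down 2 \<in> half e" by (rule minus_imaginary_in_half) simp
  have "norm (f (down 2)) \<le> C / norm (down 2) ^ 2"
    using assms z unfolding decays_def by blast
  then have "0 \<le> C / norm (down 2) ^ 2"
    using norm_ge_zero order_trans by blast
  then show ?thesis by (simp add: norm_mult zero_le_divide_iff)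
qed

lemma has_vector_derivative_along_line:
  assumes "(f has_field_derivative f') (at (z + of_real t * d))"
  shows "((\<lambda>t. f (z + of_real t * d)) has_vector_derivative f' * d) (at t)"
proof -
  have "((\<lambda>t. z + of_real t * d) has_vector_derivative d) (at t)"
    by (auto intro!: derivative_eq_intros)
  from field_vector_diff_chain_at[OF this assms] show ?thesis by (simp add: o_def mult.commute)
qed

text \<open>A solution of the homogeneous equation is a multiple of \<open>e\<^bsup>-ikz\<^esup>\<close>, which grows exponentially along
  the ray.\<close>

lemma homogeneous_solution_zero:
  assumes e: "e \<in> {1, -1}" and k: "k \<noteq> 0"
    and closed: "\<And>z t. z \<in> S \<Longrightarrow> t \<ge> 0 \<Longrightarrow> z + of_real t * ray e k \<in> S"
    and deriv: "\<And>z. z \<in> S \<Longrightarrow> (q has_field_derivative - (\<i> * of_int k * q z)) (at z)"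
    and bdd: "\<And>z. z \<in> S \<Longrightarrow> norm (q z) \<le> B" and z: "z \<in> S"
  shows "q z = 0"
proof -
  let ?d = "ray e k"
  define h where "h t = exp (\<i> * of_int k * (of_real t * ?d)) * q (z + of_real t * ?d)" for t :: real
  have "(h has_vector_derivative 0) (at t within {0..})" if "t \<in> {0..}" for t
  proof -
    have zt: "z + of_real t * ?d \<in> S" using closed[OF z] that by auto
    have 1: "((\<lambda>t. exp (\<i> * of_int k * (of_real t * ?d))) has_vector_derivative
        exp (\<i> * of_int k * (of_real t * ?d)) * (\<i> * of_int k * ?d)) (at t)"
      by (auto intro!: derivative_eq_intros has_vector_derivative_real_field)
    have "(h has_vector_derivative 0) (at t)"
      unfolding h_def
      using has_vector_derivative_mult[OF 1 has_vector_derivative_along_line[OF deriv[OF zt]]]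
      by (simp add: mult_ac)
    then show ?thesis by (rule has_vector_derivative_at_within)
  qed
  then obtain c where c: "\<And>t. t \<in> {0..} \<Longrightarrow> h t = c"
    using has_vector_derivative_zero_constant[of "{0::real..}" h] by auto
  have "h t = q z" if "t \<ge> 0" for t using c[of t] c[of 0] that by (simp add: h_def)
  then have le: "norm (q z) \<le> exp (- (\<bar>of_int k\<bar> / 2 * t)) * B" if "t \<ge> 0" for t
  proof -
    have "norm (h t) \<le> exp (- (\<bar>of_int k\<bar> / 2 * t)) * B"
      unfolding h_def norm_mult
      using norm_exp_ray_le[OF e that, of k] bdd[OF closed[OF z that]] by (intro mult_mono) auto
    then show ?thesis using \<open>\<And>t. t \<ge> 0 \<Longrightarrow> h t = q z\<close>[OF that] by simp
  qed
  have "((\<lambda>s. exp (- (\<bar>of_int k\<bar> / 2 * s))) \<longlongrightarrow> (0::real)) at_top" by (rule tendsto_exp_minus_at_top) (use k in simp)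
  then have "((\<lambda>s. exp (- (\<bar>of_int k\<bar> / 2 * s)) * B) \<longlongrightarrow> 0) at_top" by (rule tendsto_mult_left_zero)
  then have "norm (q z) \<le> 0"
    by (rule tendsto_lowerbound) (use le in \<open>auto intro: eventually_at_top_linorderI[of 0]\<close>)
  then show ?thesis by simp
qed

text \<open>Variation of constants: \<open>e\<^bsup>ikz\<^esup>q\<close> is the primitive of \<open>e\<^bsup>ikz\<^esup>f\<close> that vanishes at the end of the ray. As
  the integrand decays along the ray at the rate \<open>|k|/2\<close>, there is a gain of a factor \<open>k\<close> in the bound.\<close>

lemma inhomogeneous_solution_exists:
  assumes e: "e \<in> {1, -1}" and k: "k \<noteq> 0" and f: "decays e C f"
  obtains q where "q holomorphic_on half e"
    "\<And>z. z \<in> half e \<Longrightarrow> (q has_field_derivative (f z - \<i> * of_int k * q z)) (at z)"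
    "\<And>z. z \<in> half e \<Longrightarrow> norm (of_int k * q z) \<le> 400 * C / norm z ^ 2"
proof -
  let ?S = "half e" and ?d = "ray e k"
  let ?E = "\<lambda>z. exp (\<i> * of_int k * z)"
  have holf: "f holomorphic_on ?S" and bdf: "\<And>z. z \<in> ?S \<Longrightarrow> norm (f z) \<le> C / norm z ^ 2"
    using f by (auto simp: decays_def)
  have C: "C \<ge> 0" by (rule decays_nonneg[OF f])
  obtain P where P: "\<And>z. z \<in> ?S \<Longrightarrow> (P has_field_derivative ?E z * f z) (at z within ?S)"
    by (rule holomorphic_convex_primitive'[OF convex_half open_half, of "\<lambda>z. ?E z * f z" e])
      (auto intro!: holomorphic_intros holf)
  have P': "(P has_field_derivative ?E z * f z) (at z)" if "z \<in> ?S" for z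
    using P[OF that] at_within_open[OF that open_half] by simp
  define \<kappa> where "\<kappa> = \<bar>real_of_int k\<bar> / 2"
  have \<kappa>: "\<kappa> > 0" using k by (simp add: \<kappa>_def)
  \<comment> \<open>The factor \<open>162 = 2 \<cdot> 9\<^sup>2\<close> comes from the length of \<open>ray e k\<close> and from \<open>norm_le_norm_ray\<close>.\<close>
  have line: "\<exists>L. ((\<lambda>t. P (z + of_real t * ?d)) \<longlongrightarrow> L) at_top \<and>
      norm (P z - L) \<le> norm (?E z) * (162 * C / norm z ^ 2) / \<kappa>" if z: "z \<in> ?S" for z
  proof -
    have nz: "norm z > 0" using half_nonzero[OF z] by simp
    have bd: "norm (?E (z + of_real t * ?d) * f (z + of_real t * ?d) * ?d)
        \<le> norm (?E z) * (162 * C / norm z ^ 2) * exp (- (\<kappa> * t))" if t: "t \<ge> 0" for t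
    proof -
      let ?w = "z + of_real t * ?d"
      have w: "?w \<in> ?S" by (rule ray_in_half[OF e z t])
      have nw: "norm ?w > 0" using half_nonzero[OF w] by simp
      have "norm z ^ 2 \<le> (9 * norm ?w) ^ 2"
        by (rule power_mono[OF norm_le_norm_ray[OF e z t]]) simp
      then have "C / norm ?w ^ 2 \<le> 81 * C / norm z ^ 2"
        using C nz nw by (simp add: divide_simps power_mult_distrib) (metis mult.assoc mult.commute mult_left_mono)
      then have 1: "norm (f ?w) \<le> 81 * C / norm z ^ 2" using bdf[OF w] by linarith
      have "?E ?w = ?E z * exp (\<i> * of_int k * (of_real t * ?d))"
        by (simp add: distrib_left exp_add)
      then have 2: "norm (?E ?w) \<le> norm (?E z) * exp (- (\<kappa> * t))"
        using norm_exp_ray_le[OF e t, of k] by (simp add: norm_mult \<kappa>_def mult_left_mono)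
      have "norm (?E ?w * f ?w * ?d) \<le> (norm (?E z) * exp (- (\<kappa> * t))) * (81 * C / norm z ^ 2) * 2"
        unfolding norm_mult by (intro mult_mono 1 2 norm_ray(1)[OF e]) (use C in auto)
      then show ?thesis by (simp add: mult_ac)
    qed
    obtain L where L: "((\<lambda>t. P (z + of_real t * ?d)) \<longlongrightarrow> L) at_top"
      "\<And>t. t \<ge> 0 \<Longrightarrow> norm (P (z + of_real t * ?d) - L) \<le> norm (?E z) * (162 * C / norm z ^ 2) / \<kappa> * exp (- (\<kappa> * t))"
      using exponential_decay_limit[of 0 "\<lambda>t. P (z + of_real t * ?d)" "\<lambda>t. ?E (z + of_real t * ?d) * f (z + of_real t * ?d) * ?d"
          "norm (?E z) * (162 * C / norm z ^ 2)" \<kappa>] bd \<kappa> has_vector_derivative_along_line[OF P'[OF ray_in_half[OF e z]]]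
      by blast
    from L(2)[of 0] L(1) show ?thesis by auto
  qed
  then obtain Lz where Lz: "\<And>z. z \<in> ?S \<Longrightarrow> ((\<lambda>t. P (z + of_real t * ?d)) \<longlongrightarrow> Lz z) at_top"
      "\<And>z. z \<in> ?S \<Longrightarrow> norm (P z - Lz z) \<le> norm (?E z) * (162 * C / norm z ^ 2) / \<kappa>"
    by metis
  \<comment> \<open>The limit along the ray does not depend on its starting point, as \<open>P'\<close> is exponentially
    small on the segments that join two parallel rays.\<close>
  have L_eq: "Lz z = Lz z'" if z: "z \<in> ?S" and z': "z' \<in> ?S" for z z'
  proof -
    define R where "R = norm z + norm z'"
    have seg: "norm (P (z + of_real t * ?d) - P (z' + of_real t * ?d)) \<le> exp (\<bar>of_int k\<bar> * R) * exp (- (\<kappa> * t)) * (4 * C) * norm (z - z')"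
      if t: "t \<ge> 0" for t
    proof -
      have "norm (P (z + of_real t * ?d) - P (z' + of_real t * ?d)) \<le> (exp (\<bar>of_int k\<bar> * R) * exp (- (\<kappa> * t)) * (4 * C)) *
          norm ((z + of_real t * ?d) - (z' + of_real t * ?d))"
      proof (rule field_differentiable_bound[of "(\<lambda>u. of_real t * ?d + u) ` closed_segment z z'" P "\<lambda>w. ?E w * f w"])
        show "convex ((\<lambda>u. of_real t * ?d + u) ` closed_segment z z')"
          by (intro convex_translation) simp
        fix w assume "w \<in> (\<lambda>u. of_real t * ?d + u) ` closed_segment z z'"
        then obtain u where u: "u \<in> closed_segment z z'" "w = u + of_real t * ?d" by (auto simp: add.commute)
        have uS: "u \<in> ?S" using closed_segment_subset[OF z z' convex_half] u by auto
        have w: "w \<in> ?S" unfolding u(2) by (rule ray_in_half[OF e uS t])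
        show "(P has_field_derivative ?E w * f w) (at w within (\<lambda>u. of_real t * ?d + u) ` closed_segment z z')"
          by (rule has_field_derivative_at_within[OF P'[OF w]])
        have "norm u \<le> R"
        proof -
          have "u \<in> cball 0 R" if "closed_segment z z' \<subseteq> cball 0 R" using that u by auto
          moreover have "closed_segment z z' \<subseteq> cball 0 R"
            by (rule closed_segment_subset) (auto simp: R_def)
          ultimately show ?thesis by simp
        qed
        then have "norm (\<i> * of_int k * u) \<le> \<bar>of_int k\<bar> * R" by (simp add: norm_mult mult_left_mono)
        then have "norm (?E u) \<le> exp (\<bar>of_int k\<bar> * R)"
          using order_trans[OF norm_exp] exp_le_cancel_iff by blast
        moreover have "?E w = ?E u * exp (\<i> * of_int k * (of_real t * ?d))"
          unfolding u(2) by (simp add: distrib_left exp_add)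
        ultimately have 1: "norm (?E w) \<le> exp (\<bar>of_int k\<bar> * R) * exp (- (\<kappa> * t))"
          using norm_exp_ray_le[OF e t, of k] by (simp add: norm_mult \<kappa>_def mult_mono)
        have 2: "norm (f w) \<le> 4 * C" by (rule bounded_of_decay[OF e w bdf[OF w]])
        show "norm (?E w * f w) \<le> exp (\<bar>of_int k\<bar> * R) * exp (- (\<kappa> * t)) * (4 * C)"
          unfolding norm_mult by (intro mult_mono 1 2) auto
      qed (auto simp: add.commute)
      then show ?thesis by simp
    qed
    have "((\<lambda>t. P (z + of_real t * ?d) - P (z' + of_real t * ?d)) \<longlongrightarrow> Lz z - Lz z') at_top"
      by (intro tendsto_diff Lz z z')
    moreover have "((\<lambda>t. P (z + of_real t * ?d) - P (z' + of_real t * ?d)) \<longlongrightarrow> 0) at_top"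
    proof (rule Lim_null_comparison)
      show "\<forall>\<^sub>F t in at_top. norm (P (z + of_real t * ?d) - P (z' + of_real t * ?d)) \<le> (exp (\<bar>of_int k\<bar> * R) * (4 * C) * norm (z - z')) * exp (- (\<kappa> * t))"
        using eventually_ge_at_top[of 0] by eventually_elim (use seg in \<open>simp add: mult_ac\<close>)
      show "((\<lambda>t. (exp (\<bar>of_int k\<bar> * R) * (4 * C) * norm (z - z')) * exp (- (\<kappa> * t))) \<longlongrightarrow> 0) at_top"
        by (rule tendsto_mult_right_zero[OF tendsto_exp_minus_at_top[OF \<kappa>]])
    qed
    ultimately show ?thesis using tendsto_unique[OF trivial_limit_at_top_linorder] by fastforce
  qed
  define L where "L = Lz (down 2)"
  define q where "q z = exp (- (\<i> * of_int k * z)) * (P z - L)" for z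
  show ?thesis
  proof (rule that[of q])
    show d: "(q has_field_derivative (f z - \<i> * of_int k * q z)) (at z)" if "z \<in> ?S" for z
    proof -
      have "(q has_field_derivative exp (- (\<i> * of_int k * z)) * (?E z * f z) + exp (- (\<i> * of_int k * z)) * - (\<i> * of_int k) * (P z - L)) (at z)"
        unfolding q_def by (auto intro!: derivative_eq_intros P'[OF that])
      moreover have *: "exp (- (\<i> * of_int k * z)) * (?E z * f z) = f z"
        by (simp add: exp_minus)
      moreover have "f z + exp (- (\<i> * of_int k * z)) * - (\<i> * of_int k) * (P z - L) = f z - \<i> * of_int k * q z"
        by (simp add: q_def)
      ultimately show ?thesis by (simp only:)
    qed
    show "q holomorphic_on ?S"
      by (meson d field_differentiable_at_within field_differentiable_def holomorphic_on_def)
    fix z assume z: "z \<in> ?S"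
    have "L = Lz z" unfolding L_def by (rule L_eq[OF minus_imaginary_in_half z]) simp
    then have "norm (P z - L) \<le> norm (?E z) * (162 * C / norm z ^ 2) / \<kappa>" using Lz(2)[OF z] by simp
    then have "norm (exp (- (\<i> * of_int k * z))) * norm (P z - L) \<le> norm (exp (- (\<i> * of_int k * z))) * (norm (?E z) * (162 * C / norm z ^ 2) / \<kappa>)"
      by (rule mult_left_mono) simp
    also have "\<dots> = (162 * C / norm z ^ 2) / \<kappa>" by (simp add: exp_minus norm_inverse)
    finally have "norm (q z) \<le> (162 * C / norm z ^ 2) / \<kappa>" by (simp add: q_def norm_mult)
    then have "norm (of_int k * q z) \<le> \<bar>of_int k\<bar> * ((162 * C / norm z ^ 2) / \<kappa>)"
      unfolding norm_mult by (simp only: norm_of_int) (rule mult_left_mono, auto)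
    also have "\<dots> = 324 * C / norm z ^ 2" using k by (simp add: \<kappa>_def)
    also have "\<dots> \<le> 400 * C / norm z ^ 2" using C by (intro divide_right_mono) auto
    finally show "norm (of_int k * q z) \<le> 400 * C / norm z ^ 2" .
  qed
qed

text \<open>Meaningful for \<open>k \<noteq> 0\<close> and a source that decays, by \<open>sol_exists\<close> and \<open>sol_unique\<close>. The solution is
  singled out by boundedness alone, as this is easy to verify for the coefficients of a given solution of
  the inner equation.\<close>

definition sol :: "real \<Rightarrow> int \<Rightarrow> (complex \<Rightarrow> complex) \<Rightarrow> complex \<Rightarrow> complex" where
  "sol e k f = (SOME q. q holomorphic_on half e \<and>
     (\<forall>z\<in>half e. (q has_field_derivative (f z - \<i> * of_int k * q z)) (at z)) \<and>
     (\<exists>B. \<forall>z\<in>half e. norm (q z) \<le> B))"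

lemma sol_exists:
  assumes "e \<in> {1, -1}" "k \<noteq> 0" "decays e C f"
  obtains q where "q holomorphic_on half e"
    "\<forall>z\<in>half e. (q has_field_derivative (f z - \<i> * of_int k * q z)) (at z)"
    "\<And>z. z \<in> half e \<Longrightarrow> norm (of_int k * q z) \<le> 400 * C / norm z ^ 2"
    "\<And>z. z \<in> half e \<Longrightarrow> norm (q z) \<le> 1600 * C"
proof -
  obtain q where q: "q holomorphic_on half e"
    "\<And>z. z \<in> half e \<Longrightarrow> (q has_field_derivative (f z - \<i> * of_int k * q z)) (at z)"
    "\<And>z. z \<in> half e \<Longrightarrow> norm (of_int k * q z) \<le> 400 * C / norm z ^ 2"
    using inhomogeneous_solution_exists[OF assms] by blast
  have "norm (q z) \<le> 1600 * C" if "z \<in> half e" for z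
  proof -
    have "1 \<le> \<bar>real_of_int k\<bar>" using assms(2) by linarith
    then have "norm (q z) \<le> norm (of_int k * q z)"
      by (simp add: norm_mult mult_le_cancel_right1)
    then show ?thesis using bounded_of_decay[OF assms(1) that q(3)[OF that]] by simp
  qed
  then show ?thesis using that q by blast
qed

text \<open>A solution of the inner equation is given on a part of the half-plane only; uniqueness therefore refers to a
  subset \<open>S\<close> that contains the rays of its points.\<close>

lemma sol_unique:
  assumes e: "e \<in> {1, -1}" and k: "k \<noteq> 0" and f: "decays e C f"
    and S: "S \<subseteq> half e" "\<And>z t. z \<in> S \<Longrightarrow> t \<ge> 0 \<Longrightarrow> z + of_real t * ray e k \<in> S"
    and q: "\<And>z. z \<in> S \<Longrightarrow> (q has_field_derivative (f z - \<i> * of_int k * q z)) (at z)"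
    and B: "\<And>z. z \<in> S \<Longrightarrow> norm (q z) \<le> B" and z: "z \<in> S"
  shows "q z = sol e k f z"
proof -
  have "\<exists>q. q holomorphic_on half e \<and>
     (\<forall>z\<in>half e. (q has_field_derivative (f z - \<i> * of_int k * q z)) (at z)) \<and>
     (\<exists>B. \<forall>z\<in>half e. norm (q z) \<le> B)"
    using sol_exists[OF e k f] by metis
  from someI_ex[OF this] obtain B' where s:
     "\<And>z. z \<in> half e \<Longrightarrow> (sol e k f has_field_derivative (f z - \<i> * of_int k * sol e k f z)) (at z)"
     "\<And>z. z \<in> half e \<Longrightarrow> norm (sol e k f z) \<le> B'"
    unfolding sol_def[symmetric] by blast
  have "q z - sol e k f z = 0"
  proof (rule homogeneous_solution_zero[where q = "\<lambda>z. q z - sol e k f z" and S = S and B = "B + B'", OF e k S(2)])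
    fix z assume z: "z \<in> S"
    show "((\<lambda>z. q z - sol e k f z) has_field_derivative - (\<i> * of_int k * (q z - sol e k f z))) (at z)"
      using DERIV_diff[OF q[OF z] s(1)] z S(1) by (auto simp: algebra_simps)
    show "norm (q z - sol e k f z) \<le> B + B'"
      using norm_triangle_ineq4[of "q z" "sol e k f z"] B[OF z] s(2) z S(1)
      by (meson add_mono order_trans subsetD)
  qed (use z in auto)
  then show ?thesis by simp
qed

lemma sol_props:
  assumes e: "e \<in> {1, -1}" and k: "k \<noteq> 0" and f: "decays e C f"
  shows "sol e k f holomorphic_on half e"
    "\<And>z. z \<in> half e \<Longrightarrow> (sol e k f has_field_derivative (f z - \<i> * of_int k * sol e k f z)) (at z)"
    "\<And>z. z \<in> half e \<Longrightarrow> norm (of_int k * sol e k f z) \<le> 400 * C / norm z ^ 2"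
    "\<And>z. z \<in> half e \<Longrightarrow> norm (sol e k f z) \<le> 1600 * C"
proof -
  obtain q where q: "q holomorphic_on half e"
    "\<forall>z\<in>half e. (q has_field_derivative (f z - \<i> * of_int k * q z)) (at z)"
    "\<And>z. z \<in> half e \<Longrightarrow> norm (of_int k * q z) \<le> 400 * C / norm z ^ 2"
    "\<And>z. z \<in> half e \<Longrightarrow> norm (q z) \<le> 1600 * C"
    using sol_exists[OF e k f] by blast
  have eq: "q z = sol e k f z" if "z \<in> half e" for z
    by (rule sol_unique[OF e k f subset_refl ray_in_half[OF e] _ q(4) that]) (use q(2) in auto)
  show 1: "sol e k f holomorphic_on half e"
    using q(1) eq by (simp cong: holomorphic_cong)
  show "(sol e k f has_field_derivative (f z - \<i> * of_int k * sol e k f z)) (at z)" if z: "z \<in> half e" for z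
  proof -
    have "\<exists>q. q holomorphic_on half e \<and>
       (\<forall>z\<in>half e. (q has_field_derivative (f z - \<i> * of_int k * q z)) (at z)) \<and>
       (\<exists>B. \<forall>z\<in>half e. norm (q z) \<le> B)"
      using q by blast
    from someI_ex[OF this] show ?thesis unfolding sol_def[symmetric] using z by blast
  qed
  show "norm (of_int k * sol e k f z) \<le> 400 * C / norm z ^ 2" if z: "z \<in> half e" for z
    using q(3)[OF z] eq[OF z] by simp
  show "norm (sol e k f z) \<le> 1600 * C" if z: "z \<in> half e" for z
    using q(4)[OF z] eq[OF z] by simp
qed

lemma sol_linear:
  assumes e: "e \<in> {1, -1}" and k: "k \<noteq> 0" and f: "decays e C f" and g: "decays e D g"
    and h: "\<And>z. z \<in> half e \<Longrightarrow> h z = \<alpha> * f z + \<beta> * g z" and z: "z \<in> half e"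
  shows "sol e k h z = \<alpha> * sol e k f z + \<beta> * sol e k g z"
proof -
  have "decays e (norm \<alpha> * C + norm \<beta> * D) h"
    unfolding decays_def
  proof (intro conjI ballI)
    have "(\<lambda>z. \<alpha> * f z + \<beta> * g z) holomorphic_on half e"
      using f g by (auto intro!: holomorphic_intros simp: decays_def)
    then show "h holomorphic_on half e" using h by (simp cong: holomorphic_cong)
    fix z assume z: "z \<in> half e"
    have "norm (h z) \<le> norm \<alpha> * norm (f z) + norm \<beta> * norm (g z)"
      unfolding h[OF z] by (metis norm_mult norm_triangle_ineq)
    also have "\<dots> \<le> norm \<alpha> * (C / norm z ^ 2) + norm \<beta> * (D / norm z ^ 2)"
      using f g z by (intro add_mono mult_left_mono) (auto simp: decays_def)
    finally show "norm (h z) \<le> (norm \<alpha> * C + norm \<beta> * D) / norm z ^ 2" by (simp add: add_divide_distrib)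
  qed
  then have "(\<lambda>z. \<alpha> * sol e k f z + \<beta> * sol e k g z) z = sol e k h z"
  proof (rule sol_unique[OF e k _ subset_refl ray_in_half[OF e] _ _ z])
    fix z assume z: "z \<in> half e"
    show "((\<lambda>z. \<alpha> * sol e k f z + \<beta> * sol e k g z) has_field_derivative (h z - \<i> * of_int k * (\<alpha> * sol e k f z + \<beta> * sol e k g z))) (at z)"
      using DERIV_add[OF DERIV_cmult[OF sol_props(2)[OF e k f z], of \<alpha>] DERIV_cmult[OF sol_props(2)[OF e k g z], of \<beta>]]
      by (simp add: h[OF z] algebra_simps)
    have "norm (\<alpha> * sol e k f z + \<beta> * sol e k g z) \<le> norm \<alpha> * norm (sol e k f z) + norm \<beta> * norm (sol e k g z)"
      by (metis norm_mult norm_triangle_ineq)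
    also have "\<dots> \<le> norm \<alpha> * (1600 * C) + norm \<beta> * (1600 * D)"
      by (intro add_mono mult_left_mono sol_props(4)[OF e k f z] sol_props(4)[OF e k g z]) auto
    finally show "norm (\<alpha> * sol e k f z + \<beta> * sol e k g z) \<le> norm \<alpha> * (1600 * C) + norm \<beta> * (1600 * D)" .
  qed auto
  then show ?thesis by simp
qed

section \<open>Absolutely summable sequences\<close>

definition l1 :: "(int \<Rightarrow> complex) \<Rightarrow> bool" where
  "l1 x \<longleftrightarrow> (\<lambda>k. norm (x k)) summable_on UNIV"

definition l1_norm :: "(int \<Rightarrow> complex) \<Rightarrow> real" where
  "l1_norm x = (\<Sum>\<^sub>\<infinity>k. norm (x k))"

lemma l1_norm_nonneg: "l1_norm x \<ge> 0"
  unfolding l1_norm_def by (rule infsum_nonneg) simp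

lemma l1_linear:
  assumes "l1 u" "l1 v"
  shows "l1 (\<lambda>k. \<alpha> * u k + \<beta> * v k)"
  unfolding l1_def
proof (rule summable_on_comparison_test)
  show "(\<lambda>k. norm \<alpha> * norm (u k) + norm \<beta> * norm (v k)) summable_on UNIV"
    using assms by (intro summable_on_add summable_on_cmult_right) (auto simp: l1_def)
  show "norm (\<alpha> * u k + \<beta> * v k) \<le> norm \<alpha> * norm (u k) + norm \<beta> * norm (v k)" for k
    by (metis norm_mult norm_triangle_ineq)
qed auto

lemma convolution_has_sum:
  fixes S T :: "int \<Rightarrow> real"
  assumes S: "\<And>k. S k \<ge> 0" "S summable_on UNIV" and T: "\<And>k. T k \<ge> 0" "T summable_on UNIV"
  shows "(\<lambda>l. S l * T (k - l)) summable_on UNIV"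
    and "((\<lambda>k. \<Sum>\<^sub>\<infinity>l. S l * T (k - l)) has_sum infsum S UNIV * infsum T UNIV) UNIV"
proof -
  have 1: "((\<lambda>m. S l * T m) has_sum S l * infsum T UNIV) UNIV" for l
    using T by (intro has_sum_cmult_right) auto
  have 2: "((\<lambda>l. S l * infsum T UNIV) has_sum infsum S UNIV * infsum T UNIV) UNIV"
    using S by (intro has_sum_cmult_left) auto
  have 3: "(\<lambda>(l, m). S l * T m) summable_on Sigma UNIV (\<lambda>_. UNIV)"
    by (rule summable_on_SigmaI[OF _ has_sum_imp_summable[OF 2]]) (use 1 S T in auto)
  have 4: "((\<lambda>(l, m). S l * T m) has_sum infsum S UNIV * infsum T UNIV) (Sigma UNIV (\<lambda>_. UNIV))"
    by (rule has_sum_SigmaI[OF _ 2 3]) (use 1 in auto)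
  have "((\<lambda>(l, m). S l * T m) has_sum infsum S UNIV * infsum T UNIV) (Sigma UNIV (\<lambda>_. UNIV)) \<longleftrightarrow>
      ((\<lambda>(k, l). S l * T (k - l)) has_sum infsum S UNIV * infsum T UNIV) (Sigma UNIV (\<lambda>_. UNIV))"
    by (rule has_sum_reindex_bij_witness[where i = "\<lambda>(k, l). (l, k - l)" and j = "\<lambda>(l, m). (l + m, l)"]) auto
  with 4 have 5: "((\<lambda>(k, l). S l * T (k - l)) has_sum infsum S UNIV * infsum T UNIV) (Sigma UNIV (\<lambda>_. UNIV))"
    by simp
  show s: "(\<lambda>l. S l * T (k - l)) summable_on UNIV" for k
    by (rule summable_on_SigmaD1[OF has_sum_imp_summable[OF 5]]) simp
  show "((\<lambda>k. \<Sum>\<^sub>\<infinity>l. S l * T (k - l)) has_sum infsum S UNIV * infsum T UNIV) UNIV"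
    by (rule has_sum_SigmaD[OF 5]) (use s in auto)
qed

lemma holomorphic_on_infsum:
  assumes "open S" and hol: "\<And>l. f l holomorphic_on S"
    and le: "\<And>l z. z \<in> S \<Longrightarrow> norm (f l z) \<le> M l" and M: "M summable_on UNIV"
  shows "(\<lambda>z. \<Sum>\<^sub>\<infinity>l. f l z) holomorphic_on S"
proof (rule analytic_imp_holomorphic)
  show "(\<lambda>z. \<Sum>\<^sub>\<infinity>l. f l z) analytic_on S"
    unfolding analytic_on_def
  proof
    fix z assume "z \<in> S"
    then obtain r where r: "r > 0" "cball z r \<subseteq> S"
      using \<open>open S\<close> open_contains_cball by blast
    have ul: "uniform_limit (cball z r) (\<lambda>X y. \<Sum>l\<in>X. f l y) (\<lambda>y. \<Sum>\<^sub>\<infinity>l. f l y) (finite_subsets_at_top UNIV)"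
      by (rule Weierstrass_m_test_general[OF _ M]) (use le r in auto)
    have "(\<lambda>y. \<Sum>\<^sub>\<infinity>l. f l y) holomorphic_on ball z r"
    proof (rule holomorphic_uniform_limit[OF _ ul])
      have h: "(\<lambda>y. \<Sum>l\<in>X. f l y) holomorphic_on cball z r" for X
        using r by (intro holomorphic_intros holomorphic_on_subset[OF hol]) auto
      then show "\<forall>\<^sub>F X in finite_subsets_at_top UNIV. continuous_on (cball z r) (\<lambda>y. \<Sum>l\<in>X. f l y) \<and>
          (\<lambda>y. \<Sum>l\<in>X. f l y) holomorphic_on ball z r"
        by (intro always_eventually allI conjI holomorphic_on_imp_continuous_on[OF h] holomorphic_on_subset[OF h ball_subset_cball])
    qed auto
    with r show "\<exists>\<epsilon>>0. (\<lambda>y. \<Sum>\<^sub>\<infinity>l. f l y) holomorphic_on ball z \<epsilon>" by blast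
  qed
qed

section \<open>The universal recursion\<close>

text \<open>The source of the linear equation at the order \<open>length xs\<close>, where the \<open>i\<close>-th entry of \<open>xs\<close> supplies the
  Fourier coefficients of the \<open>i\<close>-th factor \<open>g\<close>. The two factors of the product are \<open>resp e (take i xs) l z\<close>
  and \<open>resp e (drop i xs) (k - l) z\<close>, with the definition of \<open>resp\<close> below written out. Discarding the frequency \<open>1\<close> in both factors
  changes nothing at the orders up to \<open>n(g)\<close>, and it keeps the sources on the two half-planes closer to
  each other than \<open>e\<^bsup>-y\<^esup>\<close> for all sequences.\<close>

function src :: "real \<Rightarrow> (int \<Rightarrow> complex) list \<Rightarrow> int \<Rightarrow> complex \<Rightarrow> complex" where
  "src e xs = (\<lambda>k z. if length xs \<le> 1 then - 2 * hd xs k / z\<^sup>2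
     else z\<^sup>2 / 8 * (\<Sum>i\<in>{1..<length xs}. \<Sum>\<^sub>\<infinity>l.
       (if l = 1 then 0 else src e (take i xs) l z - \<i> * of_int l * sol e l (src e (take i xs) l) z) *
       (if k - l = 1 then 0 else src e (drop i xs) (k - l) z - \<i> * of_int (k - l) * sol e (k - l) (src e (drop i xs) (k - l)) z)))"
  by pat_completeness auto
termination by (relation "Wellfounded.measure (\<lambda>(e, xs). length xs)") auto

declare src.simps [simp del]

text \<open>The contribution to \<open>\<partial>\<^sub>z\<psi>\<close>, which is \<open>f - iku\<close> for the solution \<open>u\<close> of \<open>u' + iku = f\<close>. For \<open>k = 0\<close> it is \<open>f\<close>
  itself, whatever \<open>u\<close> is.\<close>

definition resp :: "real \<Rightarrow> (int \<Rightarrow> complex) list \<Rightarrow> int \<Rightarrow> complex \<Rightarrow> complex" where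
  "resp e xs k z = (if k = 1 then 0 else src e xs k z - \<i> * of_int k * sol e k (src e xs k) z)"

lemma src_single: "src e [x] k z = - 2 * x k / z\<^sup>2"
  by (subst src.simps) simp

lemma src_step:
  assumes "length xs \<ge> 2"
  shows "src e xs k z = z\<^sup>2 / 8 * (\<Sum>i\<in>{1..<length xs}. \<Sum>\<^sub>\<infinity>l. resp e (take i xs) l z * resp e (drop i xs) (k - l) z)"
  using assms by (subst src.simps) (simp add: resp_def)

lemma decays_mono: "decays e C f \<Longrightarrow> C \<le> D \<Longrightarrow> decays e D f"
  unfolding decays_def by (meson divide_right_mono order_trans zero_le_power2)

lemma resp_decays:
  assumes e: "e \<in> {1, -1}" and f: "decays e C (src e xs k)"
  shows "decays e (401 * C) (resp e xs k)"
proof -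
  have C: "C \<ge> 0" by (rule decays_nonneg[OF f])
  consider "k = 1" | "k = 0" | "k \<noteq> 0" "k \<noteq> 1" by blast
  then show ?thesis
  proof cases
    case 1
    then have "resp e xs k = (\<lambda>z. 0)" by (simp add: resp_def fun_eq_iff)
    then show ?thesis using C by (simp add: decays_def)
  next
    case 2
    then have "resp e xs k = src e xs k" by (simp add: resp_def fun_eq_iff)
    then show ?thesis using decays_mono[OF f, of "401 * C"] C by simp
  next
    case 3
    note s = sol_props[OF e 3(1) f]
    have r: "resp e xs k z = src e xs k z - \<i> * of_int k * sol e k (src e xs k) z" for z
      using 3 by (simp add: resp_def)
    show ?thesis
      unfolding decays_def
    proof (intro conjI ballI)
      show "resp e xs k holomorphic_on half e"
        unfolding r using s(1) f by (auto intro!: holomorphic_intros simp: decays_def)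
      fix z assume z: "z \<in> half e"
      have "norm (resp e xs k z) \<le> norm (src e xs k z) + norm (of_int k * sol e k (src e xs k) z)"
        unfolding r using norm_triangle_ineq4[of "src e xs k z" "\<i> * of_int k * sol e k (src e xs k) z"]
        by (simp add: norm_mult)
      also have "\<dots> \<le> C / norm z ^ 2 + 400 * C / norm z ^ 2"
        using f z s(3)[OF z] by (intro add_mono) (auto simp: decays_def)
      finally show "norm (resp e xs k z) \<le> 401 * C / norm z ^ 2" by (simp add: add_divide_distrib[symmetric])
    qed
  qed
qed

text \<open>The rate \<open>3/2\<close> could be any number strictly between \<open>1\<close> and \<open>2\<close>: it has to beat \<open>e\<^bsup>-y\<^esup>\<close>, and the difference
  of two solutions at the frequency \<open>2\<close> is of size \<open>e\<^bsup>-2y\<^esup>\<close>.\<close>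

definition close :: "real \<Rightarrow> (complex \<Rightarrow> complex) \<Rightarrow> (complex \<Rightarrow> complex) \<Rightarrow> bool" where
  "close E f g \<longleftrightarrow> (\<forall>y\<ge>2. norm (f (down y) - g (down y)) \<le> E * exp (- (3 / 2 * y)))"

text \<open>At \<open>z = -iy\<close> the integrating factor \<open>e\<^bsup>ikz\<^esup>\<close> of the linear equation is \<open>e\<^bsup>ky\<^esup>\<close>.\<close>

lemma vertical_derivative:
  assumes "(\<delta> has_field_derivative (d - \<i> * of_int k * \<delta> (down y))) (at (down y))"
  shows "((\<lambda>y. of_real (exp (of_int k * y)) * \<delta> (down y)) has_vector_derivative
      - \<i> * of_real (exp (of_int k * y)) * d) (at y)"
proof -
  let ?w = "down y"
  have w: "0 + of_real t * (- \<i>) = - (\<i> * complex_of_real t)" for t by simp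
  have 1: "((\<lambda>y. \<delta> (down y)) has_vector_derivative (d - \<i> * of_int k * \<delta> ?w) * (- \<i>)) (at y)"
    using has_vector_derivative_along_line[of \<delta> "d - \<i> * of_int k * \<delta> ?w" 0 y "- \<i>"] assms
    unfolding w by simp
  have "((\<lambda>y. exp (of_int k * y)) has_real_derivative exp (of_int k * y) * of_int k) (at y)"
    by (auto intro!: derivative_eq_intros)
  then have 2: "((\<lambda>y. complex_of_real (exp (of_int k * y))) has_vector_derivative of_real (exp (of_int k * y) * of_int k)) (at y)"
    by (intro has_vector_derivative_of_real) (simp add: has_real_derivative_iff_has_vector_derivative)
  have eq: "of_real (exp (of_int k * y)) * ((d - \<i> * of_int k * \<delta> ?w) * (- \<i>)) + of_real (exp (of_int k * y) * of_int k) * \<delta> ?w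
      = - \<i> * of_real (exp (of_int k * y)) * d"
    by (simp add: algebra_simps)
  show ?thesis using has_vector_derivative_mult[OF 2 1] unfolding eq .
qed

lemma sol_difference_derivative:
  assumes k: "k \<noteq> 0" and f: "decays 1 C f" and g: "decays (-1) D g" and y: "y > 1"
  shows "((\<lambda>y. of_real (exp (of_int k * y)) * (sol 1 k f (down y) - sol (-1) k g (down y))) has_vector_derivative
      - \<i> * of_real (exp (of_int k * y)) * (f (down y) - g (down y))) (at y)"
proof -
  let ?w = "down y"
  have "((\<lambda>z. sol 1 k f z - sol (-1) k g z) has_field_derivative
     (f ?w - g ?w) - \<i> * of_int k * (sol 1 k f ?w - sol (-1) k g ?w)) (at ?w)"
    using DERIV_diff[OF sol_props(2)[OF _ k f, of ?w] sol_props(2)[OF _ k g, of ?w]] minus_imaginary_in_half[OF y]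
    by (simp add: algebra_simps)
  from vertical_derivative[OF this] show ?thesis .
qed

lemma exp_4_le: "exp (4::real) \<le> 81"
proof -
  have "exp (4::real) = exp 1 ^ 4" by (simp add: exp_of_nat_mult[symmetric])
  also have "\<dots> \<le> 3 ^ 4" by (intro power_mono exp_le) auto
  finally show ?thesis by simp
qed

text \<open>Let \<open>h\<close> be \<open>e\<^bsup>ky\<^esup>\<close> times the difference of the solutions; its derivative is \<open>e\<^bsup>ky\<^esup>\<close> times the difference of
  the sources. For \<open>k < 0\<close> it vanishes at infinity and is integrated from there. For \<open>k \<ge> 2\<close>
  it is integrated from \<open>y = 2\<close>, and the initial value contributes a term \<open>e\<^bsup>-ky\<^esup>\<close>, which is negligible. For
  \<open>k = 1\<close> this term is of the order \<open>e\<^bsup>-y\<^esup>\<close> that defines the coefficient sought. The constant is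
  \<open>16200 = 81 \<cdot> 200\<close>, where \<open>e\<^sup>4 \<le> 81\<close>.\<close>

lemma sol_close:
  assumes k: "k \<noteq> 0" "k \<noteq> 1" and f: "decays 1 C f" and g: "decays (-1) C g" and E: "close E f g" and y: "y \<ge> 2"
  shows "norm (of_int k * (sol 1 k f (down y) - sol (-1) k g (down y))) \<le> (4 * E + 16200 * C) * exp (- (3 / 2 * y))"
proof -
  define \<delta> where "\<delta> y = sol 1 k f (down y) - sol (-1) k g (down y)" for y :: real
  define h where "h y = of_real (exp (of_int k * y)) * \<delta> y" for y
  let ?h' = "\<lambda>y. - \<i> * of_real (exp (of_int k * y)) * (f (down y) - g (down y))"
  have C: "C \<ge> 0" by (rule decays_nonneg[OF f])
  have E0: "E \<ge> 0"
  proof -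
    have "0 \<le> E * exp (- (3 / 2 * 2))" using E unfolding close_def by (meson norm_ge_zero order_refl order_trans)
    then show ?thesis by (simp add: zero_le_mult_iff)
  qed
  have d: "(h has_vector_derivative ?h' y) (at y)" if "y \<ge> 2" for y
    unfolding h_def \<delta>_def using sol_difference_derivative[OF k(1) f g] that by simp
  have h'_le: "norm (?h' y) \<le> E * exp ((of_int k - 3 / 2) * y)" if "y \<ge> 2" for y
  proof -
    have "norm (?h' y) \<le> exp (of_int k * y) * (E * exp (- (3 / 2 * y)))"
      using E that by (simp add: norm_mult close_def)
    also have "\<dots> = E * exp ((of_int k - 3 / 2) * y)" by (simp add: exp_add[symmetric] algebra_simps)
    finally show ?thesis .
  qed
  have \<delta>_h: "norm (\<delta> y) = exp (- (of_int k * y)) * norm (h y)" for y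
    by (simp add: h_def norm_mult exp_minus)
  have \<delta>_bd: "norm (of_int k * \<delta> y) \<le> 800 * C / y ^ 2" if "y \<ge> 2" for y
  proof -
    have in_half: "down y \<in> half e" for e using minus_imaginary_in_half[of y] that by simp
    have n: "norm (down y) = y" using that by (simp add: norm_mult)
    have "norm (of_int k * \<delta> y) \<le> norm (of_int k * sol 1 k f (down y)) + norm (of_int k * sol (-1) k g (down y))"
      unfolding \<delta>_def right_diff_distrib by (rule norm_triangle_ineq4)
    also have "\<dots> \<le> 400 * C / y ^ 2 + 400 * C / y ^ 2"
      using sol_props(3)[OF _ k(1) f in_half] sol_props(3)[OF _ k(1) g in_half] n by (intro add_mono) auto
    finally show ?thesis by (simp add: add_divide_distrib[symmetric])
  qed
  have "norm (of_int k * \<delta> y) \<le> (4 * E + 16200 * C) * exp (- (3 / 2 * y))"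
  proof (cases "k < 0")
    case True
    define \<kappa> where "\<kappa> = 3 / 2 - real_of_int k"
    have \<kappa>: "\<kappa> > 0" using True by (simp add: \<kappa>_def)
    have le: "norm (?h' t) \<le> E * exp (- (\<kappa> * t))" if "t \<ge> 2" for t
    proof -
      have "- (\<kappa> * t) = (of_int k - 3 / 2) * t" by (simp add: \<kappa>_def algebra_simps)
      then show ?thesis using h'_le[OF that] by (simp only:)
    qed
    have "\<exists>L. (h \<longlongrightarrow> L) at_top \<and> (\<forall>t\<ge>2. norm (h t - L) \<le> E / \<kappa> * exp (- (\<kappa> * t)))"
      using exponential_decay_limit[OF d le \<kappa>] by metis
    then obtain L where L: "(h \<longlongrightarrow> L) at_top" "\<And>t. t \<ge> 2 \<Longrightarrow> norm (h t - L) \<le> E / \<kappa> * exp (- (\<kappa> * t))"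
      by blast
    have "(h \<longlongrightarrow> 0) at_top"
    proof (rule Lim_null_comparison)
      show "\<forall>\<^sub>F y in at_top. norm (h y) \<le> exp (of_int k * y) * (800 * C)"
        using eventually_ge_at_top[of 2]
      proof eventually_elim
        case (elim y)
        have "1 \<le> norm (complex_of_int k)" using True by simp
        then have "norm (\<delta> y) \<le> norm (of_int k * \<delta> y)" by (simp add: norm_mult mult_le_cancel_right1)
        also have "\<dots> \<le> 800 * C / y ^ 2" by (rule \<delta>_bd[OF elim])
        also have "\<dots> \<le> 800 * C"
        proof -
          have "1 \<le> y ^ 2" using elim by (intro one_le_power) simp
          then show ?thesis using C by (simp add: divide_le_eq mult_le_cancel_left1)
        qed
        finally show ?case by (simp add: h_def norm_mult)
      qed
      have "filterlim (\<lambda>s. real_of_int k * s) at_bot at_top"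
        using True by (intro filterlim_tendsto_neg_mult_at_bot[OF tendsto_const]) (auto simp: filterlim_ident)
      then have "((\<lambda>s. exp (of_int k * s)) \<longlongrightarrow> (0::real)) at_top" by (rule filterlim_compose[OF exp_at_bot])
      then show "((\<lambda>y. exp (of_int k * y) * (800 * C)) \<longlongrightarrow> 0) at_top" by (rule tendsto_mult_left_zero)
    qed
    then have "L = 0" using L(1) tendsto_unique[OF trivial_limit_at_top_linorder] by blast
    then have "norm (h y) \<le> E / \<kappa> * exp (- (\<kappa> * y))" using L(2)[OF y] by simp
    then have "norm (\<delta> y) \<le> exp (- (of_int k * y)) * (E / \<kappa> * exp (- (\<kappa> * y)))"
      unfolding \<delta>_h by (rule mult_left_mono) simp
    also have "\<dots> = E / \<kappa> * exp (- (3 / 2 * y))"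
    proof -
      have 1: "exp (- (of_int k * y)) * exp (- (\<kappa> * y)) = exp (- (3 / 2 * y))"
        by (simp add: exp_add[symmetric] \<kappa>_def algebra_simps)
      show ?thesis unfolding 1[symmetric] by (simp only: mult_ac)
    qed
    finally have "norm (of_int k * \<delta> y) \<le> \<bar>of_int k\<bar> * (E / \<kappa> * exp (- (3 / 2 * y)))"
      unfolding norm_mult by (simp only: norm_of_int) (rule mult_left_mono, auto)
    also have "\<dots> = (\<bar>of_int k\<bar> / \<kappa>) * (E * exp (- (3 / 2 * y)))" by simp
    also have "\<dots> \<le> 1 * (E * exp (- (3 / 2 * y)))"
    proof (rule mult_right_mono)
      have "\<bar>real_of_int k\<bar> = - real_of_int k" using True by simp
      then have "\<bar>real_of_int k\<bar> \<le> \<kappa>" by (simp add: \<kappa>_def)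
      then show "\<bar>of_int k\<bar> / \<kappa> \<le> 1" using \<kappa> by (simp add: divide_le_eq)
    qed (use E0 in simp)
    also have "\<dots> \<le> (4 * E + 16200 * C) * exp (- (3 / 2 * y))"
      unfolding mult_1 by (rule mult_right_mono) (use E0 C in auto)
    finally show ?thesis .
  next
    case False
    then have k2: "k \<ge> 2" using k by linarith
    then have rk: "real_of_int k \<ge> 2" by linarith
    define \<kappa> where "\<kappa> = real_of_int k - 3 / 2"
    have \<kappa>: "\<kappa> > 0" using rk by (simp add: \<kappa>_def)
    have "norm (h y - h 2) \<le> E / \<kappa> * exp (\<kappa> * y) - E / \<kappa> * exp (\<kappa> * 2)"
      by (rule norm_diff_le_of_derivative_le[where h' = ?h' and G' = "\<lambda>t. E * exp (\<kappa> * t)", OF y d])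
        (use \<kappa> h'_le in \<open>auto intro!: derivative_eq_intros simp: \<kappa>_def\<close>)
    also have "\<dots> \<le> E / \<kappa> * exp (\<kappa> * y)" using E0 \<kappa> by simp
    finally have "norm (h y) \<le> norm (h 2) + E / \<kappa> * exp (\<kappa> * y)"
      using norm_triangle_sub[of "h y" "h 2"] by linarith
    then have "norm (\<delta> y) \<le> exp (- (of_int k * y)) * (exp (of_int k * 2) * norm (\<delta> 2) + E / \<kappa> * exp (\<kappa> * y))"
      unfolding \<delta>_h[of y] by (intro mult_left_mono) (auto simp: h_def norm_mult)
    also have "\<dots> = exp (- (of_int k * (y - 2))) * norm (\<delta> 2) + E / \<kappa> * exp (- (3 / 2 * y))"
    proof -
      have 1: "exp (- (of_int k * y)) * exp (of_int k * 2) = exp (- (of_int k * (y - 2)))"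
        "exp (- (of_int k * y)) * exp (\<kappa> * y) = exp (- (3 / 2 * y))"
        by (simp_all add: exp_add[symmetric] \<kappa>_def algebra_simps)
      have "A * (B * u + v * D) = (A * B) * u + v * (A * D)" for A B D u v :: real
        by (simp add: algebra_simps)
      then show ?thesis unfolding 1[symmetric] .
    qed
    finally have "norm (of_int k * \<delta> y) \<le> of_int k * (exp (- (of_int k * (y - 2))) * norm (\<delta> 2) + E / \<kappa> * exp (- (3 / 2 * y)))"
      unfolding norm_mult using rk by (simp only: norm_of_int) (rule mult_mono, auto)
    also have "\<dots> = exp (- (of_int k * (y - 2))) * norm (of_int k * \<delta> 2) + (of_int k / \<kappa>) * (E * exp (- (3 / 2 * y)))"
      using rk by (simp add: norm_mult algebra_simps)
    also have "\<dots> \<le> (81 * exp (- (3 / 2 * y))) * (200 * C) + 4 * (E * exp (- (3 / 2 * y)))"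
    proof (intro add_mono mult_mono)
      have "exp (- (of_int k * (y - 2))) \<le> exp (4 + - (3 / 2 * y))"
        using mult_right_mono[OF rk, of "y - 2"] y by simp
      also have "\<dots> \<le> 81 * exp (- (3 / 2 * y))" unfolding exp_add by (intro mult_right_mono exp_4_le) simp
      finally show "exp (- (of_int k * (y - 2))) \<le> 81 * exp (- (3 / 2 * y))" .
      show "norm (of_int k * \<delta> 2) \<le> 200 * C" using \<delta>_bd[of 2] by simp
      have "of_int k \<le> 4 * \<kappa>" using rk by (simp add: \<kappa>_def)
      then show "of_int k / \<kappa> \<le> 4" using \<kappa> by (simp add: divide_le_eq)
    qed (use E0 C in auto)
    finally show ?thesis by (simp add: algebra_simps)
  qed
  then show ?thesis by (simp add: \<delta>_def)
qed

lemma resp_close: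
  assumes f: "decays 1 C (src 1 xs k)" and g: "decays (-1) C (src (-1) xs k)"
    and E: "close C (src 1 xs k) (src (-1) xs k)"
  shows "close (16300 * C) (resp 1 xs k) (resp (-1) xs k)"
  unfolding close_def
proof (intro allI impI)
  fix y :: real assume y: "y \<ge> 2"
  let ?w = "down y"
  have C: "C \<ge> 0" by (rule decays_nonneg[OF f])
  have E': "norm (src 1 xs k ?w - src (-1) xs k ?w) \<le> C * exp (- (3 / 2 * y))"
    using E y by (simp add: close_def)
  have le: "C * exp (- (3 / 2 * y)) \<le> 16300 * C * exp (- (3 / 2 * y))"
    using C by (intro mult_right_mono) auto
  consider "k = 1" | "k = 0" | "k \<noteq> 0" "k \<noteq> 1" by blast
  then show "norm (resp 1 xs k ?w - resp (-1) xs k ?w) \<le> 16300 * C * exp (- (3 / 2 * y))"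
  proof cases
    case 1
    then show ?thesis using C by (simp add: resp_def)
  next
    case 2
    then show ?thesis using E' le by (simp add: resp_def)
  next
    case 3
    have "resp 1 xs k ?w - resp (-1) xs k ?w = (src 1 xs k ?w - src (-1) xs k ?w) - \<i> * (of_int k * (sol 1 k (src 1 xs k) ?w - sol (-1) k (src (-1) xs k) ?w))"
      using 3 by (simp add: resp_def algebra_simps)
    also have "norm \<dots> \<le> norm (src 1 xs k ?w - src (-1) xs k ?w) + norm (\<i> * (of_int k * (sol 1 k (src 1 xs k) ?w - sol (-1) k (src (-1) xs k) ?w)))"
      by (rule norm_triangle_ineq4)
    also have "\<dots> = norm (src 1 xs k ?w - src (-1) xs k ?w) + norm (of_int k * (sol 1 k (src 1 xs k) ?w - sol (-1) k (src (-1) xs k) ?w))"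
      by (simp only: norm_mult norm_ii mult_1)
    also have "\<dots> \<le> C * exp (- (3 / 2 * y)) + (4 * C + 16200 * C) * exp (- (3 / 2 * y))"
      by (intro add_mono E' sol_close[OF 3 f g E y])
    also have "\<dots> \<le> 16300 * C * exp (- (3 / 2 * y))" using C by (simp add: algebra_simps)
    finally show ?thesis .
  qed
qed

lemma dominated_infsum:
  fixes f :: "'i \<Rightarrow> complex"
  assumes "\<And>l. l \<in> A \<Longrightarrow> norm (f l) \<le> M l" "M summable_on A"
  shows "f summable_on A" "norm (infsum f A) \<le> infsum M A"
proof -
  have "(\<lambda>l. norm (f l)) summable_on A"
    by (rule summable_on_comparison_test[OF assms(2)]) (use assms(1) in auto)
  then show f: "f summable_on A" by (rule abs_summable_summable)
  show "norm (infsum f A) \<le> infsum M A"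
    by (rule norm_infsum_le[OF has_sum_infsum[OF f] has_sum_infsum[OF assms(2)] assms(1)])
qed

lemma has_sum_finite_sum:
  fixes f :: "'j \<Rightarrow> 'i \<Rightarrow> 'b::topological_comm_monoid_add"
  assumes "finite I" "\<And>i. i \<in> I \<Longrightarrow> (f i has_sum s i) A"
  shows "((\<lambda>x. \<Sum>i\<in>I. f i x) has_sum (\<Sum>i\<in>I. s i)) A"
  using assms by (induction I rule: finite_induct) (auto intro!: has_sum_add)

text \<open>The estimates that are reproduced by the recursion, with a single summable majorant \<open>S\<close> for the decay on both
  half-planes and for their closeness. The bound \<open>b\<close> of its sum turns into a bound of the multilinear form.\<close>

definition controlled :: "real \<Rightarrow> (int \<Rightarrow> real) \<Rightarrow> (int \<Rightarrow> complex) list \<Rightarrow> bool" where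
  "controlled b S xs \<longleftrightarrow> (\<forall>k. S k \<ge> 0) \<and> S summable_on UNIV \<and> infsum S UNIV \<le> b \<and>
     (\<forall>k. decays 1 (S k) (src 1 xs k) \<and> decays (-1) (S k) (src (-1) xs k) \<and>
       close (S k) (src 1 xs k) (src (-1) xs k))"

lemma controlled_decays:
  "controlled b S xs \<Longrightarrow> e \<in> {1, -1} \<Longrightarrow> decays e (S k) (src e xs k)"
  by (auto simp: controlled_def)

lemma controlled_resp_le:
  assumes "controlled b S xs" "e \<in> {1, -1}" "z \<in> half e"
  shows "norm (resp e xs k z) \<le> 401 * S k / norm z ^ 2"
  using resp_decays[OF assms(2) controlled_decays[OF assms(1,2)]] assms(3) by (simp add: decays_def)

lemma controlled_single:
  assumes "l1 x"
  shows "controlled (2 * l1_norm x) (\<lambda>k. 2 * norm (x k)) [x]"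
proof -
  have "decays e (2 * norm (x k)) (src e [x] k)" for e k
  proof -
    have eq: "src e [x] k = (\<lambda>z. - 2 * x k / z\<^sup>2)" by (simp add: fun_eq_iff src_single)
    show ?thesis
      unfolding decays_def eq
      by (auto simp: norm_divide norm_mult norm_power half_nonzero intro!: holomorphic_intros)
  qed
  moreover have "close (2 * norm (x k)) (src 1 [x] k) (src (-1) [x] k)" for k
    by (simp add: close_def src_single)
  moreover have "(\<lambda>k. 2 * norm (x k)) summable_on UNIV" "infsum (\<lambda>k. 2 * norm (x k)) UNIV = 2 * l1_norm x"
    using assms by (auto simp: l1_def l1_norm_def intro: summable_on_cmult_right infsum_cmult_right)
  ultimately show ?thesis by (simp add: controlled_def)
qed

lemma resp_product_bounds:
  assumes e: "e \<in> {1, -1}" and S: "controlled b S xs" and T: "controlled c T ys"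
  shows "z \<in> half e \<Longrightarrow> (\<lambda>l. resp e xs l z * resp e ys (k - l) z) summable_on UNIV"
    and "z \<in> half e \<Longrightarrow> norm (\<Sum>\<^sub>\<infinity>l. resp e xs l z * resp e ys (k - l) z) \<le> 160801 * (\<Sum>\<^sub>\<infinity>l. S l * T (k - l)) / norm z ^ 4"
    and "(\<lambda>z. \<Sum>\<^sub>\<infinity>l. resp e xs l z * resp e ys (k - l) z) holomorphic_on half e"
proof -
  have ST: "\<And>k. S k \<ge> 0" "S summable_on UNIV" "\<And>k. T k \<ge> 0" "T summable_on UNIV"
    using S T by (auto simp: controlled_def)
  note conv = convolution_has_sum[OF ST]
  \<comment> \<open>\<open>160801 = 401\<^sup>2\<close>\<close>
  have le: "norm (resp e xs l z * resp e ys (k - l) z) \<le> 160801 / norm z ^ 4 * (S l * T (k - l))" if "z \<in> half e" for z l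
  proof -
    have "norm (resp e xs l z * resp e ys (k - l) z) \<le> (401 * S l / norm z ^ 2) * (401 * T (k - l) / norm z ^ 2)"
      unfolding norm_mult using controlled_resp_le[OF S e that] controlled_resp_le[OF T e that] ST
      by (intro mult_mono) auto
    also have "\<dots> = 160801 / norm z ^ 4 * (S l * T (k - l))" by (simp add: power4_eq_xxxx power2_eq_square)
    finally show ?thesis .
  qed
  have sM: "(\<lambda>l. 160801 / norm z ^ 4 * (S l * T (k - l))) summable_on UNIV" for z :: complex
    using conv(1)[of k] by (intro summable_on_cmult_right)
  show "(\<lambda>l. resp e xs l z * resp e ys (k - l) z) summable_on UNIV" if "z \<in> half e"
    by (rule dominated_infsum(1)[OF le[OF that] sM])
  show "norm (\<Sum>\<^sub>\<infinity>l. resp e xs l z * resp e ys (k - l) z) \<le> 160801 * (\<Sum>\<^sub>\<infinity>l. S l * T (k - l)) / norm z ^ 4" if "z \<in> half e"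
    using dominated_infsum(2)[OF le[OF that] sM] unfolding infsum_cmult_right' by simp
  show "(\<lambda>z. \<Sum>\<^sub>\<infinity>l. resp e xs l z * resp e ys (k - l) z) holomorphic_on half e"
  proof (rule holomorphic_on_infsum[OF open_half])
    show "(\<lambda>z. resp e xs l z * resp e ys (k - l) z) holomorphic_on half e" for l
      using resp_decays[OF e controlled_decays[OF S e]] resp_decays[OF e controlled_decays[OF T e]]
      by (intro holomorphic_intros) (auto simp: decays_def)
    show "(\<lambda>l. 160801 * 16 * (S l * T (k - l))) summable_on UNIV"
      using conv(1)[of k] by (intro summable_on_cmult_right)
    fix l z assume z: "z \<in> half e"
    have "(1 / 2) ^ 4 \<le> norm z ^ 4" by (rule power_mono) (use half_norm_ge[OF e z] in auto)
    then have "160801 / norm z ^ 4 \<le> 160801 / ((1 / 2) ^ 4)"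
      by (intro divide_left_mono mult_pos_pos zero_less_power) (use half_nonzero[OF z] in auto)
    then have "160801 / norm z ^ 4 * (S l * T (k - l)) \<le> 160801 * 16 * (S l * T (k - l))"
      using ST by (intro mult_right_mono) (auto simp: power_divide)
    then show "norm (resp e xs l z * resp e ys (k - l) z) \<le> 160801 * 16 * (S l * T (k - l))"
      using le[OF z, of l] by linarith
  qed
qed

text \<open>Each of the two terms in the difference of the products pairs the closeness of one factor with the decay of the other, so the
  constant is \<open>13072600 = 2 \<cdot> 401 \<cdot> 16300\<close>.\<close>

lemma resp_product_close:
  assumes S: "controlled b S xs" and T: "controlled c T ys" and y: "y \<ge> 2"
  defines "w \<equiv> down y"
  shows "norm ((\<Sum>\<^sub>\<infinity>l. resp 1 xs l w * resp 1 ys (k - l) w) - (\<Sum>\<^sub>\<infinity>l. resp (-1) xs l w * resp (-1) ys (k - l) w))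
    \<le> 13072600 / y ^ 2 * exp (- (3 / 2 * y)) * (\<Sum>\<^sub>\<infinity>l. S l * T (k - l))"
proof -
  have ST: "\<And>k. S k \<ge> 0" "S summable_on UNIV" "\<And>k. T k \<ge> 0" "T summable_on UNIV"
    using S T by (auto simp: controlled_def)
  note conv = convolution_has_sum[OF ST]
  have w: "w \<in> half e" for e using minus_imaginary_in_half[of y e] y by (simp add: w_def)
  have nw: "norm w = y" using y by (simp add: w_def norm_mult)
  have "norm (resp 1 xs l w * resp 1 ys (k - l) w - resp (-1) xs l w * resp (-1) ys (k - l) w)
      \<le> 13072600 / y ^ 2 * exp (- (3 / 2 * y)) * (S l * T (k - l))" for l
  proof -
    have cx: "norm (resp 1 xs l w - resp (-1) xs l w) \<le> 16300 * S l * exp (- (3 / 2 * y))"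
      using resp_close[of "S l" xs l] S y by (auto simp: controlled_def close_def w_def)
    have cy: "norm (resp 1 ys (k - l) w - resp (-1) ys (k - l) w) \<le> 16300 * T (k - l) * exp (- (3 / 2 * y))"
      using resp_close[of "T (k - l)" ys "k - l"] T y by (auto simp: controlled_def close_def w_def)
    have "resp 1 xs l w * resp 1 ys (k - l) w - resp (-1) xs l w * resp (-1) ys (k - l) w
      = (resp 1 xs l w - resp (-1) xs l w) * resp 1 ys (k - l) w + resp (-1) xs l w * (resp 1 ys (k - l) w - resp (-1) ys (k - l) w)"
      by (simp add: algebra_simps)
    also have "norm \<dots> \<le> norm (resp 1 xs l w - resp (-1) xs l w) * norm (resp 1 ys (k - l) w) + norm (resp (-1) xs l w) * norm (resp 1 ys (k - l) w - resp (-1) ys (k - l) w)"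
      by (metis norm_mult norm_triangle_ineq)
    also have "\<dots> \<le> (16300 * S l * exp (- (3 / 2 * y))) * (401 * T (k - l) / y ^ 2) + (401 * S l / y ^ 2) * (16300 * T (k - l) * exp (- (3 / 2 * y)))"
      using cx cy controlled_resp_le[OF S _ w, of "-1" l] controlled_resp_le[OF T _ w, of 1 "k - l"] nw ST
      by (intro add_mono mult_mono) auto
    also have "\<dots> = 13072600 / y ^ 2 * exp (- (3 / 2 * y)) * (S l * T (k - l))" by simp
    finally show ?thesis .
  qed
  then have "norm (\<Sum>\<^sub>\<infinity>l. resp 1 xs l w * resp 1 ys (k - l) w - resp (-1) xs l w * resp (-1) ys (k - l) w)
      \<le> (\<Sum>\<^sub>\<infinity>l. 13072600 / y ^ 2 * exp (- (3 / 2 * y)) * (S l * T (k - l)))"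
    by (rule dominated_infsum(2)) (use conv(1)[of k] in \<open>intro summable_on_cmult_right\<close>)
  moreover have "(\<Sum>\<^sub>\<infinity>l. resp 1 xs l w * resp 1 ys (k - l) w - resp (-1) xs l w * resp (-1) ys (k - l) w)
     = (\<Sum>\<^sub>\<infinity>l. resp 1 xs l w * resp 1 ys (k - l) w) - (\<Sum>\<^sub>\<infinity>l. resp (-1) xs l w * resp (-1) ys (k - l) w)"
    using infsum_add[OF resp_product_bounds(1)[OF _ S T w, of 1 k]
        summable_on_uminus[THEN iffD2, OF resp_product_bounds(1)[OF _ S T w, of "-1" k]]]
    by (simp add: infsum_uminus)
  ultimately show ?thesis by (simp only: infsum_cmult_right')
qed

text \<open>The product of two responses decays like \<open>z\<^bsup>-4\<^esup>\<close>, which the factor \<open>z\<^sup>2\<close> of the source turns into the decay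
  \<open>z\<^bsup>-2\<^esup>\<close> that is required at the next step. The majorants are convolved. The constant exceeds both \<open>401\<^sup>2/8\<close>
  and \<open>2 \<cdot> 401 \<cdot> 16300/8\<close>.\<close>

lemma controlled_step:
  assumes n: "length xs \<ge> 2"
    and S: "\<And>i. i \<in> {1..<length xs} \<Longrightarrow> controlled (b i) (S i) (take i xs)"
    and T: "\<And>i. i \<in> {1..<length xs} \<Longrightarrow> controlled (c i) (T i) (drop i xs)"
  shows "controlled (2000000 * (\<Sum>i\<in>{1..<length xs}. b i * c i))
    (\<lambda>k. 2000000 * (\<Sum>i\<in>{1..<length xs}. \<Sum>\<^sub>\<infinity>l. S i l * T i (k - l))) xs"
proof -
  let ?I = "{1..<length xs}"
  let ?V = "\<lambda>k. \<Sum>i\<in>?I. \<Sum>\<^sub>\<infinity>l. S i l * T i (k - l)"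
  have ST: "\<And>k. S i k \<ge> 0" "S i summable_on UNIV" "\<And>k. T i k \<ge> 0" "T i summable_on UNIV"
      "infsum (S i) UNIV \<le> b i" "infsum (T i) UNIV \<le> c i" if "i \<in> ?I" for i
    using S[OF that] T[OF that] by (auto simp: controlled_def)
  have conv0: "(\<Sum>\<^sub>\<infinity>l. S i l * T i (k - l)) \<ge> 0" if "i \<in> ?I" for i k
    by (rule infsum_nonneg) (use ST[OF that] in auto)
  have V0: "?V k \<ge> 0" for k by (rule sum_nonneg) (use conv0 in auto)
  have hs: "((\<lambda>k. 2000000 * ?V k) has_sum 2000000 * (\<Sum>i\<in>?I. infsum (S i) UNIV * infsum (T i) UNIV)) UNIV"
    by (intro has_sum_cmult_right has_sum_finite_sum convolution_has_sum(2) ST) auto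
  have dec: "decays e (2000000 * ?V k) (src e xs k)" if e: "e \<in> {1, -1}" for e k
    unfolding decays_def
  proof (intro conjI ballI)
    show "src e xs k holomorphic_on half e"
      unfolding src_step[OF n]
      by (intro holomorphic_intros resp_product_bounds(3)[OF e S T]) auto
    fix z assume z: "z \<in> half e"
    have nz: "norm z > 0" using half_nonzero[OF z] by simp
    have "norm (src e xs k z) \<le> norm z ^ 2 / 8 * (\<Sum>i\<in>?I. norm (\<Sum>\<^sub>\<infinity>l. resp e (take i xs) l z * resp e (drop i xs) (k - l) z))"
      unfolding src_step[OF n] norm_mult norm_divide norm_power
      by (intro mult_mono norm_sum) auto
    also have "\<dots> \<le> norm z ^ 2 / 8 * (\<Sum>i\<in>?I. 160801 * (\<Sum>\<^sub>\<infinity>l. S i l * T i (k - l)) / norm z ^ 4)"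
      by (intro mult_left_mono sum_mono resp_product_bounds(2)[OF e S T z]) auto
    also have "\<dots> = 160801 / 8 * ?V k / norm z ^ 2"
      using nz by (simp add: sum_distrib_left[symmetric] sum_divide_distrib[symmetric] power4_eq_xxxx power2_eq_square)
    also have "\<dots> \<le> 2000000 * ?V k / norm z ^ 2"
      using V0[of k] by (intro divide_right_mono mult_right_mono) auto
    finally show "norm (src e xs k z) \<le> 2000000 * ?V k / norm z ^ 2" .
  qed
  have clo: "close (2000000 * ?V k) (src 1 xs k) (src (-1) xs k)" for k
    unfolding close_def
  proof (intro allI impI)
    fix y :: real assume y: "y \<ge> 2"
    define w where "w = down y"
    have nw: "norm w = y" using y by (simp add: w_def norm_mult)
    let ?c = "\<lambda>e i. \<Sum>\<^sub>\<infinity>l. resp e (take i xs) l w * resp e (drop i xs) (k - l) w"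
    have "src 1 xs k w - src (-1) xs k w = w\<^sup>2 / 8 * (\<Sum>i\<in>?I. ?c 1 i - ?c (-1) i)"
      unfolding src_step[OF n] by (simp add: sum_subtractf right_diff_distrib diff_divide_distrib)
    then have "norm (src 1 xs k w - src (-1) xs k w) = y ^ 2 / 8 * norm (\<Sum>i\<in>?I. ?c 1 i - ?c (-1) i)"
      by (simp only: norm_mult norm_divide norm_power nw) simp
    also have "\<dots> \<le> y ^ 2 / 8 * (\<Sum>i\<in>?I. norm (?c 1 i - ?c (-1) i))"
      by (intro mult_left_mono norm_sum) simp
    also have "\<dots> \<le> y ^ 2 / 8 * (\<Sum>i\<in>?I. 13072600 / y ^ 2 * exp (- (3 / 2 * y)) * (\<Sum>\<^sub>\<infinity>l. S i l * T i (k - l)))"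
      unfolding w_def by (intro mult_left_mono sum_mono resp_product_close[OF S T y]) auto
    also have "\<dots> = 13072600 / 8 * (?V k * exp (- (3 / 2 * y)))"
      unfolding sum_distrib_left[symmetric] using y by simp
    also have "\<dots> \<le> 2000000 * (?V k * exp (- (3 / 2 * y)))"
      using V0[of k] by (intro mult_right_mono) auto
    finally show "norm (src 1 xs k (down y) - src (-1) xs k (down y)) \<le> 2000000 * ?V k * exp (- (3 / 2 * y))"
      by (simp add: w_def mult.assoc)
  qed
  have "infsum (\<lambda>k. 2000000 * ?V k) UNIV \<le> 2000000 * (\<Sum>i\<in>?I. b i * c i)"
    unfolding infsumI[OF hs]
    by (intro mult_left_mono sum_mono mult_mono ST infsum_nonneg order_trans[OF _ ST(5)]) auto
  then show ?thesis
    using dec clo V0 has_sum_imp_summable[OF hs] by (auto simp: controlled_def)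
qed

lemma src_controlled:
  assumes "n \<ge> 1"
  shows "\<exists>C\<ge>0. \<forall>xs. length xs = n \<and> (\<forall>x\<in>set xs. l1 x) \<longrightarrow> (\<exists>S. controlled (C * (\<Prod>x\<leftarrow>xs. l1_norm x)) S xs)"
  using assms
proof (induction n rule: less_induct)
  case (less n)
  let ?P = "\<lambda>n C. C \<ge> 0 \<and> (\<forall>xs. length xs = n \<and> (\<forall>x\<in>set xs. l1 x) \<longrightarrow> (\<exists>S. controlled (C * (\<Prod>x\<leftarrow>xs. l1_norm x)) S xs))"
  show ?case
  proof (cases "n = 1")
    case True
    have "?P 1 2" using controlled_single by (fastforce simp: length_Suc_conv)
    then show ?thesis using True by blast
  next
    case False
    with less.prems have n: "n \<ge> 2" by simp
    have "\<forall>i\<in>{1..<n}. \<exists>C. ?P i C" using less.IH by (meson atLeastLessThan_iff)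
    then obtain c where c: "\<And>i. i \<in> {1..<n} \<Longrightarrow> ?P i (c i)" by metis
    show ?thesis
    proof (intro exI[of _ "2000000 * (\<Sum>i\<in>{1..<n}. c i * c (n - i))"] conjI allI impI)
      show "2000000 * (\<Sum>i\<in>{1..<n}. c i * c (n - i)) \<ge> 0"
      proof (intro mult_nonneg_nonneg sum_nonneg)
        fix i assume i: "i \<in> {1..<n}"
        then have "n - i \<in> {1..<n}" by auto
        then show "c i \<ge> 0" "c (n - i) \<ge> 0" using c i by blast+
      qed simp
      fix xs :: "(int \<Rightarrow> complex) list" assume xs: "length xs = n \<and> (\<forall>x\<in>set xs. l1 x)"
      have "\<exists>S. controlled (c i * (\<Prod>x\<leftarrow>take i xs. l1_norm x)) S (take i xs)" if "i \<in> {1..<n}" for i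
        using c[OF that] xs that in_set_takeD[of _ i xs] by auto
      then obtain S where S: "\<And>i. i \<in> {1..<n} \<Longrightarrow> controlled (c i * (\<Prod>x\<leftarrow>take i xs. l1_norm x)) (S i) (take i xs)"
        by metis
      have "\<exists>T. controlled (c (n - i) * (\<Prod>x\<leftarrow>drop i xs. l1_norm x)) T (drop i xs)" if i: "i \<in> {1..<n}" for i
      proof -
        have "n - i \<in> {1..<n}" using i by auto
        from c[OF this] show ?thesis using xs i in_set_dropD[of _ i xs] by auto
      qed
      then obtain T where T: "\<And>i. i \<in> {1..<n} \<Longrightarrow> controlled (c (n - i) * (\<Prod>x\<leftarrow>drop i xs. l1_norm x)) (T i) (drop i xs)"
        by metis
      have p: "(\<Prod>x\<leftarrow>take i xs. l1_norm x) * (\<Prod>x\<leftarrow>drop i xs. l1_norm x) = (\<Prod>x\<leftarrow>xs. l1_norm x)" for i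
        by (metis append_take_drop_id map_append prod_list.append)
      have eq: "(\<Sum>i\<in>{1..<n}. (c i * (\<Prod>x\<leftarrow>take i xs. l1_norm x)) * (c (n - i) * (\<Prod>x\<leftarrow>drop i xs. l1_norm x)))
          = (\<Sum>i\<in>{1..<n}. c i * c (n - i)) * (\<Prod>x\<leftarrow>xs. l1_norm x)"
        unfolding sum_distrib_right
      proof (rule sum.cong)
        fix i
        show "(c i * (\<Prod>x\<leftarrow>take i xs. l1_norm x)) * (c (n - i) * (\<Prod>x\<leftarrow>drop i xs. l1_norm x)) = c i * c (n - i) * (\<Prod>x\<leftarrow>xs. l1_norm x)"
          unfolding p[symmetric, of i] by (simp only: mult_ac)
      qed simp
      have "length xs \<ge> 2" using xs n by simp
      from controlled_step[OF this, of "\<lambda>i. c i * (\<Prod>x\<leftarrow>take i xs. l1_norm x)" S "\<lambda>i. c (n - i) * (\<Prod>x\<leftarrow>drop i xs. l1_norm x)" T]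
      show "\<exists>S. controlled (2000000 * (\<Sum>i\<in>{1..<n}. c i * c (n - i)) * (\<Prod>x\<leftarrow>xs. l1_norm x)) S xs"
        using S T xs eq by (auto simp: mult.assoc)
    qed
  qed
qed

lemma src_controlledE:
  assumes "xs \<noteq> []" "\<And>x. x \<in> set xs \<Longrightarrow> l1 x"
  obtains b S where "controlled b S xs"
  using src_controlled[of "length xs"] assms by (metis One_nat_def Suc_leI length_greater_0_conv)

lemma resp_linear_from_src:
  assumes e: "e \<in> {1, -1}" and f: "decays e C (src e us k)" and g: "decays e D (src e vs k)"
    and h: "\<And>z. z \<in> half e \<Longrightarrow> src e ws k z = \<alpha> * src e us k z + \<beta> * src e vs k z" and z: "z \<in> half e"
  shows "resp e ws k z = \<alpha> * resp e us k z + \<beta> * resp e vs k z"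
proof (cases "k = 0 \<or> k = 1")
  case True
  then show ?thesis using h[OF z] by (auto simp: resp_def)
next
  case False
  then have "sol e k (src e ws k) z = \<alpha> * sol e k (src e us k) z + \<beta> * sol e k (src e vs k) z"
    using sol_linear[OF e _ f g h z] by simp
  then show ?thesis using False h[OF z] by (simp add: resp_def algebra_simps)
qed

text \<open>In each product of the source the entry that varies belongs to exactly one of the two factors.\<close>

lemma src_linear:
  assumes e: "e \<in> {1, -1}"
  shows "\<lbrakk>\<And>x. x \<in> set xs \<Longrightarrow> l1 x; i < length xs; l1 u; l1 v; z \<in> half e\<rbrakk> \<Longrightarrow>
    src e (xs[i := (\<lambda>k. \<alpha> * u k + \<beta> * v k)]) k z = \<alpha> * src e (xs[i := u]) k z + \<beta> * src e (xs[i := v]) k z"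
proof (induction "length xs" arbitrary: xs i k z rule: less_induct)
  case less
  define w where "w = (\<lambda>k. \<alpha> * u k + \<beta> * v k)"
  have w: "l1 w" unfolding w_def by (rule l1_linear) fact+
  have l1_upd: "l1 x" if "x \<in> set (ys[j := y])" "l1 y" "\<And>x. x \<in> set ys \<Longrightarrow> l1 x" for x y ys j
    using that set_update_subset_insert[of ys j y] by auto
  have resp_lin: "resp e (ys[j := w]) l z' = \<alpha> * resp e (ys[j := u]) l z' + \<beta> * resp e (ys[j := v]) l z'"
    if len: "length ys < length xs" and ys: "\<And>x. x \<in> set ys \<Longrightarrow> l1 x" and j: "j < length ys" and z': "z' \<in> half e" for ys j l z'
  proof -
    have ne: "ys[j := y] \<noteq> []" for y using j by auto
    obtain b S where S: "controlled b S (ys[j := u])"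
      using src_controlledE[OF ne[of u]] l1_upd[OF _ \<open>l1 u\<close> ys] by metis
    obtain c T where T: "controlled c T (ys[j := v])"
      using src_controlledE[OF ne[of v]] l1_upd[OF _ \<open>l1 v\<close> ys] by metis
    show ?thesis
      by (rule resp_linear_from_src[OF e controlled_decays[OF S e] controlled_decays[OF T e] _ z'])
        (use less.hyps[OF len ys j \<open>l1 u\<close> \<open>l1 v\<close>] in \<open>simp add: w_def\<close>)
  qed
  show ?case
  proof (cases "length xs \<ge> 2")
    case False
    then have "length xs = Suc 0" using less.prems(2) by linarith
    then obtain x where "xs = [x]" "i = 0" using less.prems(2) by (auto simp: length_Suc_conv)
    then show ?thesis by (simp add: src_single algebra_simps add_divide_distrib diff_divide_distrib)
  next
    case True
    have summ: "(\<lambda>l. resp e ys l z * resp e zs (k - l) z) summable_on UNIV"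
      if "ys \<noteq> []" "zs \<noteq> []" "\<And>x. x \<in> set ys \<Longrightarrow> l1 x" "\<And>x. x \<in> set zs \<Longrightarrow> l1 x" for ys zs
      using src_controlledE[OF that(1,3)] src_controlledE[OF that(2,4)] resp_product_bounds(1)[OF e _ _ less.prems(5)]
      by metis
    have term_lin: "(\<Sum>\<^sub>\<infinity>l. resp e (take j (xs[i := w])) l z * resp e (drop j (xs[i := w])) (k - l) z)
        = \<alpha> * (\<Sum>\<^sub>\<infinity>l. resp e (take j (xs[i := u])) l z * resp e (drop j (xs[i := u])) (k - l) z)
        + \<beta> * (\<Sum>\<^sub>\<infinity>l. resp e (take j (xs[i := v])) l z * resp e (drop j (xs[i := v])) (k - l) z)"
      if j: "j \<in> {1..<length xs}" for j
    proof -
      have ne: "take j (xs[i := y]) \<noteq> []" "drop j (xs[i := y]) \<noteq> []" for y using j by auto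
      have l1_td: "l1 x" if "x \<in> set (take j (xs[i := y])) \<or> x \<in> set (drop j (xs[i := y]))" "l1 y" for x y
        using that l1_upd[of x xs i y] less.prems(1) in_set_takeD in_set_dropD by metis
      have "resp e (take j (xs[i := w])) l z * resp e (drop j (xs[i := w])) (k - l) z
          = \<alpha> * (resp e (take j (xs[i := u])) l z * resp e (drop j (xs[i := u])) (k - l) z)
          + \<beta> * (resp e (take j (xs[i := v])) l z * resp e (drop j (xs[i := v])) (k - l) z)" for l
      proof (cases "i < j")
        case True
        have "resp e ((take j xs)[i := w]) l z = \<alpha> * resp e ((take j xs)[i := u]) l z + \<beta> * resp e ((take j xs)[i := v]) l z"
          by (rule resp_lin) (use j True less.prems in \<open>auto dest: in_set_takeD\<close>)
        then show ?thesis using True by (simp add: take_update_swap algebra_simps)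
      next
        case False
        have "resp e ((drop j xs)[i - j := w]) (k - l) z = \<alpha> * resp e ((drop j xs)[i - j := u]) (k - l) z + \<beta> * resp e ((drop j xs)[i - j := v]) (k - l) z"
          by (rule resp_lin) (use j False less.prems in \<open>auto dest: in_set_dropD\<close>)
        then show ?thesis using False by (simp add: drop_update_swap algebra_simps)
      qed
      moreover have sm: "(\<lambda>l. c * (resp e (take j (xs[i := y])) l z * resp e (drop j (xs[i := y])) (k - l) z)) summable_on UNIV"
        if "l1 y" for y c
        by (rule summable_on_cmult_right, rule summ[OF ne]) (use l1_td that in blast)+
      ultimately show ?thesis
        by (simp only: infsum_add[OF sm[OF \<open>l1 u\<close>] sm[OF \<open>l1 v\<close>]] infsum_cmult_right')
    qed
    have src: "src e (xs[i := y]) k z = z\<^sup>2 / 8 * (\<Sum>j\<in>{1..<length xs}. \<Sum>\<^sub>\<infinity>l.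
        resp e (take j (xs[i := y])) l z * resp e (drop j (xs[i := y])) (k - l) z)" for y
      using src_step[of "xs[i := y]" e k z] True by simp
    have "A * (\<alpha> * U + \<beta> * V) = \<alpha> * (A * U) + \<beta> * (A * V)" for A U V :: complex by (simp add: algebra_simps)
    then have "src e (xs[i := w]) k z = \<alpha> * src e (xs[i := u]) k z + \<beta> * src e (xs[i := v]) k z"
      unfolding src by (simp only: term_lin sum.distrib sum_distrib_left[symmetric] cong: sum.cong)
    then show ?thesis by (simp add: w_def)
  qed
qed

section \<open>The splitting functional\<close>

text \<open>At the frequency \<open>1\<close> the branches of the solution differ asymptotically by a multiple of \<open>e\<^bsup>-y\<^esup>\<close> at
  \<open>z = -iy\<close>. The splitting functional is this multiple.\<close>

definition splitting :: "(int \<Rightarrow> complex) list \<Rightarrow> complex" where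
  "splitting xs = Lim at_top (\<lambda>y::real. of_real (exp y) *
     (sol 1 1 (src 1 xs 1) (down y) - sol (-1) 1 (src (-1) xs 1) (down y)))"

text \<open>The derivative of the expression is \<open>e\<^sup>y\<close> times the difference of the sources, which is \<open>O(e\<^bsup>-y/2\<^esup>)\<close>. The bound
  follows by comparison with the value at \<open>y = 2\<close>, where \<open>e\<^sup>2 \<le> 9\<close>.\<close>

lemma splitting_limit:
  assumes "controlled b S xs"
  shows "((\<lambda>y::real. of_real (exp y) *
     (sol 1 1 (src 1 xs 1) (down y) - sol (-1) 1 (src (-1) xs 1) (down y))) \<longlongrightarrow> splitting xs) at_top"
    and "norm (splitting xs) \<le> 30000 * b"
proof -
  have f: "decays 1 (S 1) (src 1 xs 1)" and g: "decays (-1) (S 1) (src (-1) xs 1)"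
    and cl: "close (S 1) (src 1 xs 1) (src (-1) xs 1)" and S: "\<And>k. S k \<ge> 0" "S summable_on UNIV" "infsum S UNIV \<le> b"
    using assms by (auto simp: controlled_def)
  define D where "D y = complex_of_real (exp y) *
     (sol 1 1 (src 1 xs 1) (down y) - sol (-1) 1 (src (-1) xs 1) (down y))" for y :: real
  let ?D' = "\<lambda>y. - \<i> * complex_of_real (exp y) * (src 1 xs 1 (down y) - src (-1) xs 1 (down y))"
  have d: "(D has_vector_derivative ?D' y) (at y)" if "y \<ge> 2" for y
    using sol_difference_derivative[of 1, OF _ f g] that unfolding D_def by simp
  have le: "norm (?D' y) \<le> S 1 * exp (- (1 / 2 * y))" if "y \<ge> 2" for y
  proof -
    have "norm (?D' y) \<le> exp y * (S 1 * exp (- (3 / 2 * y)))"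
      using cl that by (simp add: norm_mult close_def)
    also have "\<dots> = S 1 * exp (- (1 / 2 * y))" by (simp add: exp_add[symmetric])
    finally show ?thesis .
  qed
  have "\<exists>L. (D \<longlongrightarrow> L) at_top \<and> (\<forall>t\<ge>2. norm (D t - L) \<le> S 1 / (1 / 2) * exp (- (1 / 2 * t)))"
    using exponential_decay_limit[OF d le] by (metis half_gt_zero zero_less_one)
  then obtain L where L: "(D \<longlongrightarrow> L) at_top" "norm (D 2 - L) \<le> S 1 / (1 / 2) * exp (- (1 / 2 * 2))"
    by (meson order_refl)
  have sp: "splitting xs = L"
    unfolding splitting_def D_def[symmetric] using L(1) by (intro tendsto_Lim) auto
  then show "((\<lambda>y::real. of_real (exp y) *
     (sol 1 1 (src 1 xs 1) (down y) - sol (-1) 1 (src (-1) xs 1) (down y))) \<longlongrightarrow> splitting xs) at_top"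
    using L(1) by (simp add: D_def[abs_def])
  have w: "down 2 \<in> half e" for e by (rule minus_imaginary_in_half) simp
  have "norm (D 2) = exp 2 * norm (sol 1 1 (src 1 xs 1) (down 2) - sol (-1) 1 (src (-1) xs 1) (down 2))"
    by (simp add: D_def norm_mult)
  also have "\<dots> \<le> 9 * (1600 * S 1 + 1600 * S 1)"
  proof (intro mult_mono)
    have "exp (2::real) = exp 1 ^ 2" by (simp add: exp_of_nat_mult[symmetric])
    also have "\<dots> \<le> 3 ^ 2" by (intro power_mono exp_le) auto
    finally show "exp (2::real) \<le> 9" by simp
    show "norm (sol 1 1 (src 1 xs 1) (down 2) - sol (-1) 1 (src (-1) xs 1) (down 2)) \<le> 1600 * S 1 + 1600 * S 1"
      by (rule order_trans[OF norm_triangle_ineq4]) (intro add_mono sol_props(4)[OF _ _ f w] sol_props(4)[OF _ _ g w]; simp)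
  qed auto
  finally have "norm (D 2) \<le> 28800 * S 1" by simp
  moreover have "S 1 / (1 / 2) * exp (- (1 / 2 * 2)) \<le> 2 * S 1"
    using S(1)[of 1] by (simp add: mult_left_le)
  ultimately have "norm L \<le> 28800 * S 1 + 2 * S 1"
    using L(2) norm_triangle_sub[of L "D 2"] by (simp add: norm_minus_commute)
  moreover have "S 1 \<le> infsum S UNIV"
    using finite_sum_le_infsum[OF S(2), of "{1}"] S(1) by simp
  ultimately show "norm (splitting xs) \<le> 30000 * b" using S(3) S(1)[of 1] unfolding sp by linarith
qed

lemma splitting_bounded:
  assumes "n \<ge> 1"
  obtains C where "C \<ge> 0" "\<And>xs. \<lbrakk>length xs = n; \<And>x. x \<in> set xs \<Longrightarrow> l1 x\<rbrakk> \<Longrightarrow> norm (splitting xs) \<le> C * (\<Prod>x\<leftarrow>xs. l1_norm x)"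
proof -
  obtain C where C: "C \<ge> 0" "\<And>xs. \<lbrakk>length xs = n; \<And>x. x \<in> set xs \<Longrightarrow> l1 x\<rbrakk> \<Longrightarrow> \<exists>S. controlled (C * (\<Prod>x\<leftarrow>xs. l1_norm x)) S xs"
    using src_controlled[OF assms] by blast
  show ?thesis
  proof (rule that[of "30000 * C"])
    show "norm (splitting xs) \<le> 30000 * C * (\<Prod>x\<leftarrow>xs. l1_norm x)" if xs: "length xs = n" "\<And>x. x \<in> set xs \<Longrightarrow> l1 x" for xs
      using C(2)[OF xs] splitting_limit(2) by (metis mult.assoc)
  qed (use C in auto)
qed

lemma splitting_linear:
  assumes xs: "\<And>x. x \<in> set xs \<Longrightarrow> l1 x" and i: "i < length xs" and u: "l1 u" and v: "l1 v"
  shows "splitting (xs[i := (\<lambda>k. \<alpha> * u k + \<beta> * v k)]) = \<alpha> * splitting (xs[i := u]) + \<beta> * splitting (xs[i := v])"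
proof -
  define w where "w = (\<lambda>k. \<alpha> * u k + \<beta> * v k)"
  have w: "l1 w" unfolding w_def by (rule l1_linear[OF u v])
  have c: "\<exists>b S. controlled b S (xs[i := y])" if "l1 y" for y
  proof -
    have "xs[i := y] \<noteq> []" using i by auto
    moreover have "l1 x" if "x \<in> set (xs[i := y])" for x
      using that \<open>l1 y\<close> xs set_update_subset_insert[of xs i y] by auto
    ultimately show ?thesis using src_controlledE by metis
  qed
  obtain b S where S: "controlled b S (xs[i := u])" using c[OF u] by blast
  obtain c T where T: "controlled c T (xs[i := v])" using c[OF v] by blast
  obtain d U where U: "controlled d U (xs[i := w])" using c[OF w] by blast
  let ?D = "\<lambda>zs y. of_real (exp y) *
     (sol 1 1 (src 1 zs 1) (down y) - sol (-1) 1 (src (-1) zs 1) (down y))"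
  have "((\<lambda>y. \<alpha> * ?D (xs[i := u]) y + \<beta> * ?D (xs[i := v]) y) \<longlongrightarrow> \<alpha> * splitting (xs[i := u]) + \<beta> * splitting (xs[i := v])) at_top"
    by (intro tendsto_intros splitting_limit(1)[OF S] splitting_limit(1)[OF T])
  moreover have "\<forall>\<^sub>F y in at_top. \<alpha> * ?D (xs[i := u]) y + \<beta> * ?D (xs[i := v]) y = ?D (xs[i := w]) y"
    using eventually_gt_at_top[of 1]
  proof eventually_elim
    case (elim y)
    have "sol e 1 (src e (xs[i := w]) 1) (down y) = \<alpha> * sol e 1 (src e (xs[i := u]) 1) (down y)
        + \<beta> * sol e 1 (src e (xs[i := v]) 1) (down y)" if e: "e \<in> {1, -1}" for e
    proof (rule sol_linear[OF e _ controlled_decays[OF S e] controlled_decays[OF T e] _ minus_imaginary_in_half[OF elim]])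
      show "src e (xs[i := w]) 1 z = \<alpha> * src e (xs[i := u]) 1 z + \<beta> * src e (xs[i := v]) 1 z" if "z \<in> half e" for z
        unfolding w_def by (rule src_linear[OF e xs i u v that])
    qed simp
    from this[of 1] this[of "-1"] show ?case by (simp add: algebra_simps)
  qed
  ultimately have "(?D (xs[i := w]) \<longlongrightarrow> \<alpha> * splitting (xs[i := u]) + \<beta> * splitting (xs[i := v])) at_top"
    by (rule Lim_transform_eventually)
  then show ?thesis
    using tendsto_unique[OF trivial_limit_at_top_linorder splitting_limit(1)[OF U]] by (simp add: w_def)
qed

section \<open>Bounded multilinear forms define analytic functions\<close>

lemma coeff_norm_nonneg: "coeff_norm s x \<ge> 0"
  unfolding coeff_norm_def by (rule infsum_nonneg) simp

lemma coeff_space_linear: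
  assumes "u \<in> coeff_space s" "v \<in> coeff_space s"
  shows "(\<lambda>k. \<alpha> * u k + \<beta> * v k) \<in> coeff_space s"
proof -
  have "(\<lambda>k. norm (\<alpha> * u k + \<beta> * v k) * exp (s * \<bar>of_int k\<bar>)) summable_on UNIV"
  proof (rule summable_on_comparison_test)
    show "(\<lambda>k. norm \<alpha> * (norm (u k) * exp (s * \<bar>of_int k\<bar>)) + norm \<beta> * (norm (v k) * exp (s * \<bar>of_int k\<bar>))) summable_on UNIV"
      using assms by (intro summable_on_add summable_on_cmult_right) (auto simp: coeff_space_def)
    show "norm (\<alpha> * u k + \<beta> * v k) * exp (s * \<bar>of_int k\<bar>) \<le>
        norm \<alpha> * (norm (u k) * exp (s * \<bar>of_int k\<bar>)) + norm \<beta> * (norm (v k) * exp (s * \<bar>of_int k\<bar>))" for k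
      using mult_right_mono[OF norm_triangle_ineq[of "\<alpha> * u k" "\<beta> * v k"], of "exp (s * \<bar>of_int k\<bar>)"]
      by (simp add: norm_mult algebra_simps)
  qed auto
  then show ?thesis using assms by (simp add: coeff_space_def)
qed

lemma coeff_space_l1:
  assumes "x \<in> coeff_space s" "s > 0"
  shows "l1 x" "l1_norm x \<le> coeff_norm s x"
proof -
  have sm: "(\<lambda>k. norm (x k) * exp (s * \<bar>of_int k\<bar>)) summable_on UNIV" using assms by (simp add: coeff_space_def)
  have le: "norm (x k) \<le> norm (x k) * exp (s * \<bar>of_int k\<bar>)" for k
    using assms by (simp add: mult_le_cancel_left1)
  show l: "l1 x" unfolding l1_def by (rule summable_on_comparison_test[OF sm]) (use le in auto)
  show "l1_norm x \<le> coeff_norm s x"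
    unfolding l1_norm_def coeff_norm_def by (rule infsum_mono) (use l sm le in \<open>auto simp: l1_def\<close>)
qed

lemma splitting_multilinear_form:
  assumes "n \<ge> 1" "s > 0"
  shows "\<exists>C\<ge>0. multilinear_form s n C splitting"
proof -
  obtain C where C: "C \<ge> 0" "\<And>xs. \<lbrakk>length xs = n; \<And>x. x \<in> set xs \<Longrightarrow> l1 x\<rbrakk> \<Longrightarrow> norm (splitting xs) \<le> C * (\<Prod>x\<leftarrow>xs. l1_norm x)"
    using splitting_bounded[OF assms(1)] by metis
  have "multilinear_form s n C splitting"
    unfolding multilinear_form_def
  proof (intro allI impI conjI ballI)
    fix xs assume xs: "length xs = n \<and> set xs \<subseteq> coeff_space s"
    then have l: "l1 x" if "x \<in> set xs" for x using that coeff_space_l1(1)[of x s] assms(2) by blast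
    have "norm (splitting xs) \<le> C * (\<Prod>x\<leftarrow>xs. l1_norm x)" using C(2) xs l by blast
    also have "(\<Prod>x\<leftarrow>xs. l1_norm x) = (\<Prod>i<n. l1_norm (xs ! i))"
      using xs by (simp add: prod.list_conv_set_nth atLeast0LessThan)
    also have "C * (\<Prod>i<n. l1_norm (xs ! i)) \<le> C * (\<Prod>i<n. coeff_norm s (xs ! i))"
    proof (intro mult_left_mono prod_mono conjI C(1) l1_norm_nonneg)
      show "l1_norm (xs ! i) \<le> coeff_norm s (xs ! i)" if "i \<in> {..<n}" for i
        using xs that assms(2) nth_mem[of i xs] by (intro coeff_space_l1(2)) auto
    qed
    finally show "norm (splitting xs) \<le> C * (\<Prod>i<n. coeff_norm s (xs ! i))" .
    fix i u v \<alpha> \<beta> assume "i < n" "u \<in> coeff_space s" "v \<in> coeff_space s"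
    then show "splitting (xs[i := (\<lambda>k. \<alpha> * u k + \<beta> * v k)]) = \<alpha> * splitting (xs[i := u]) + \<beta> * splitting (xs[i := v])"
      using splitting_linear[OF l] xs coeff_space_l1(1)[OF _ assms(2)] by simp
  qed
  then show ?thesis using C(1) by blast
qed

text \<open>For the expansion of \<open>A\<close> at \<open>n\<close> copies of \<open>a + x\<close>: the sum of the values of \<open>A\<close> over all the lists that arise from
  \<open>ys\<close> by appending \<open>k\<close> further entries, namely those of \<open>xs\<close> in their order, interspersed with copies of \<open>a\<close>. It is
  linear in every entry of \<open>xs\<close>.\<close>

fun expansion :: "((int \<Rightarrow> complex) list \<Rightarrow> complex) \<Rightarrow> (int \<Rightarrow> complex) \<Rightarrow> nat \<Rightarrow>
    (int \<Rightarrow> complex) list \<Rightarrow> (int \<Rightarrow> complex) list \<Rightarrow> complex" where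
  "expansion A a 0 ys xs = (if xs = [] then A ys else 0)"
| "expansion A a (Suc k) ys [] = expansion A a k (ys @ [a]) []"
| "expansion A a (Suc k) ys (x # xs) = expansion A a k (ys @ [a]) (x # xs) + expansion A a k (ys @ [x]) xs"

lemma expansion_eq_0: "length xs > k \<Longrightarrow> expansion A a k ys xs = 0"
  by (induction A a k ys xs rule: expansion.induct) auto

context
  fixes s :: real and n :: nat and C :: real and A :: "(int \<Rightarrow> complex) list \<Rightarrow> complex" and a :: "int \<Rightarrow> complex"
  assumes A: "multilinear_form s n C A" and C: "C \<ge> 0" and a: "a \<in> coeff_space s"
begin

lemma multilinear_bound:
  assumes "length ys = n" "set ys \<subseteq> coeff_space s"
  shows "norm (A ys) \<le> C * (\<Prod>y\<leftarrow>ys. coeff_norm s y)"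
proof -
  have "norm (A ys) \<le> C * (\<Prod>i<n. coeff_norm s (ys ! i))" using A assms by (simp add: multilinear_form_def)
  also have "(\<Prod>i<n. coeff_norm s (ys ! i)) = (\<Prod>y\<leftarrow>ys. coeff_norm s y)"
    using assms by (simp add: prod.list_conv_set_nth atLeast0LessThan)
  finally show ?thesis .
qed

lemma multilinear_linear:
  assumes "length ys = n" "set ys \<subseteq> coeff_space s" "i < n" "u \<in> coeff_space s" "v \<in> coeff_space s"
  shows "A (ys[i := (\<lambda>k. \<alpha> * u k + \<beta> * v k)]) = \<alpha> * A (ys[i := u]) + \<beta> * A (ys[i := v])"
  using A assms by (simp add: multilinear_form_def)

lemma prod_list_coeff_norm_nonneg: "(\<Prod>y\<leftarrow>ys. coeff_norm s y) \<ge> 0"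
  by (induction ys) (auto intro: mult_nonneg_nonneg coeff_norm_nonneg)

text \<open>The number of the terms is absorbed by the \<open>1\<close> in \<open>(1 + \<parallel>a\<parallel>)\<^sup>k\<close>: the recursion leaves room for a factor
  \<open>\<parallel>a\<parallel>\<close> in one summand and for a factor \<open>1\<close> in the other.\<close>

lemma expansion_bound:
  "\<lbrakk>length ys + k = n; set ys \<subseteq> coeff_space s; set xs \<subseteq> coeff_space s\<rbrakk> \<Longrightarrow>
    norm (expansion A a k ys xs) \<le> C * (\<Prod>y\<leftarrow>ys. coeff_norm s y) * (1 + coeff_norm s a) ^ k * (\<Prod>x\<leftarrow>xs. coeff_norm s x)"
proof (induction k arbitrary: ys xs)
  case 0
  then show ?case
    using multilinear_bound[of ys] C prod_list_coeff_norm_nonneg[of ys] prod_list_coeff_norm_nonneg[of xs]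
    by (auto intro!: mult_nonneg_nonneg)
next
  case (Suc k)
  let ?Y = "\<Prod>y\<leftarrow>ys. coeff_norm s y" and ?X = "\<lambda>xs. \<Prod>x\<leftarrow>xs. coeff_norm s x" and ?q = "(1 + coeff_norm s a) ^ k"
  have a0: "coeff_norm s a \<ge> 0" by (rule coeff_norm_nonneg)
  have nn: "C * ?Y * ?q * ?X zs \<ge> 0" for zs
    using C a0 prod_list_coeff_norm_nonneg[of ys] prod_list_coeff_norm_nonneg[of zs] by simp
  have 1: "norm (expansion A a k (ys @ [a]) xs) \<le> coeff_norm s a * (C * ?Y * ?q * ?X xs)"
    using Suc.IH[of "ys @ [a]" xs] Suc.prems a by (simp add: mult_ac)
  have goal: "C * ?Y * (1 + coeff_norm s a) ^ Suc k * ?X xs = coeff_norm s a * (C * ?Y * ?q * ?X xs) + C * ?Y * ?q * ?X xs"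
    by (simp add: algebra_simps)
  show ?case
  proof (cases xs)
    case Nil
    then show ?thesis using 1 nn[of xs] unfolding goal by simp
  next
    case (Cons x zs)
    have "norm (expansion A a k (ys @ [x]) zs) \<le> C * ?Y * ?q * ?X xs"
      using Suc.IH[of "ys @ [x]" zs] Suc.prems Cons by (simp add: mult_ac)
    then show ?thesis
      unfolding goal using 1 Cons norm_triangle_ineq[of "expansion A a k (ys @ [a]) xs" "expansion A a k (ys @ [x]) zs"] by simp
  qed
qed

lemma expansion_linear_prefix:
  "\<lbrakk>length ys + k = n; set ys \<subseteq> coeff_space s; set xs \<subseteq> coeff_space s; i < length ys; u \<in> coeff_space s; v \<in> coeff_space s\<rbrakk> \<Longrightarrow>
    expansion A a k (ys[i := (\<lambda>k. \<alpha> * u k + \<beta> * v k)]) xs = \<alpha> * expansion A a k (ys[i := u]) xs + \<beta> * expansion A a k (ys[i := v]) xs"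
proof (induction k arbitrary: ys xs)
  case 0
  then show ?case using multilinear_linear[of ys i u v \<alpha> \<beta>] by auto
next
  case (Suc k)
  have 1: "expansion A a k (ys[i := (\<lambda>k. \<alpha> * u k + \<beta> * v k)] @ [b]) zs
      = \<alpha> * expansion A a k (ys[i := u] @ [b]) zs + \<beta> * expansion A a k (ys[i := v] @ [b]) zs"
    if "b \<in> coeff_space s" "set zs \<subseteq> coeff_space s" for b zs
    using Suc.IH[of "ys @ [b]" zs] Suc.prems that by (simp add: list_update_append1)
  show ?case
  proof (cases xs)
    case Nil
    then show ?thesis using 1[OF a, of "[]"] by simp
  next
    case (Cons x zs)
    then show ?thesis using 1[OF a, of xs] 1[of x zs] Suc.prems by (simp add: algebra_simps)
  qed
qed

lemma expansion_linear:
  "\<lbrakk>length ys + k = n; set ys \<subseteq> coeff_space s; set xs \<subseteq> coeff_space s; i < length xs; u \<in> coeff_space s; v \<in> coeff_space s\<rbrakk> \<Longrightarrow>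
    expansion A a k ys (xs[i := (\<lambda>k. \<alpha> * u k + \<beta> * v k)]) = \<alpha> * expansion A a k ys (xs[i := u]) + \<beta> * expansion A a k ys (xs[i := v])"
proof (induction k arbitrary: ys xs i)
  case 0
  then have "xs \<noteq> []" by auto
  then show ?case by simp
next
  case (Suc k)
  let ?w = "\<lambda>k. \<alpha> * u k + \<beta> * v k"
  obtain x zs where xs: "xs = x # zs" using Suc.prems by (cases xs) auto
  have 1: "expansion A a k (ys @ [a]) (xs[i := ?w]) = \<alpha> * expansion A a k (ys @ [a]) (xs[i := u]) + \<beta> * expansion A a k (ys @ [a]) (xs[i := v])"
    using Suc.IH[of "ys @ [a]" xs i] Suc.prems a by simp
  show ?case
  proof (cases i)
    case 0
    have "expansion A a k (ys @ [?w]) zs = \<alpha> * expansion A a k (ys @ [u]) zs + \<beta> * expansion A a k (ys @ [v]) zs"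
      using expansion_linear_prefix[of "ys @ [x]" k zs "length ys" u v \<alpha> \<beta>] Suc.prems xs by simp
    then show ?thesis using 1 0 xs by (simp add: algebra_simps)
  next
    case (Suc j)
    have "expansion A a k (ys @ [x]) (zs[j := ?w]) = \<alpha> * expansion A a k (ys @ [x]) (zs[j := u]) + \<beta> * expansion A a k (ys @ [x]) (zs[j := v])"
      using Suc.IH[of "ys @ [x]" zs j] Suc.prems xs Suc by simp
    then show ?thesis using 1 Suc xs by (simp add: algebra_simps)
  qed
qed

lemma expansion_sum:
  "\<lbrakk>length ys + k = n; set ys \<subseteq> coeff_space s; x \<in> coeff_space s\<rbrakk> \<Longrightarrow>
    (\<Sum>m\<le>k. expansion A a k ys (replicate m x)) = A (ys @ replicate k (\<lambda>j. a j + x j))"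
proof (induction k arbitrary: ys)
  case 0
  then show ?case by simp
next
  case (Suc k)
  let ?w = "\<lambda>j. 1 * a j + 1 * x j"
  have w: "?w \<in> coeff_space s" by (rule coeff_space_linear[OF a Suc.prems(3)])
  have "(\<Sum>m\<le>Suc k. expansion A a (Suc k) ys (replicate m x))
      = expansion A a k (ys @ [a]) [] + (\<Sum>m\<le>k. expansion A a k (ys @ [a]) (replicate (Suc m) x) + expansion A a k (ys @ [x]) (replicate m x))"
    by (subst sum.atMost_Suc_shift) simp
  also have "\<dots> = (\<Sum>m\<le>Suc k. expansion A a k (ys @ [a]) (replicate m x)) + (\<Sum>m\<le>k. expansion A a k (ys @ [x]) (replicate m x))"
    by (subst sum.atMost_Suc_shift) (simp add: sum.distrib)
  also have "(\<Sum>m\<le>Suc k. expansion A a k (ys @ [a]) (replicate m x)) = (\<Sum>m\<le>k. expansion A a k (ys @ [a]) (replicate m x))"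
    by (simp add: expansion_eq_0 del: replicate.simps)
  also have "\<dots> = A ((ys @ [a]) @ replicate k (\<lambda>j. a j + x j))" by (rule Suc.IH) (use Suc.prems a in auto)
  also have "(\<Sum>m\<le>k. expansion A a k (ys @ [x]) (replicate m x)) = A ((ys @ [x]) @ replicate k (\<lambda>j. a j + x j))"
    by (rule Suc.IH) (use Suc.prems in auto)
  also have "A ((ys @ [a]) @ replicate k (\<lambda>j. a j + x j)) + A ((ys @ [x]) @ replicate k (\<lambda>j. a j + x j))
      = A (ys @ replicate (Suc k) (\<lambda>j. a j + x j))"
    using multilinear_linear[of "(ys @ [a]) @ replicate k (\<lambda>j. a j + x j)" "length ys" a x 1 1] Suc.prems a w
    by (simp add: list_update_append set_replicate_conv_if)
  finally show ?case .
qed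

text \<open>The power series of the polynomial at \<open>a\<close> is finite, so that any radius would do; \<open>R = 1\<close> is taken.\<close>

lemma expansion_analytic_at:
  "\<exists>C>0. \<exists>R>0. \<exists>B. (\<forall>m. multilinear_form s m (C * R ^ m) (B m)) \<and>
        (\<forall>x\<in>coeff_space s. R * coeff_norm s x < 1 \<longrightarrow>
           (\<lambda>m. B m (replicate m x)) sums A (replicate n (\<lambda>k. a k + x k)))"
proof -
  have pos: "0 < C * (1 + coeff_norm s a) ^ n + 1"
    using C coeff_norm_nonneg[of s a] by (intro add_nonneg_pos mult_nonneg_nonneg) auto
  have form: "multilinear_form s m ((C * (1 + coeff_norm s a) ^ n + 1) * 1 ^ m) (expansion A a n [])" for m
    unfolding multilinear_form_def
  proof (intro allI impI conjI ballI)
    fix xs assume xs: "length xs = m \<and> set xs \<subseteq> coeff_space s"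
    have p: "(\<Prod>x\<leftarrow>xs. coeff_norm s x) = (\<Prod>i<m. coeff_norm s (xs ! i))"
      using xs by (simp add: prod.list_conv_set_nth atLeast0LessThan)
    have "norm (expansion A a n [] xs) \<le> C * (1 + coeff_norm s a) ^ n * (\<Prod>x\<leftarrow>xs. coeff_norm s x)"
      using expansion_bound[of "[]" n xs] xs by simp
    also have "\<dots> \<le> (C * (1 + coeff_norm s a) ^ n + 1) * 1 ^ m * (\<Prod>x\<leftarrow>xs. coeff_norm s x)"
      using prod_list_coeff_norm_nonneg[of xs] by (intro mult_right_mono) auto
    finally show "norm (expansion A a n [] xs) \<le> (C * (1 + coeff_norm s a) ^ n + 1) * 1 ^ m * (\<Prod>i<m. coeff_norm s (xs ! i))"
      unfolding p .
    fix i u v \<alpha> \<beta> assume "i < m" "u \<in> coeff_space s" "v \<in> coeff_space s"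
    then show "expansion A a n [] (xs[i := (\<lambda>k. \<alpha> * u k + \<beta> * v k)]) = \<alpha> * expansion A a n [] (xs[i := u]) + \<beta> * expansion A a n [] (xs[i := v])"
      using expansion_linear[of "[]" n xs i u v \<alpha> \<beta>] xs by simp
  qed
  have sums: "(\<lambda>m. expansion A a n [] (replicate m x)) sums A (replicate n (\<lambda>k. a k + x k))" if x: "x \<in> coeff_space s" for x
  proof -
    have "(\<lambda>m. expansion A a n [] (replicate m x)) sums (\<Sum>m\<le>n. expansion A a n [] (replicate m x))"
    by (rule sums_finite) (auto intro: expansion_eq_0)
    then show ?thesis using expansion_sum[of "[]" n x] x by simp
  qed
  show ?thesis
    by (rule exI[of _ "C * (1 + coeff_norm s a) ^ n + 1"], rule conjI[OF pos],
        rule exI[of _ "1::real"], rule conjI, simp, rule exI[of _ "\<lambda>m. expansion A a n []"])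
      (use form sums in blast)
qed

end

lemma coeff_analytic_splitting:
  assumes "n \<ge> 1" "s > 0"
  shows "coeff_analytic s (\<lambda>a. splitting (replicate n a))"
proof -
  obtain C where "C \<ge> 0" "multilinear_form s n C splitting"
    using splitting_multilinear_form[OF assms] by blast
  then show ?thesis
    unfolding coeff_analytic_def using expansion_analytic_at by blast
qed

section \<open>The splitting functional in degrees one and two\<close>

lemma decays_inverse_square: "decays e (norm c) (\<lambda>z. c / z\<^sup>2)"
  unfolding decays_def
  by (auto simp: norm_divide norm_power half_nonzero intro!: holomorphic_intros)

text \<open>The integrand differs from \<open>i e\<^bsup>iw\<^esup>/w\<close> by the derivative of \<open>-e\<^bsup>iw\<^esup>/w\<close>, and the integral of the former
  is given by Cauchy's formula, as the triangle winds once around the origin.\<close>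

lemma contour_integral_triangle_exp:
  assumes y: "y > 0" and t: "t > 2 * y"
  defines "a \<equiv> down y" and "b \<equiv> Complex t (t / 2 - y)" and "c \<equiv> Complex (- t) (t / 2 - y)"
  shows "((\<lambda>w. exp (\<i> * w) / w\<^sup>2) has_contour_integral - (2 * pi)) (linepath a b +++ linepath b c +++ linepath c a)"
proof -
  let ?\<gamma> = "linepath a b +++ linepath b c +++ linepath c a"
  have nc: "\<not> collinear {a, b, c}"
    using y t by (auto simp: collinear_3_expand a_def b_def c_def complex_eq_iff algebra_simps)
  have int: "0 \<in> interior (convex hull {a, b, c})"
  proof -
    define u where "u = (t / 2 - y) / (t / 2)"
    have u: "0 < u" "u < 1" using y t by (auto simp: u_def divide_less_eq)
    have "u *\<^sub>R a + ((1 - u) / 2) *\<^sub>R b + ((1 - u) / 2) *\<^sub>R c = 0"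
      using y t by (simp add: a_def b_def c_def complex_eq_iff u_def field_simps)
    then show ?thesis
      unfolding interior_convex_hull_3_minimal[OF nc DIM_complex]
      using u by (intro CollectI exI[of _ u] exI[of _ "(1 - u) / 2"]) auto
  qed
  have Im: "Im ((b - a) * cnj (b - 0)) = t * y"
    by (simp add: a_def b_def algebra_simps)
  have wn: "winding_number ?\<gamma> 0 = 1"
    using winding_number_triangle[OF int] y t unfolding Im by simp
  have vp: "valid_path ?\<gamma>" by auto
  have nz: "path_image ?\<gamma> \<subseteq> - {0}"
  proof -
    have "w \<noteq> 0" if "w \<in> closed_segment a b \<or> w \<in> closed_segment b c \<or> w \<in> closed_segment c a" for w
      using that y t by (auto simp: closed_segment_def a_def b_def c_def complex_eq_iff algebra_simps)
    then show ?thesis by (auto simp: path_image_join)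
  qed
  have "((\<lambda>w. exp (\<i> * w) / (w - 0)) has_contour_integral (2 * pi * \<i> * winding_number ?\<gamma> 0 * exp (\<i> * 0))) ?\<gamma>"
    by (rule Cauchy_integral_formula_convex_simple[of UNIV]) (use vp nz in \<open>auto intro!: holomorphic_intros\<close>)
  then have 1: "((\<lambda>w. \<i> * (exp (\<i> * w) / w)) has_contour_integral \<i> * (2 * pi * \<i>)) ?\<gamma>"
    using wn by (intro has_contour_integral_lmul) simp
  have "((\<lambda>w. exp (\<i> * w) / w\<^sup>2 - \<i> * (exp (\<i> * w) / w)) has_contour_integral
      (\<lambda>w. - exp (\<i> * w) / w) (pathfinish ?\<gamma>) - (\<lambda>w. - exp (\<i> * w) / w) (pathstart ?\<gamma>)) ?\<gamma>"
    by (rule contour_integral_primitive[OF _ vp nz])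
      (auto intro!: derivative_eq_intros simp: field_simps power2_eq_square)
  then have 2: "((\<lambda>w. exp (\<i> * w) / w\<^sup>2 - \<i> * (exp (\<i> * w) / w)) has_contour_integral 0) ?\<gamma>" by simp
  show ?thesis using has_contour_integral_add[OF 2 1] by (simp add: mult_ac)
qed

text \<open>Multiplied by \<open>e\<^bsup>iz\<^esup>\<close>, the two solutions are the primitives of \<open>c e\<^bsup>iz\<^esup>/z\<^sup>2\<close> that vanish at the upper left and
  at the upper right end of the plane. Their difference at \<open>-iy\<close> is thus an integral along a path
  around the origin. The path is completed to a triangle by a segment high up, on which the integrand is
  exponentially small; the value is a residue.\<close>

lemma inverse_square_jump:
  fixes c :: complex
  assumes y: "y > 1"
  shows "of_real (exp y) * (sol 1 1 (\<lambda>z. c / z\<^sup>2) (down y) - sol (-1) 1 (\<lambda>z. c / z\<^sup>2) (down y)) = - (2 * pi) * c"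
proof -
  define a where "a = down y"
  define q where "q e = sol e 1 (\<lambda>z. c / z\<^sup>2)" for e
  define h where "h e w = exp (\<i> * w) * q e w" for e w
  note dec = decays_inverse_square[of _ c]
  have ah: "a \<in> half e" for e unfolding a_def by (rule minus_imaginary_in_half[OF y])
  have dh: "(h e has_field_derivative c * (exp (\<i> * w) / w\<^sup>2)) (at w)" if e: "e \<in> {1, -1}" and w: "w \<in> half e" for e w
  proof -
    have E: "((\<lambda>w. exp (\<i> * w)) has_field_derivative exp (\<i> * w) * \<i>) (at w)"
      by (auto intro!: derivative_eq_intros)
    have Q: "(q e has_field_derivative (c / w\<^sup>2 - \<i> * q e w)) (at w)"
      using sol_props(2)[OF e _ dec w, of 1] by (simp add: q_def)
    have "exp (\<i> * w) * \<i> * q e w + (c / w\<^sup>2 - \<i> * q e w) * exp (\<i> * w) = c * (exp (\<i> * w) / w\<^sup>2)"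
      by (simp add: algebra_simps)
    then show ?thesis using DERIV_mult[OF E Q] unfolding h_def by simp
  qed
  have ci: "((\<lambda>w. c * (exp (\<i> * w) / w\<^sup>2)) has_contour_integral h e v - h e u) (linepath u v)"
    if e: "e \<in> {1, -1}" and "u \<in> half e" "v \<in> half e" for e u v
  proof -
    have "((\<lambda>w. c * (exp (\<i> * w) / w\<^sup>2)) has_contour_integral h e (pathfinish (linepath u v)) - h e (pathstart (linepath u v))) (linepath u v)"
      by (rule contour_integral_primitive[OF has_field_derivative_at_within[OF dh[OF e]]])
        (use closed_segment_subset[OF that(2,3) convex_half] in simp_all)
    then show ?thesis by simp
  qed
  define K where "K = h 1 a - h (-1) a"
  have le: "norm (K + 2 * pi * c) \<le> norm c * exp y * ((2 * t + 3200) * exp (- (t / 2)))" if t: "t \<ge> 2 * y + 2" for t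
  proof -
    define b where "b = Complex t (t / 2 - y)"
    define d where "d = Complex (- t) (t / 2 - y)"
    have bh: "b \<in> half (-1)" and dh: "d \<in> half 1" using y t by (auto simp: b_def d_def half_def)
    have tot: "((\<lambda>w. c * (exp (\<i> * w) / w\<^sup>2)) has_contour_integral c * (- (2 * pi))) (linepath a b +++ linepath b d +++ linepath d a)"
      unfolding a_def b_def d_def
      by (rule has_contour_integral_lmul) (use contour_integral_triangle_exp[of y t] y t in simp)
    have "(\<lambda>w. c * (exp (\<i> * w) / w\<^sup>2)) contour_integrable_on (linepath b d)"
    proof (rule contour_integrable_continuous_linepath)
      have "w \<noteq> 0" if "w \<in> closed_segment b d" for w
        using that y t by (auto simp: closed_segment_def b_def d_def complex_eq_iff algebra_simps)
      then show "continuous_on (closed_segment b d) (\<lambda>w. c * (exp (\<i> * w) / w\<^sup>2))"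
        by (intro continuous_intros) auto
    qed
    then obtain J where J: "((\<lambda>w. c * (exp (\<i> * w) / w\<^sup>2)) has_contour_integral J) (linepath b d)"
      by (auto simp: contour_integrable_on_def)
    have "((\<lambda>w. c * (exp (\<i> * w) / w\<^sup>2)) has_contour_integral (h (-1) b - h (-1) a) + (J + (h 1 a - h 1 d))) (linepath a b +++ linepath b d +++ linepath d a)"
      by (intro has_contour_integral_join ci ah bh dh J) auto
    then have eq: "c * (- (2 * pi)) = (h (-1) b - h (-1) a) + (J + (h 1 a - h 1 d))"
      using tot has_contour_integral_unique by blast
    have Im: "Im w = t / 2 - y" if w: "w \<in> closed_segment b d" for w
    proof -
      obtain u where u: "w = (1 - u) *\<^sub>R b + u *\<^sub>R d" using w by (auto simp: in_segment)
      show ?thesis unfolding u by (simp add: b_def d_def algebra_simps)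
    qed
    have ex: "exp (- (t / 2 - y)) = exp y * exp (- (t / 2))" by (simp add: exp_add[symmetric])
    have "norm J \<le> norm c * exp (- (t / 2 - y)) * norm (d - b)"
    proof (rule has_contour_integral_bound_linepath[OF J])
      fix w assume w: "w \<in> closed_segment b d"
      have "1 \<le> norm w" using abs_Im_le_cmod[of w] Im[OF w] t by linarith
      then have "1 \<le> norm w ^ 2" by (rule one_le_power)
      have "norm (c * (exp (\<i> * w) / w\<^sup>2)) = norm c * exp (- (t / 2 - y)) / norm w ^ 2"
        using Im[OF w] by (simp add: norm_mult norm_divide norm_power norm_exp_eq_Re)
      also have "\<dots> \<le> norm c * exp (- (t / 2 - y))"
        using divide_left_mono[OF \<open>1 \<le> norm w ^ 2\<close>, of "norm c * exp (- (t / 2 - y))"] \<open>1 \<le> norm w ^ 2\<close>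
        by (cases "w = 0") simp_all
      finally show "norm (c * (exp (\<i> * w) / w\<^sup>2)) \<le> norm c * exp (- (t / 2 - y))" .
    qed simp
    also have "norm (d - b) = 2 * t"
    proof -
      have "d - b = of_real (- 2 * t)" by (simp add: d_def b_def complex_eq_iff)
      then show ?thesis using t y by (simp only: norm_of_real)
    qed
    finally have J_le: "norm J \<le> norm c * exp y * (2 * t * exp (- (t / 2)))" unfolding ex by (simp add: mult_ac)
    have h_le: "norm (h e w) \<le> norm c * exp y * (1600 * exp (- (t / 2)))" if e: "e \<in> {1, -1}" and w: "w \<in> half e" "Im w = t / 2 - y" for e w
    proof -
      have "norm (h e w) \<le> exp (- (t / 2 - y)) * (1600 * norm c)"
        unfolding h_def norm_mult q_def
        using sol_props(4)[OF e _ dec w(1), of 1] w(2) by (intro mult_mono) (auto simp: norm_exp_eq_Re)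
      then show ?thesis unfolding ex by (simp add: mult_ac)
    qed
    have "K + 2 * pi * c = h 1 d - h (-1) b - J"
      using eq by (simp add: K_def algebra_simps)
    also have "norm \<dots> \<le> norm (h 1 d) + norm (h (-1) b) + norm J"
      by (meson add_right_mono norm_triangle_ineq4 order_trans)
    also have "\<dots> \<le> norm c * exp y * (1600 * exp (- (t / 2))) + norm c * exp y * (1600 * exp (- (t / 2))) + norm c * exp y * (2 * t * exp (- (t / 2)))"
      by (intro add_mono h_le J_le bh dh) (auto simp: b_def d_def)
    also have "\<dots> = norm c * exp y * ((2 * t + 3200) * exp (- (t / 2)))" by (simp add: algebra_simps)
    finally show ?thesis .
  qed
  have half: "filterlim (\<lambda>t::real. t / 2) at_top at_top"
    using filterlim_tendsto_pos_mult_at_top[OF tendsto_const[of "1/2::real"] _ filterlim_ident] by simp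
  have "((\<lambda>t::real. 4 * ((t / 2) ^ 1 / exp (t / 2)) + 3200 * ((t / 2) ^ 0 / exp (t / 2))) \<longlongrightarrow> 4 * 0 + 3200 * 0) at_top"
    by (intro tendsto_intros filterlim_compose[OF tendsto_power_div_exp_0 half])
  then have "((\<lambda>t::real. norm c * exp y * (4 * ((t / 2) ^ 1 / exp (t / 2)) + 3200 * ((t / 2) ^ 0 / exp (t / 2)))) \<longlongrightarrow> 0) at_top"
    using tendsto_mult_right_zero by fastforce
  then have "((\<lambda>t::real. norm c * exp y * ((2 * t + 3200) * exp (- (t / 2)))) \<longlongrightarrow> 0) at_top"
    by (simp add: exp_minus field_simps)
  then have "norm (K + 2 * pi * c) \<le> 0"
    by (rule tendsto_lowerbound) (use le in \<open>auto intro: eventually_at_top_linorderI[of "2 * y + 2"]\<close>)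
  then have "K = - (2 * pi) * c" by (simp add: eq_neg_iff_add_eq_0)
  moreover have "exp (\<i> * a) = of_real (exp y)" by (simp add: a_def exp_of_real)
  ultimately show ?thesis by (simp add: K_def h_def q_def a_def right_diff_distrib)
qed

lemma splitting_single:
  fixes x :: "int \<Rightarrow> complex"
  assumes "l1 x"
  shows "splitting [x] = 4 * pi * x 1"
proof -
  have s: "src e [x] 1 = (\<lambda>z. (- 2 * x 1) / z\<^sup>2)" for e by (simp add: src_single fun_eq_iff)
  have "\<forall>\<^sub>F y in at_top. 4 * pi * x 1 = of_real (exp y) *
     (sol 1 1 (src 1 [x] 1) (down y) - sol (-1) 1 (src (-1) [x] 1) (down y))"
    using eventually_gt_at_top[of 1]
    by eventually_elim (simp only: s inverse_square_jump, simp)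
  then have "((\<lambda>y. of_real (exp y) * (sol 1 1 (src 1 [x] 1) (down y) - sol (-1) 1 (src (-1) [x] 1) (down y))) \<longlongrightarrow> 4 * pi * x 1) at_top"
    by (rule Lim_transform_eventually[OF tendsto_const])
  then show ?thesis
    using tendsto_unique[OF trivial_limit_at_top_linorder splitting_limit(1)[OF controlled_single[OF assms]]] by simp
qed

definition unit_seq :: "int \<Rightarrow> int \<Rightarrow> complex" where
  "unit_seq l = (\<lambda>k. if k = l then 1 else 0)"

lemma l1_unit_seq: "l1 (unit_seq l)"
proof -
  have "((\<lambda>k. norm (unit_seq l k)) summable_on UNIV) \<longleftrightarrow> ((\<lambda>k. norm (unit_seq l k)) summable_on {l})"
    by (rule summable_on_cong_neutral) (auto simp: unit_seq_def)
  then show ?thesis by (simp add: l1_def)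
qed

lemma sol_zero:
  assumes e: "e \<in> {1, -1}" and "k \<noteq> 0" "\<And>z. z \<in> half e \<Longrightarrow> f z = 0" "z \<in> half e"
  shows "sol e k f z = 0"
proof -
  have d: "decays e 0 (\<lambda>z. 0)" by (simp add: decays_def)
  show ?thesis using sol_linear[OF e assms(2) d d, of f 0 0 z] assms(3,4) by simp
qed

lemma resp_unit_seq:
  assumes e: "e \<in> {1, -1}" and z: "z \<in> half e" and l: "l \<noteq> 1"
  shows "resp e [unit_seq l] k z = (if k = l then - 2 / z\<^sup>2 - \<i> * of_int l * sol e l (\<lambda>z. - 2 / z\<^sup>2) z else 0)"
proof -
  have eq: "src e [unit_seq l] l = (\<lambda>z. - 2 / z\<^sup>2)" by (simp add: fun_eq_iff src_single unit_seq_def)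
  have 0: "sol e k (src e [unit_seq l] k) z = 0" if "k \<noteq> l" "k \<noteq> 0"
    by (rule sol_zero[OF e that(2) _ z]) (use that in \<open>simp add: src_single unit_seq_def\<close>)
  show ?thesis
  proof (cases "k = l")
    case True
    then show ?thesis using l by (simp add: resp_def eq)
  next
    case False
    have "src e [unit_seq l] k z = 0" using False by (simp add: src_single unit_seq_def)
    then show ?thesis using False 0 by (cases "k = 0") (auto simp: resp_def)
  qed
qed

lemma src_unit_seqs:
  assumes e: "e \<in> {1, -1}" and z: "z \<in> half e" and l: "l \<noteq> 1" and m: "m \<noteq> 1"
  shows "src e [unit_seq l, unit_seq m] 1 z = (if l + m = 1 then z\<^sup>2 / 8 *
    ((- 2 / z\<^sup>2 - \<i> * of_int l * sol e l (\<lambda>z. - 2 / z\<^sup>2) z) * (- 2 / z\<^sup>2 - \<i> * of_int m * sol e m (\<lambda>z. - 2 / z\<^sup>2) z)) else 0)"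
proof -
  have "(\<Sum>\<^sub>\<infinity>k. resp e [unit_seq l] k z * resp e [unit_seq m] (1 - k) z) =
      (\<Sum>\<^sub>\<infinity>k\<in>{l}. resp e [unit_seq l] k z * resp e [unit_seq m] (1 - k) z)"
    by (rule infsum_cong_neutral) (auto simp: resp_unit_seq[OF e z l])
  also have "\<dots> = resp e [unit_seq l] l z * resp e [unit_seq m] (1 - l) z" by simp
  finally have "src e [unit_seq l, unit_seq m] 1 z = z\<^sup>2 / 8 * (resp e [unit_seq l] l z * resp e [unit_seq m] (1 - l) z)"
    using src_step[of "[unit_seq l, unit_seq m]" e 1 z] by simp
  moreover have "1 - l = m \<longleftrightarrow> l + m = 1" by auto
  ultimately show ?thesis
    by (simp only: resp_unit_seq[OF e z l] resp_unit_seq[OF e z m] refl if_True) simp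
qed

text \<open>Here \<open>U\<close>, \<open>V\<close>, \<open>W\<close> are the solutions with source \<open>-2/z\<^sup>2\<close> at the frequencies \<open>L\<close>, \<open>M\<close>, \<open>1\<close>, and
  \<open>U'\<close>, \<open>V'\<close>, \<open>W'\<close> are their derivatives. The identity reads \<open>Q' = z\<^sup>2U'V'/8 - iQ\<close> for an
  explicit function \<open>Q\<close>, the solution for the source \<open>z\<^sup>2U'V'/8\<close>. It is found by undetermined
  coefficients. As \<open>L + M = 1\<close>, the operator \<open>\<partial>\<^sub>z + i\<close> maps \<open>z\<^sup>3UV\<close> to \<open>3z\<^sup>2UV - 2z(U + V)\<close>, so that a
  multiple of \<open>z\<^sup>3UV\<close> accounts for the part \<open>-LMz\<^sup>2UV\<close> of \<open>z\<^sup>2U'V'\<close>. The terms linear in \<open>U\<close> and \<open>V\<close>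
  that are left are removed in the same way by \<open>zU\<close>, \<open>zV\<close>, \<open>U\<close>, \<open>V\<close> and \<open>1/z\<close>. A multiple of \<open>1/z\<^sup>2\<close> remains, which
  is accounted for by \<open>W\<close>.\<close>

lemma second_order_identity:
  fixes z U V W L M I :: complex
  assumes "z \<noteq> 0" "L \<noteq> 0" "M \<noteq> 0" "L + M = 1" "I * I = -1"
  defines "U' \<equiv> - 2 / z\<^sup>2 - I * L * U" and "V' \<equiv> - 2 / z\<^sup>2 - I * M * V" and "W' \<equiv> - 2 / z\<^sup>2 - I * W"
  shows "1 / 8 * (- (L * M / 3) * (3 * z\<^sup>2 * (U * V) + z ^ 3 * (U' * V + U * V')) + 2 * I * L / 3 * (U + z * U')
     + 2 * I * M / 3 * (V + z * V') + 4 * L / (3 * M) * U' + 4 * M / (3 * L) * V' - 4 / 3 / z\<^sup>2) - 1 / (6 * L * M) * W'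
   = z\<^sup>2 / 8 * (U' * V') - I * (1 / 8 * (- (L * M / 3) * (z ^ 3 * (U * V)) + 2 * I * L / 3 * (z * U)
     + 2 * I * M / 3 * (z * V) + 4 * L / (3 * M) * U + 4 * M / (3 * L) * V + 4 / 3 / z) - 1 / (6 * L * M) * W)"
proof -
  define y where "y = 1 / z"
  define p where "p = 1 / L"
  define q where "q = 1 / M"
  have r: "z * y = 1" "L * p = 1" "M * q = 1" using assms by (simp_all add: y_def p_def q_def)
  have d: "a / z\<^sup>2 = a * y\<^sup>2" "a / z = a * y" for a by (simp_all add: y_def power_divide)
  have U': "U' = - 2 * y\<^sup>2 - I * L * U" and V': "V' = - 2 * y\<^sup>2 - I * M * V" and W': "W' = - 2 * y\<^sup>2 - I * W"
    by (simp_all add: U'_def V'_def W'_def d)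
  have h1: "3 * z\<^sup>2 * (U * V) + z ^ 3 * (U' * V + U * V') = 3 * z\<^sup>2 * (U * V) - 2 * z * (U + V) - I * z ^ 3 * (U * V)"
    unfolding U' V' using r(1) assms(4) by algebra
  have h2: "U + z * U' = U - 2 * y + I * M * z * U - I * z * U" unfolding U' using r(1) assms(4) by algebra
  have h3: "V + z * V' = V - 2 * y + I * L * z * V - I * z * V" unfolding V' using r(1) assms(4) by algebra
  have h4: "U' = - 2 * y\<^sup>2 + I * M * U - I * U" unfolding U' using assms(4) by algebra
  have h5: "V' = - 2 * y\<^sup>2 + I * L * V - I * V" unfolding V' using assms(4) by algebra
  have h7: "z\<^sup>2 * (U' * V') = 4 * y\<^sup>2 + 2 * I * (L * U + M * V) - L * M * z\<^sup>2 * (U * V)"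
    unfolding U' V' using r(1) assms(5) by algebra
  have pq: "L * q + M * p = p * q - 2" using r assms(4) by algebra
  have q: "L / M = L * q" "M / L = M * p" "1 / (L * M) = p * q" by (simp_all add: p_def q_def)
  have fr: "4 * L / (3 * M) = 4 / 3 * (L * q)" "4 * M / (3 * L) = 4 / 3 * (M * p)" "1 / (6 * L * M) = 1 / 6 * (p * q)"
    by (simp_all add: p_def q_def)
  have "24 * (1 / 8 * (- (L * M / 3) * (3 * z\<^sup>2 * (U * V) + z ^ 3 * (U' * V + U * V')) + 2 * I * L / 3 * (U + z * U')
     + 2 * I * M / 3 * (V + z * V') + 4 * L / (3 * M) * U' + 4 * M / (3 * L) * V' - 4 / 3 / z\<^sup>2) - 1 / (6 * L * M) * W')
    = - L * M * (3 * z\<^sup>2 * (U * V) - 2 * z * (U + V) - I * z ^ 3 * (U * V)) + 2 * I * L * (U - 2 * y + I * M * z * U - I * z * U)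
     + 2 * I * M * (V - 2 * y + I * L * z * V - I * z * V) + 4 * (L * q) * (- 2 * y\<^sup>2 + I * M * U - I * U)
     + 4 * (M * p) * (- 2 * y\<^sup>2 + I * L * V - I * V) - 4 * y\<^sup>2 - 4 * (p * q) * (- 2 * y\<^sup>2 - I * W)"
    unfolding h1 h2 h3 fr d W' h4[symmetric] h5[symmetric] by (simp add: field_simps)
  also have "\<dots> = (3 * (4 * y\<^sup>2 + 2 * I * (L * U + M * V) - L * M * z\<^sup>2 * (U * V)) - I * (- L * M * (z ^ 3 * (U * V)) + 2 * I * L * (z * U)
     + 2 * I * M * (z * V) + 4 * (L * q) * U + 4 * (M * p) * V + 4 * y - 4 * (p * q) * W))
     + (2 * L * M * (1 + I * I) * z * (U + V) + 4 * I * L * U * (M * q - 1) + 4 * I * M * V * (L * p - 1)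
       - 4 * I * y * (L + M - 1) - 8 * y\<^sup>2 * (L * q + M * p - p * q + 2))"
    by (simp add: algebra_simps)
  also have "(2 * L * M * (1 + I * I) * z * (U + V) + 4 * I * L * U * (M * q - 1) + 4 * I * M * V * (L * p - 1)
       - 4 * I * y * (L + M - 1) - 8 * y\<^sup>2 * (L * q + M * p - p * q + 2)) = 0"
    using assms(4,5) r pq by simp
  also have "(3 * (4 * y\<^sup>2 + 2 * I * (L * U + M * V) - L * M * z\<^sup>2 * (U * V)) - I * (- L * M * (z ^ 3 * (U * V)) + 2 * I * L * (z * U)
     + 2 * I * M * (z * V) + 4 * (L * q) * U + 4 * (M * p) * V + 4 * y - 4 * (p * q) * W)) + 0
    = 3 * (4 * y\<^sup>2 + 2 * I * (L * U + M * V) - L * M * z\<^sup>2 * (U * V)) - I * (- L * M * (z ^ 3 * (U * V)) + 2 * I * L * (z * U)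
     + 2 * I * M * (z * V) + 4 * (L * q) * U + 4 * (M * p) * V + 4 * y - 4 * (p * q) * W)" by simp
  also have "\<dots> = 24 * (z\<^sup>2 / 8 * (U' * V') - I * (1 / 8 * (- (L * M / 3) * (z ^ 3 * (U * V)) + 2 * I * L / 3 * (z * U)
     + 2 * I * M / 3 * (z * V) + 4 * L / (3 * M) * U + 4 * M / (3 * L) * V + 4 / 3 / z) - 1 / (6 * L * M) * W))"
    unfolding h7[symmetric] fr d by (simp add: field_simps)
  finally show ?thesis by (simp only: mult_cancel_left) simp
qed

lemma inverse_square_sol_bounds:
  assumes e: "e \<in> {1, -1}" and l: "l \<noteq> 0" and z: "z \<in> half e"
  shows "norm (sol e l (\<lambda>z. - 2 / z\<^sup>2) z) \<le> 800 / norm z ^ 2" "norm (sol e l (\<lambda>z. - 2 / z\<^sup>2) z) \<le> 3200"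
proof -
  have d: "decays e 2 (\<lambda>z. - 2 / z\<^sup>2)" using decays_inverse_square[of e "- 2"] by simp
  have "1 \<le> \<bar>real_of_int l\<bar>" using l by linarith
  then have "norm (sol e l (\<lambda>z. - 2 / z\<^sup>2) z) \<le> norm (of_int l * sol e l (\<lambda>z. - 2 / z\<^sup>2) z)"
    by (simp add: norm_mult mult_le_cancel_right1)
  then show "norm (sol e l (\<lambda>z. - 2 / z\<^sup>2) z) \<le> 800 / norm z ^ 2"
    using sol_props(3)[OF e l d z] by simp
  show "norm (sol e l (\<lambda>z. - 2 / z\<^sup>2) z) \<le> 3200" using sol_props(4)[OF e l d z] by simp
qed

lemma inverse_square_sol_difference_limit:
  assumes l: "l \<noteq> 0" "l \<noteq> 1"
  shows "((\<lambda>y. of_real (exp y) * (of_real y ^ j * (sol 1 l (\<lambda>z. - 2 / z\<^sup>2) (down y) - sol (-1) l (\<lambda>z. - 2 / z\<^sup>2) (down y)))) \<longlongrightarrow> 0) at_top"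
proof (rule Lim_null_comparison)
  let ?\<delta> = "\<lambda>y. sol 1 l (\<lambda>z. - 2 / z\<^sup>2) (down y) - sol (-1) l (\<lambda>z. - 2 / z\<^sup>2) (down y)"
  have d: "decays e 2 (\<lambda>z. - 2 / z\<^sup>2)" for e using decays_inverse_square[of e "- 2"] by simp
  have l1: "1 \<le> \<bar>real_of_int l\<bar>" using l by linarith
  show "\<forall>\<^sub>F y in at_top. norm (of_real (exp y) * (of_real y ^ j * ?\<delta> y)) \<le> 32400 * 2 ^ j * ((y / 2) ^ j / exp (y / 2))"
    using eventually_ge_at_top[of 2]
  proof eventually_elim
    case (elim y)
    have "norm (?\<delta> y) \<le> norm (of_int l * ?\<delta> y)" using l1 by (simp add: norm_mult mult_le_cancel_right1)
    also have "\<dots> \<le> (4 * 0 + 16200 * 2) * exp (- (3 / 2 * y))"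
      by (rule sol_close[OF l d d _ elim]) (simp add: close_def)
    finally have "norm (?\<delta> y) \<le> 32400 * exp (- (3 / 2 * y))" by simp
    then have "exp y * (y ^ j * norm (?\<delta> y)) \<le> exp y * (y ^ j * (32400 * exp (- (3 / 2 * y))))"
      using elim by (intro mult_left_mono) auto
    also have "\<dots> = 32400 * y ^ j * (exp y * exp (- (3 / 2 * y)))" by simp
    also have "exp y * exp (- (3 / 2 * y)) = exp (- (y / 2))" by (simp add: exp_add[symmetric])
    finally have "exp y * (y ^ j * norm (?\<delta> y)) \<le> 32400 * 2 ^ j * ((y / 2) ^ j / exp (y / 2))"
      by (simp add: power_divide exp_minus field_simps)
    then show ?case using elim by (simp add: norm_mult norm_power)
  qed
  have half: "filterlim (\<lambda>t::real. t / 2) at_top at_top"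
    using filterlim_tendsto_pos_mult_at_top[OF tendsto_const[of "1/2::real"] _ filterlim_ident] by simp
  show "((\<lambda>y::real. 32400 * 2 ^ j * ((y / 2) ^ j / exp (y / 2))) \<longlongrightarrow> 0) at_top"
    by (intro tendsto_mult_right_zero filterlim_compose[OF tendsto_power_div_exp_0 half])
qed

text \<open>The solution is the function \<open>Q\<close> of \<open>second_order_identity\<close>. The branches of \<open>U\<close> and \<open>V\<close> are exponentially
  closer than \<open>e\<^bsup>-y\<^esup>\<close>, even when multiplied by powers of \<open>z\<close>, and \<open>1/z\<close> has only one branch, so that only the multiple
  of \<open>W\<close> in \<open>Q\<close> contributes, with the residue of \<open>inverse_square_jump\<close>.\<close>

lemma splitting_unit_seqs:
  assumes l: "l \<noteq> 0" "l \<noteq> 1" and m: "m \<noteq> 0" "m \<noteq> 1"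
  shows "splitting [unit_seq l, unit_seq m] = (if l + m = 1 then - (2 * pi / 3) / (of_int l * of_int m) else 0)"
proof -
  let ?src = "\<lambda>e. src e [unit_seq l, unit_seq m] 1"
  obtain b S where S: "controlled b S [unit_seq l, unit_seq m]"
    by (rule src_controlledE[of "[unit_seq l, unit_seq m]"]) (use l1_unit_seq in auto)
  let ?D = "\<lambda>y. of_real (exp y) * (sol 1 1 (?src 1) (down y) - sol (-1) 1 (?src (-1)) (down y))"
  have lim: "(?D \<longlongrightarrow> splitting [unit_seq l, unit_seq m]) at_top" by (rule splitting_limit(1)[OF S])
  show ?thesis
  proof (cases "l + m = 1")
    case False
    have z0: "sol e 1 (?src e) (down y) = 0" if "y > 1" "e \<in> {1, -1}" for e y
      by (rule sol_zero[OF that(2) _ _ minus_imaginary_in_half[OF that(1)]])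
        (use src_unit_seqs[OF that(2) _ l(2) m(2)] False in auto)
    have "\<forall>\<^sub>F y in at_top. 0 = ?D y"
      using eventually_gt_at_top[of 1]
    proof eventually_elim
      case (elim y)
      show ?case using z0[OF elim, of 1] z0[OF elim, of "-1"] by simp
    qed
    then have "(?D \<longlongrightarrow> 0) at_top" by (rule Lim_transform_eventually[OF tendsto_const])
    then show ?thesis using False tendsto_unique[OF trivial_limit_at_top_linorder lim] by simp
  next
    case True
    define L M where "L = complex_of_int l" and "M = complex_of_int m"
    have L: "L \<noteq> 0" "M \<noteq> 0" "L + M = 1"
      using l m True by (auto simp: L_def M_def simp flip: of_int_add)
    define U where "U e = sol e l (\<lambda>z. - 2 / z\<^sup>2)" for e
    define V where "V e = sol e m (\<lambda>z. - 2 / z\<^sup>2)" for e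
    define W where "W e = sol e 1 (\<lambda>z. - 2 / z\<^sup>2)" for e
    define Q where "Q e z = 1 / 8 * (- (L * M / 3) * (z ^ 3 * (U e z * V e z)) + 2 * \<i> * L / 3 * (z * U e z)
     + 2 * \<i> * M / 3 * (z * V e z) + 4 * L / (3 * M) * U e z + 4 * M / (3 * L) * V e z + 4 / 3 / z) - 1 / (6 * L * M) * W e z" for e z
    have d: "decays e 2 (\<lambda>z. - 2 / z\<^sup>2)" for e using decays_inverse_square[of e "- 2"] by simp
    have Q: "Q e z = sol e 1 (?src e) z" if e: "e \<in> {1, -1}" and z: "z \<in> half e" for e z
    proof (rule sol_unique[OF e _ controlled_decays[OF S e] subset_refl ray_in_half[OF e] _ _ z])
      fix z assume z: "z \<in> half e"
      have z0: "z \<noteq> 0" by (rule half_nonzero[OF z])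
      let ?U' = "- 2 / z\<^sup>2 - \<i> * L * U e z" and ?V' = "- 2 / z\<^sup>2 - \<i> * M * V e z" and ?W' = "- 2 / z\<^sup>2 - \<i> * W e z"
      have der: "(U e has_field_derivative ?U') (at z)" "(V e has_field_derivative ?V') (at z)" "(W e has_field_derivative ?W') (at z)"
        using sol_props(2)[OF e l(1) d z] sol_props(2)[OF e m(1) d z] sol_props(2)[OF e _ d z, of 1]
        by (auto simp: U_def V_def W_def L_def M_def)
      have "(Q e has_field_derivative (1 / 8 * (- (L * M / 3) * (3 * z\<^sup>2 * (U e z * V e z) + z ^ 3 * (?U' * V e z + U e z * ?V')) + 2 * \<i> * L / 3 * (U e z + z * ?U')
     + 2 * \<i> * M / 3 * (V e z + z * ?V') + 4 * L / (3 * M) * ?U' + 4 * M / (3 * L) * ?V' - 4 / 3 / z\<^sup>2) - 1 / (6 * L * M) * ?W')) (at z)"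
        unfolding Q_def[abs_def]
        by (rule derivative_eq_intros der refl z0)+ (simp add: power2_eq_square algebra_simps)
      also have "(1 / 8 * (- (L * M / 3) * (3 * z\<^sup>2 * (U e z * V e z) + z ^ 3 * (?U' * V e z + U e z * ?V')) + 2 * \<i> * L / 3 * (U e z + z * ?U')
     + 2 * \<i> * M / 3 * (V e z + z * ?V') + 4 * L / (3 * M) * ?U' + 4 * M / (3 * L) * ?V' - 4 / 3 / z\<^sup>2) - 1 / (6 * L * M) * ?W')
        = z\<^sup>2 / 8 * (?U' * ?V') - \<i> * Q e z"
        unfolding Q_def by (rule second_order_identity[OF z0 L]) simp
      also have "z\<^sup>2 / 8 * (?U' * ?V') = ?src e z"
        using src_unit_seqs[OF e z l(2) m(2)] True by (simp add: U_def V_def L_def M_def)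
      finally show "(Q e has_field_derivative ?src e z - \<i> * of_int 1 * Q e z) (at z)" by simp
      have nz: "norm z > 1 / 2" by (rule half_norm_ge[OF e z])
      have U: "norm (U e z) \<le> 800 / norm z ^ 2" "norm (U e z) \<le> 3200" and V: "norm (V e z) \<le> 800 / norm z ^ 2" "norm (V e z) \<le> 3200" and W: "norm (W e z) \<le> 3200"
        using inverse_square_sol_bounds[OF e _ z] l m by (auto simp: U_def V_def W_def)
      have b1: "norm (z ^ 3 * (U e z * V e z)) \<le> 1280000"
      proof -
        have "norm (z ^ 3 * (U e z * V e z)) \<le> norm z ^ 3 * ((800 / norm z ^ 2) * (800 / norm z ^ 2))"
          unfolding norm_mult norm_power using U V by (intro mult_left_mono mult_mono) auto
        also have "\<dots> = 640000 / norm z" using z0 by (simp add: power2_eq_square power3_eq_cube)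
        also have "\<dots> \<le> 1280000" using nz by (simp add: divide_le_eq)
        finally show ?thesis .
      qed
      have b2: "norm (z * u) \<le> 1600" if "norm u \<le> 800 / norm z ^ 2" for u
      proof -
        have "norm (z * u) \<le> norm z * (800 / norm z ^ 2)" unfolding norm_mult using that by (intro mult_left_mono) auto
        also have "\<dots> = 800 / norm z" using z0 by (simp add: power2_eq_square)
        also have "\<dots> \<le> 1600" using nz by (simp add: divide_le_eq)
        finally show ?thesis .
      qed
      have b3: "norm (4 / 3 / z) \<le> 3" using nz by (simp add: norm_divide divide_le_eq)
      have tri: "norm (x1 * (c1 * t1 + c2 * t2 + c3 * t3 + c4 * t4 + c5 * t5 + t6) - c7 * t7)
          \<le> norm x1 * (norm c1 * B1 + norm c2 * B2 + norm c3 * B3 + norm c4 * B4 + norm c5 * B5 + B6) + norm c7 * B7"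
        if "norm t1 \<le> B1" "norm t2 \<le> B2" "norm t3 \<le> B3" "norm t4 \<le> B4" "norm t5 \<le> B5" "norm t6 \<le> B6" "norm t7 \<le> B7"
        for x1 c1 c2 c3 c4 c5 c7 t1 t2 t3 t4 t5 t6 t7 :: complex and B1 B2 B3 B4 B5 B6 B7
      proof -
        have "norm (c1 * t1 + c2 * t2 + c3 * t3 + c4 * t4 + c5 * t5 + t6) \<le> norm c1 * B1 + norm c2 * B2 + norm c3 * B3 + norm c4 * B4 + norm c5 * B5 + B6"
          using that by (intro norm_triangle_le add_mono) (auto simp: norm_mult intro!: mult_left_mono)
        then show ?thesis
          using that(7) by (intro order_trans[OF norm_triangle_ineq4] add_mono) (auto simp: norm_mult intro!: mult_left_mono)
      qed
      show "norm (Q e z) \<le> norm (1 / 8 :: complex) * (norm (- (L * M / 3)) * 1280000 + norm (2 * \<i> * L / 3) * 1600 + norm (2 * \<i> * M / 3) * 1600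
         + norm (4 * L / (3 * M)) * 3200 + norm (4 * M / (3 * L)) * 3200 + 3) + norm (1 / (6 * L * M)) * 3200"
        unfolding Q_def by (rule tri[OF b1 b2[OF U(1)] b2[OF V(1)] U(2) V(2) b3 W])
    qed auto
    let ?w = "\<lambda>y. down y"
    let ?u = "\<lambda>j y. of_real (exp y) * (of_real y ^ j * (U 1 (?w y) - U (-1) (?w y)))"
    let ?v = "\<lambda>j y. of_real (exp y) * (of_real y ^ j * (V 1 (?w y) - V (-1) (?w y)))"
    have u0: "(?u j \<longlongrightarrow> 0) at_top" and v0: "(?v j \<longlongrightarrow> 0) at_top" for j
      unfolding U_def V_def by (rule inverse_square_sol_difference_limit[OF l] inverse_square_sol_difference_limit[OF m])+
    have bdd: "((\<lambda>y. f y * g y) \<longlongrightarrow> 0) at_top" if "(f \<longlongrightarrow> 0) at_top" "\<And>y. y > 1 \<Longrightarrow> norm (g y) \<le> 3200" for f g :: "real \<Rightarrow> complex"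
    proof (rule Lim_null_comparison)
      show "\<forall>\<^sub>F y in at_top. norm (f y * g y) \<le> norm (f y) * 3200"
        using eventually_gt_at_top[of 1] by eventually_elim (use that(2) in \<open>auto simp: norm_mult intro!: mult_left_mono\<close>)
      show "((\<lambda>y. norm (f y) * 3200) \<longlongrightarrow> 0) at_top"
        using that(1) by (intro tendsto_mult_left_zero) (simp add: tendsto_norm_zero)
    qed
    have uv: "((\<lambda>y. ?u 3 y * V 1 (?w y)) \<longlongrightarrow> 0) at_top" "((\<lambda>y. ?v 3 y * U (-1) (?w y)) \<longlongrightarrow> 0) at_top"
      using inverse_square_sol_bounds(2)[OF _ _ minus_imaginary_in_half] l m unfolding U_def V_def
      by (intro bdd u0[unfolded U_def] v0[unfolded V_def]; simp)+
    have "((\<lambda>y. - (L * M / 3 / 8) * (\<i> * (?u 3 y * V 1 (?w y)) + \<i> * (?v 3 y * U (-1) (?w y))) + 2 * \<i> * L / 3 / 8 * (- \<i> * ?u 1 y) + 2 * \<i> * M / 3 / 8 * (- \<i> * ?v 1 y)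
        + 4 * L / (3 * M) / 8 * ?u 0 y + 4 * M / (3 * L) / 8 * ?v 0 y - 1 / (6 * L * M) * (4 * pi)) \<longlongrightarrow>
        - (L * M / 3 / 8) * (\<i> * 0 + \<i> * 0) + 2 * \<i> * L / 3 / 8 * (- \<i> * 0) + 2 * \<i> * M / 3 / 8 * (- \<i> * 0) + 4 * L / (3 * M) / 8 * 0 + 4 * M / (3 * L) / 8 * 0 - 1 / (6 * L * M) * (4 * pi)) at_top"
      by (intro tendsto_intros uv u0 v0)
    moreover have "\<forall>\<^sub>F y in at_top. - (L * M / 3 / 8) * (\<i> * (?u 3 y * V 1 (?w y)) + \<i> * (?v 3 y * U (-1) (?w y))) + 2 * \<i> * L / 3 / 8 * (- \<i> * ?u 1 y) + 2 * \<i> * M / 3 / 8 * (- \<i> * ?v 1 y)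
        + 4 * L / (3 * M) / 8 * ?u 0 y + 4 * M / (3 * L) / 8 * ?v 0 y - 1 / (6 * L * M) * (4 * pi) = ?D y"
      using eventually_gt_at_top[of 1]
    proof eventually_elim
      case (elim y)
      have w: "?w y \<in> half e" for e by (rule minus_imaginary_in_half[OF elim])
      have W: "of_real (exp y) * (W 1 (?w y) - W (-1) (?w y)) = 4 * pi"
        using inverse_square_jump[OF elim, of "- 2"] by (simp add: W_def)
      have w3: "?w y ^ 3 = \<i> * of_real y ^ 3"
      proof -
        have "\<i> ^ 3 = - \<i>" by (simp add: power3_eq_cube)
        then show ?thesis by (simp add: power_mult_distrib)
      qed
      have gen: "E * ((1 / 8 * (- p1 * (\<i> * y3 * (U1 * V1)) + p2 * (x * U1) + p3 * (x * V1) + p4 * U1 + p5 * V1 + r) - c * W1)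
          - (1 / 8 * (- p1 * (\<i> * y3 * (U2 * V2)) + p2 * (x * U2) + p3 * (x * V2) + p4 * U2 + p5 * V2 + r) - c * W2))
        = - (p1 / 8) * (\<i> * (E * (y3 * (U1 - U2)) * V1) + \<i> * (E * (y3 * (V1 - V2)) * U2)) + p2 / 8 * (E * (x * (U1 - U2))) + p3 / 8 * (E * (x * (V1 - V2)))
          + p4 / 8 * (E * (U1 - U2)) + p5 / 8 * (E * (V1 - V2)) - c * (E * (W1 - W2))"
        for E y3 x r c U1 U2 V1 V2 W1 W2 p1 p2 p3 p4 p5 :: complex
        by (simp add: algebra_simps add_divide_distrib diff_divide_distrib)
      have "?D y = of_real (exp y) * (Q 1 (?w y) - Q (-1) (?w y))"
        using Q[OF _ w] by simp
      also have "\<dots> = - (L * M / 3 / 8) * (\<i> * (?u 3 y * V 1 (?w y)) + \<i> * (?v 3 y * U (-1) (?w y))) + 2 * \<i> * L / 3 / 8 * (- \<i> * ?u 1 y) + 2 * \<i> * M / 3 / 8 * (- \<i> * ?v 1 y)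
        + 4 * L / (3 * M) / 8 * ?u 0 y + 4 * M / (3 * L) / 8 * ?v 0 y - 1 / (6 * L * M) * (4 * pi)"
        unfolding Q_def w3 gen W by (simp add: mult.left_commute[of "complex_of_real (exp y)" \<i>] mult.assoc)
      finally show ?case by simp
    qed
    ultimately have "(?D \<longlongrightarrow> - (L * M / 3 / 8) * (\<i> * 0 + \<i> * 0) + 2 * \<i> * L / 3 / 8 * (- \<i> * 0) + 2 * \<i> * M / 3 / 8 * (- \<i> * 0) + 4 * L / (3 * M) / 8 * 0 + 4 * M / (3 * L) / 8 * 0 - 1 / (6 * L * M) * (4 * pi)) at_top"
      by (rule Lim_transform_eventually)
    then have "splitting [unit_seq l, unit_seq m] = - 1 / (6 * L * M) * (4 * pi)"
      using tendsto_unique[OF trivial_limit_at_top_linorder lim] by simp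
    then show ?thesis using True L by (simp add: L_def M_def field_simps)
  qed
qed

text \<open>The finite truncations of \<open>x\<close> converge to \<open>x\<close> in the norm of \<open>\<ell>\<^sup>1\<close>.\<close>

lemma bounded_functional_expansion:
  assumes lin: "\<And>u v \<alpha> \<beta>. l1 u \<Longrightarrow> l1 v \<Longrightarrow> B (\<lambda>k. \<alpha> * u k + \<beta> * v k) = \<alpha> * B u + \<beta> * B v"
    and bd: "\<And>u. l1 u \<Longrightarrow> norm (B u) \<le> C * l1_norm u" and x: "l1 x"
  shows "((\<lambda>l. x l * B (unit_seq l)) has_sum (B x :: complex)) UNIV"
proof -
  define h where "h F = (\<lambda>k. if k \<in> F then x k else 0)" for F
  have lh: "l1 (h F)" for F
    using x unfolding l1_def by (rule summable_on_comparison_test) (auto simp: h_def)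
  have z: "l1 (\<lambda>k. 0)" by (simp add: l1_def)
  have B0: "B (\<lambda>k. 0) = 0" using lin[OF z z, of 0 0] by simp
  have fin: "B (h F) = (\<Sum>l\<in>F. x l * B (unit_seq l))" if "finite F" for F
    using that
  proof (induction F rule: finite_induct)
    case empty
    then show ?case using B0 by (simp add: h_def)
  next
    case (insert a F)
    have "h (insert a F) = (\<lambda>k. x a * unit_seq a k + 1 * h F k)"
      using insert by (auto simp: h_def unit_seq_def)
    then show ?case using insert lin[OF l1_unit_seq lh, of "x a" a 1 F] by simp
  qed
  have dif: "norm (B (h F) - B x) \<le> C * (l1_norm x - (\<Sum>l\<in>F. norm (x l)))" if F: "finite F" for F
  proof -
    have "B (h (- F)) = B (\<lambda>k. 1 * x k + (-1) * h F k)"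
      by (rule arg_cong[where f = B]) (auto simp: h_def)
    also have "\<dots> = B x - B (h F)" using lin[OF x lh, of 1 "-1"] by simp
    finally have "norm (B (h F) - B x) = norm (B (h (- F)))" by (simp add: norm_minus_commute)
    also have "\<dots> \<le> C * l1_norm (h (- F))" by (rule bd[OF lh])
    also have "l1_norm (h (- F)) = l1_norm x - (\<Sum>l\<in>F. norm (x l))"
    proof -
      have "(\<lambda>k. norm (x k)) summable_on - F"
        using x unfolding l1_def by (rule summable_on_subset_banach) auto
      then have "infsum (\<lambda>k. norm (x k)) (F \<union> - F) = infsum (\<lambda>k. norm (x k)) F + infsum (\<lambda>k. norm (x k)) (- F)"
        using F by (intro infsum_Un_disjoint) auto
      moreover have "l1_norm (h (- F)) = infsum (\<lambda>k. norm (x k)) (- F)"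
        unfolding l1_norm_def by (rule infsum_cong_neutral) (auto simp: h_def)
      ultimately show ?thesis using F by (simp add: l1_norm_def Compl_partition)
    qed
    finally show ?thesis .
  qed
  have "((\<lambda>F. \<Sum>l\<in>F. norm (x l)) \<longlongrightarrow> l1_norm x) (finite_subsets_at_top UNIV)"
    using has_sum_infsum[OF x[unfolded l1_def]] unfolding has_sum_def l1_norm_def .
  then have "((\<lambda>F. C * (l1_norm x - (\<Sum>l\<in>F. norm (x l)))) \<longlongrightarrow> C * (l1_norm x - l1_norm x)) (finite_subsets_at_top UNIV)"
    by (intro tendsto_intros)
  then have lim: "((\<lambda>F. C * (l1_norm x - (\<Sum>l\<in>F. norm (x l)))) \<longlongrightarrow> 0) (finite_subsets_at_top UNIV)"
    by simp
  have "((\<lambda>F. (\<Sum>l\<in>F. x l * B (unit_seq l)) - B x) \<longlongrightarrow> 0) (finite_subsets_at_top UNIV)"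
  proof (rule Lim_null_comparison[OF _ lim], rule eventually_finite_subsets_at_top_weakI)
    fix F :: "int set" assume F: "finite F"
    show "norm ((\<Sum>l\<in>F. x l * B (unit_seq l)) - B x) \<le> C * (l1_norm x - (\<Sum>l\<in>F. norm (x l)))"
      using dif[OF F] unfolding fin[OF F] .
  qed
  then show ?thesis unfolding has_sum_def by (simp add: LIM_zero_iff)
qed

text \<open>Both arguments are expanded in unit sequences. Since \<open>x\<close> vanishes at \<open>0\<close> and \<open>1\<close>, only the pairs
  with \<open>m = 1 - l\<close> contribute.\<close>

lemma splitting_pair:
  fixes x :: "int \<Rightarrow> complex"
  assumes x: "l1 x" and "x 0 = 0" "x 1 = 0"
  shows "((\<lambda>l. - (2 * pi / 3) * (x l * x (1 - l) / (of_int l * (1 - of_int l)))) has_sum splitting [x, x]) UNIV"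
proof -
  obtain C where C: "\<And>xs. \<lbrakk>length xs = 2; \<And>x. x \<in> set xs \<Longrightarrow> l1 x\<rbrakk> \<Longrightarrow> norm (splitting xs) \<le> C * (\<Prod>x\<leftarrow>xs. l1_norm x)"
    using splitting_bounded[of 2] by (metis one_le_numeral)
  have 1: "((\<lambda>l. x l * splitting [unit_seq l, x]) has_sum splitting [x, x]) UNIV"
  proof (rule bounded_functional_expansion[where B = "\<lambda>u. splitting [u, x]" and C = "C * l1_norm x", OF _ _ x])
    show "splitting [\<lambda>k. \<alpha> * u k + \<beta> * v k, x] = \<alpha> * splitting [u, x] + \<beta> * splitting [v, x]" if "l1 u" "l1 v" for u v \<alpha> \<beta>
      using splitting_linear[of "[u, x]" 0 u v \<alpha> \<beta>] that x by auto
    show "norm (splitting [u, x]) \<le> (C * l1_norm x) * l1_norm u" if "l1 u" for u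
      using C[of "[u, x]"] that x by (auto simp: mult_ac)
  qed
  have 2: "((\<lambda>m. x m * splitting [unit_seq l, unit_seq m]) has_sum splitting [unit_seq l, x]) UNIV" for l
  proof (rule bounded_functional_expansion[where B = "\<lambda>u. splitting [unit_seq l, u]" and C = "C * l1_norm (unit_seq l)", OF _ _ x])
    show "splitting [unit_seq l, \<lambda>k. \<alpha> * u k + \<beta> * v k] = \<alpha> * splitting [unit_seq l, u] + \<beta> * splitting [unit_seq l, v]" if "l1 u" "l1 v" for u v \<alpha> \<beta>
      using splitting_linear[of "[unit_seq l, u]" 1 u v \<alpha> \<beta>] that l1_unit_seq[of l] by auto
    show "norm (splitting [unit_seq l, u]) \<le> (C * l1_norm (unit_seq l)) * l1_norm u" if "l1 u" for u
      using C[of "[unit_seq l, u]"] that l1_unit_seq[of l] by (auto simp: mult_ac)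
  qed
  have "x l * splitting [unit_seq l, x] = - (2 * pi / 3) * (x l * x (1 - l) / (of_int l * (1 - of_int l)))" for l
  proof (cases "l = 0 \<or> l = 1")
    case True
    then show ?thesis using assms by auto
  next
    case False
    have "((\<lambda>m. x m * splitting [unit_seq l, unit_seq m]) has_sum x (1 - l) * splitting [unit_seq l, unit_seq (1 - l)]) {1 - l}"
      by (simp add: has_sum_finite_iff)
    then have "((\<lambda>m. x m * splitting [unit_seq l, unit_seq m]) has_sum x (1 - l) * splitting [unit_seq l, unit_seq (1 - l)]) UNIV"
    proof (rule has_sum_cong_neutral[THEN iffD1, rotated -1])
      fix m assume "m \<in> UNIV - {1 - l}"
      then show "x m * splitting [unit_seq l, unit_seq m] = 0"
        using False assms(2,3) splitting_unit_seqs[of l m] by (cases "m = 0 \<or> m = 1") auto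
    qed auto
    then have "splitting [unit_seq l, x] = x (1 - l) * splitting [unit_seq l, unit_seq (1 - l)]"
      using has_sum_unique[OF 2] by simp
    also have "splitting [unit_seq l, unit_seq (1 - l)] = - (2 * pi / 3) / (of_int l * (1 - of_int l))"
      using splitting_unit_seqs[of l "1 - l"] False by auto
    finally show ?thesis by simp
  qed
  then show ?thesis using 1 by simp
qed

section \<open>Functions that are holomorphic in each of three variables\<close>

lemma deriv_eq_fourier_coeff:
  assumes "h holomorphic_on ball u R" "0 < r" "r < R"
  shows "deriv h u = fourier_coeff (\<lambda>s. h (u + of_real r * exp (\<i> * of_real s))) 1 / of_real r"
  using taylor_coeff_eq_fourier_coeff[OF assms, of 1] by simp

text \<open>By Cauchy's formula the derivative is an integral over a circle, whose radius can be kept constant near a given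
  point.\<close>

lemma continuous_on_deriv_param:
  fixes f :: "'a::t2_space \<Rightarrow> complex \<Rightarrow> complex"
  assumes "open X" "open U" and cont: "continuous_on (X \<times> U) (\<lambda>(x, u). f x u)"
    and hol: "\<And>x. x \<in> X \<Longrightarrow> f x holomorphic_on U"
  shows "continuous_on (X \<times> U) (\<lambda>(x, u). deriv (f x) u)"
proof (rule continuous_at_imp_continuous_on, rule ballI)
  fix p assume "p \<in> X \<times> U"
  then obtain x0 u0 where p: "p = (x0, u0)" "x0 \<in> X" "u0 \<in> U" by auto
  obtain \<epsilon> where \<epsilon>: "\<epsilon> > 0" "ball u0 \<epsilon> \<subseteq> U" using \<open>open U\<close> p by (meson openE)
  define r where "r = \<epsilon> / 4"
  have r: "r > 0" using \<epsilon> by (simp add: r_def)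
  have sub: "ball u (2 * r) \<subseteq> U" if "u \<in> ball u0 r" for u
  proof
    fix v assume "v \<in> ball u (2 * r)"
    then have "dist u0 v < \<epsilon>" using that dist_triangle[of u0 v u] r by (simp add: r_def)
    then show "v \<in> U" using \<epsilon> by auto
  qed
  have in_U: "u + of_real r * exp (\<i> * of_real s) \<in> U" if "u \<in> ball u0 r" for u s
  proof -
    have "u + of_real r * exp (\<i> * of_real s) \<in> ball u (2 * r)" using r by (simp add: dist_norm norm_mult)
    then show ?thesis using sub[OF that] by blast
  qed
  have "continuous_on ((X \<times> ball u0 r) \<times> UNIV) (\<lambda>(p, s). f (fst p) (snd p + of_real r * exp (\<i> * of_real s)))"
  proof -
    have "continuous_on ((X \<times> ball u0 r) \<times> UNIV) (\<lambda>q. (\<lambda>(x, u). f x u) (fst (fst q), snd (fst q) + of_real r * exp (\<i> * of_real (snd q))))"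
      by (rule continuous_on_compose2[OF cont]) (use in_U in \<open>auto intro!: continuous_intros\<close>)
    then show ?thesis by (simp add: case_prod_unfold)
  qed
  then have "continuous_on (X \<times> ball u0 r) (\<lambda>p. fourier_coeff (\<lambda>s. f (fst p) (snd p + of_real r * exp (\<i> * of_real s))) 1 / of_real r)"
    using r by (intro continuous_on_divide continuous_on_fourier_coeff continuous_on_const) auto
  moreover have "fourier_coeff (\<lambda>s. f (fst p) (snd p + of_real r * exp (\<i> * of_real s))) 1 / of_real r = (\<lambda>(x, u). deriv (f x) u) p"
    if "p \<in> X \<times> ball u0 r" for p
    using that r deriv_eq_fourier_coeff[OF holomorphic_on_subset[OF hol sub], of "fst p" "snd p" r]
    by (auto simp: case_prod_unfold)
  ultimately have "continuous_on (X \<times> ball u0 r) (\<lambda>(x, u). deriv (f x) u)"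
    by (simp cong: continuous_on_cong)
  moreover have "open (X \<times> ball u0 r)" using \<open>open X\<close> by (intro open_Times) auto
  ultimately show "isCont (\<lambda>(x, u). deriv (f x) u) p"
    using p r by (auto simp: continuous_on_eq_continuous_at)
qed

lemma holomorphic_deriv_param:
  assumes "open X" "open U" and cont: "continuous_on (X \<times> U) (\<lambda>(x, u). f x u)"
    and hol: "\<And>x. x \<in> X \<Longrightarrow> f x holomorphic_on U"
    and hol': "\<And>u. u \<in> U \<Longrightarrow> (\<lambda>x. f x u) holomorphic_on X" and u: "u \<in> U"
  shows "(\<lambda>x. deriv (f x) u) holomorphic_on X"
proof -
  obtain \<epsilon> where \<epsilon>: "\<epsilon> > 0" "ball u \<epsilon> \<subseteq> U" using \<open>open U\<close> u by (meson openE)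
  define r where "r = \<epsilon> / 2"
  have r: "r > 0" "r < \<epsilon>" using \<epsilon> by (auto simp: r_def)
  let ?c = "\<lambda>s. u + of_real r * exp (\<i> * of_real s)"
  have in_U: "?c s \<in> U" for s
  proof -
    have "?c s \<in> ball u \<epsilon>" using r by (simp add: dist_norm norm_mult)
    then show ?thesis using \<epsilon> by blast
  qed
  have cont': "continuous_on (U \<times> X) (\<lambda>(u, x). deriv (\<lambda>x. f x u) x)"
  proof (rule continuous_on_deriv_param[OF \<open>open U\<close> \<open>open X\<close>])
    have "continuous_on (U \<times> X) (\<lambda>q. (\<lambda>(x, u). f x u) (snd q, fst q))"
      by (rule continuous_on_compose2[OF cont]) (auto intro!: continuous_intros)
    then show "continuous_on (U \<times> X) (\<lambda>(u, x). f x u)" by (simp add: case_prod_unfold)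
  qed (rule hol')
  have "((\<lambda>x. fourier_coeff (\<lambda>s. f x (?c s)) 1) has_field_derivative fourier_coeff (\<lambda>s. deriv (\<lambda>x. f x (?c s)) x) 1) (at x)" if x: "x \<in> X" for x
  proof (rule has_field_derivative_fourier_coeff[OF \<open>open X\<close> x])
    show "((\<lambda>x. f x (?c s)) has_field_derivative deriv (\<lambda>x. f x (?c s)) x) (at x)" if "x \<in> X" for x s
      by (rule holomorphic_derivI[OF hol'[OF in_U] \<open>open X\<close> that])
    show "continuous_on {0..2 * pi} (\<lambda>s. f x (?c s))" if "x \<in> X" for x
      by (rule continuous_on_compose2[OF holomorphic_on_imp_continuous_on[OF hol[OF that]]]) (use in_U in \<open>auto intro!: continuous_intros\<close>)
    have "continuous_on (X \<times> UNIV) (\<lambda>q. (\<lambda>(u, x). deriv (\<lambda>x. f x u) x) (?c (snd q), fst q))"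
      by (rule continuous_on_compose2[OF cont']) (use in_U in \<open>auto intro!: continuous_intros\<close>)
    then show "continuous_on (X \<times> UNIV) (\<lambda>(x, s). deriv (\<lambda>x. f x (?c s)) x)" by (simp add: case_prod_unfold)
  qed
  then have "(\<lambda>x. fourier_coeff (\<lambda>s. f x (?c s)) 1 / of_real r) holomorphic_on X"
    using r by (intro holomorphic_intros) (auto simp: holomorphic_on_open[OF \<open>open X\<close>])
  moreover have "fourier_coeff (\<lambda>s. f x (?c s)) 1 / of_real r = deriv (f x) u" if "x \<in> X" for x
    using deriv_eq_fourier_coeff[OF holomorphic_on_subset[OF hol[OF that] \<epsilon>(2)] r] by simp
  ultimately show ?thesis by (simp cong: holomorphic_cong)
qed

text \<open>The consequence of joint analyticity used below. By Cauchy's formula it is inherited by all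
  partial derivatives.\<close>

definition regular :: "(complex \<Rightarrow> complex \<Rightarrow> complex \<Rightarrow> complex) \<Rightarrow> complex set \<Rightarrow> complex set \<Rightarrow> complex set \<Rightarrow> bool" where
  "regular F A B C \<longleftrightarrow> open A \<and> open B \<and> open C \<and> continuous_on (A \<times> B \<times> C) (\<lambda>(x, y, z). F x y z) \<and>
     (\<forall>y\<in>B. \<forall>z\<in>C. (\<lambda>x. F x y z) holomorphic_on A) \<and>
     (\<forall>x\<in>A. \<forall>z\<in>C. (\<lambda>y. F x y z) holomorphic_on B) \<and>
     (\<forall>x\<in>A. \<forall>y\<in>B. F x y holomorphic_on C)"

lemma regularD:
  assumes "regular F A B C"
  shows "open A" "open B" "open C" "continuous_on (A \<times> B \<times> C) (\<lambda>(x, y, z). F x y z)"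
    "\<And>y z. y \<in> B \<Longrightarrow> z \<in> C \<Longrightarrow> (\<lambda>x. F x y z) holomorphic_on A"
    "\<And>x z. x \<in> A \<Longrightarrow> z \<in> C \<Longrightarrow> (\<lambda>y. F x y z) holomorphic_on B"
    "\<And>x y. x \<in> A \<Longrightarrow> y \<in> B \<Longrightarrow> F x y holomorphic_on C"
  using assms by (auto simp: regular_def)

lemma regular_compose:
  assumes "regular F A B C" "continuous_on S f" "continuous_on S g" "continuous_on S h"
    "\<And>p. p \<in> S \<Longrightarrow> f p \<in> A \<and> g p \<in> B \<and> h p \<in> C"
  shows "continuous_on S (\<lambda>p. F (f p) (g p) (h p))"
proof -
  have "continuous_on S (\<lambda>p. (\<lambda>(x, y, z). F x y z) (f p, g p, h p))"
    by (rule continuous_on_compose2[OF regularD(4)[OF assms(1)]]) (use assms in \<open>auto intro!: continuous_intros\<close>)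
  then show ?thesis by simp
qed

lemma regular_rotate:
  assumes "regular F A B C"
  shows "regular (\<lambda>y z x. F x y z) B C A"
proof -
  have "continuous_on (B \<times> C \<times> A) (\<lambda>p. F (snd (snd p)) (fst p) (fst (snd p)))"
    by (rule regular_compose[OF assms]) (auto intro!: continuous_intros)
  then show ?thesis using regularD[OF assms] by (auto simp: regular_def case_prod_unfold)
qed

lemma regular_deriv1:
  assumes "regular F A B C"
  shows "regular (\<lambda>x y z. deriv (\<lambda>x. F x y z) x) A B C"
  unfolding regular_def
proof (intro conjI ballI)
  note R = regularD[OF assms]
  show "open A" "open B" "open C" by fact+
  have "continuous_on ((B \<times> C) \<times> A) (\<lambda>(p, x). F x (fst p) (snd p))"
    unfolding case_prod_unfold by (rule regular_compose[OF assms]) (auto intro!: continuous_intros)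
  then have "continuous_on ((B \<times> C) \<times> A) (\<lambda>(p, x). deriv (\<lambda>x. F x (fst p) (snd p)) x)"
    using R by (intro continuous_on_deriv_param) (auto intro: open_Times)
  then have "continuous_on (A \<times> B \<times> C) (\<lambda>q. (\<lambda>(p, x). deriv (\<lambda>x. F x (fst p) (snd p)) x) ((fst (snd q), snd (snd q)), fst q))"
    by (rule continuous_on_compose2) (auto intro!: continuous_intros)
  then show "continuous_on (A \<times> B \<times> C) (\<lambda>(x, y, z). deriv (\<lambda>x. F x y z) x)" by (simp add: case_prod_unfold)
  show "(\<lambda>x. deriv (\<lambda>x. F x y z) x) holomorphic_on A" if "y \<in> B" "z \<in> C" for y z
    using holomorphic_deriv[OF R(5)[OF that] R(1)] by simp
  show "(\<lambda>y. deriv (\<lambda>x. F x y z) x) holomorphic_on B" if "x \<in> A" "z \<in> C" for x z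
  proof (rule holomorphic_deriv_param[OF R(2) R(1) _ _ _ that(1)])
    show "continuous_on (B \<times> A) (\<lambda>(y, x). F x y z)"
      unfolding case_prod_unfold by (rule regular_compose[OF assms]) (use that in \<open>auto intro!: continuous_intros\<close>)
  qed (use R that in auto)
  show "(\<lambda>z. deriv (\<lambda>x. F x y z) x) holomorphic_on C" if "x \<in> A" "y \<in> B" for x y
  proof (rule holomorphic_deriv_param[OF R(3) R(1) _ _ _ that(1)])
    show "continuous_on (C \<times> A) (\<lambda>(z, x). F x y z)"
      unfolding case_prod_unfold by (rule regular_compose[OF assms]) (use that in \<open>auto intro!: continuous_intros\<close>)
  qed (use R that in auto)
qed

lemma regular_deriv2:
  assumes "regular F A B C"
  shows "regular (\<lambda>x y z. deriv (\<lambda>y. F x y z) y) A B C"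
  using regular_rotate[OF regular_rotate[OF regular_deriv1[OF regular_rotate[OF assms]]]] .

lemma regular_deriv3:
  assumes "regular F A B C"
  shows "regular (\<lambda>x y z. deriv (\<lambda>z. F x y z) z) A B C"
  using regular_rotate[OF regular_deriv1[OF regular_rotate[OF regular_rotate[OF assms]]]] .

lemma open_strip: "open (strip \<sigma>)"
  unfolding strip_def by (intro open_Collect_less continuous_intros)

lemma of_real_in_strip: "\<sigma> > 0 \<Longrightarrow> of_real t \<in> strip \<sigma>"
  by (simp add: strip_def)

lemma regular_of_holomorphic3:
  assumes "holomorphic3 F (A \<times> B \<times> C)" "open A" "open B" "open C"
  shows "regular F A B C"
proof -
  have D: "\<exists>a b c. ((\<lambda>(z, \<tau>, \<mu>). F z \<tau> \<mu>) has_derivative (\<lambda>(u, v, w). a * u + b * v + c * w)) (at p)" if "p \<in> A \<times> B \<times> C" for p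
    using assms(1) that by (auto simp: holomorphic3_def)
  show ?thesis
    unfolding regular_def
  proof (intro conjI ballI assms)
    show "continuous_on (A \<times> B \<times> C) (\<lambda>(x, y, z). F x y z)"
      using D by (intro continuous_at_imp_continuous_on) (meson has_derivative_continuous)
    show "(\<lambda>x. F x y z) holomorphic_on A" if prems: "y \<in> B" "z \<in> C" for y z
      unfolding holomorphic_on_open[OF \<open>open A\<close>]
    proof
      fix x assume "x \<in> A"
      then obtain a b c where d: "((\<lambda>(z, \<tau>, \<mu>). F z \<tau> \<mu>) has_derivative (\<lambda>(u, v, w). a * u + b * v + c * w)) (at (x, y, z))"
        using D[of "(x, y, z)"] prems by blast
      have "((\<lambda>x. (x, y, z)) has_derivative (\<lambda>h. (h, 0, 0))) (at x)" by (auto intro!: derivative_eq_intros simp: zero_prod_def)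
      from has_derivative_compose[OF this d] have "((\<lambda>x. F x y z) has_derivative (\<lambda>h. a * h)) (at x)" by simp
      then show "\<exists>f'. ((\<lambda>x. F x y z) has_field_derivative f') (at x)" by (auto simp: has_field_derivative_def)
    qed
    show "(\<lambda>y. F x y z) holomorphic_on B" if prems: "x \<in> A" "z \<in> C" for x z
      unfolding holomorphic_on_open[OF \<open>open B\<close>]
    proof
      fix y assume "y \<in> B"
      then obtain a b c where d: "((\<lambda>(z, \<tau>, \<mu>). F z \<tau> \<mu>) has_derivative (\<lambda>(u, v, w). a * u + b * v + c * w)) (at (x, y, z))"
        using D[of "(x, y, z)"] prems by blast
      have "((\<lambda>y. (x, y, z)) has_derivative (\<lambda>h. (0, h, 0))) (at y)" by (auto intro!: derivative_eq_intros simp: zero_prod_def)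
      from has_derivative_compose[OF this d] have "((\<lambda>y. F x y z) has_derivative (\<lambda>h. b * h)) (at y)" by simp
      then show "\<exists>f'. ((\<lambda>y. F x y z) has_field_derivative f') (at y)" by (auto simp: has_field_derivative_def)
    qed
    show "F x y holomorphic_on C" if prems: "x \<in> A" "y \<in> B" for x y
      unfolding holomorphic_on_open[OF \<open>open C\<close>]
    proof
      fix z assume "z \<in> C"
      then obtain a b c where d: "((\<lambda>(z, \<tau>, \<mu>). F z \<tau> \<mu>) has_derivative (\<lambda>(u, v, w). a * u + b * v + c * w)) (at (x, y, z))"
        using D[of "(x, y, z)"] prems by blast
      have "((\<lambda>z. (x, y, z)) has_derivative (\<lambda>h. (0, 0, h))) (at z)" by (auto intro!: derivative_eq_intros simp: zero_prod_def)
      from has_derivative_compose[OF this d] have "((\<lambda>z. F x y z) has_derivative (\<lambda>h. c * h)) (at z)" by simp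
      then show "\<exists>f'. (F x y has_field_derivative f') (at z)" by (auto simp: has_field_derivative_def)
    qed
  qed
qed

section \<open>Taylor coefficients in \<open>\<mu>\<close> and Fourier coefficients in \<open>\<tau>\<close>\<close>

text \<open>The Taylor coefficient at \<open>0\<close> (\<open>taylor_coeff_eq\<close>), written as an integral over the circle of radius
  \<open>r\<close> so that it commutes with the operations in the other variables.\<close>

definition taylor_coeff :: "real \<Rightarrow> nat \<Rightarrow> (complex \<Rightarrow> complex) \<Rightarrow> complex" where
  "taylor_coeff r j h = fourier_coeff (\<lambda>s. h (of_real r * exp (\<i> * of_real s))) (int j) / of_real r ^ j"

text \<open>The coefficient of \<open>\<mu>\<^sup>j e\<^bsup>ik\<tau>\<^esup>\<close>.\<close>

definition mode :: "real \<Rightarrow> nat \<Rightarrow> int \<Rightarrow> (complex \<Rightarrow> complex \<Rightarrow> complex) \<Rightarrow> complex" where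
  "mode r j k f = fourier_coeff (\<lambda>t. taylor_coeff r j (f (of_real t))) k"

lemma taylor_coeff_eq:
  assumes "h holomorphic_on ball 0 \<mu>0" "0 < r" "r < \<mu>0"
  shows "taylor_coeff r j h = (deriv ^^ j) h 0 / fact j"
  using taylor_coeff_eq_fourier_coeff[OF assms, of j] by (simp add: taylor_coeff_def)

lemma circle_in_ball: "0 < r \<Longrightarrow> r < \<mu>0 \<Longrightarrow> of_real r * exp (\<i> * of_real s) \<in> ball 0 \<mu>0"
  by (simp add: norm_mult)

lemma continuous_on_circle:
  assumes "h holomorphic_on ball 0 \<mu>0" "0 < r" "r < \<mu>0"
  shows "continuous_on S (\<lambda>s. h (of_real r * exp (\<i> * of_real s)))"
  by (rule continuous_on_compose2[OF holomorphic_on_imp_continuous_on[OF assms(1)]])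
    (use assms in \<open>auto intro!: continuous_intros simp: norm_mult\<close>)

lemma taylor_coeff_add:
  assumes "f holomorphic_on ball 0 \<mu>0" "g holomorphic_on ball 0 \<mu>0" "0 < r" "r < \<mu>0"
  shows "taylor_coeff r j (\<lambda>\<mu>. f \<mu> + g \<mu>) = taylor_coeff r j f + taylor_coeff r j g"
    "taylor_coeff r j (\<lambda>\<mu>. f \<mu> - g \<mu>) = taylor_coeff r j f - taylor_coeff r j g"
  unfolding taylor_coeff_def
  using fourier_coeff_add[OF continuous_on_circle continuous_on_circle, OF assms(1,3,4,2,3,4)]
    fourier_coeff_diff[OF continuous_on_circle continuous_on_circle, OF assms(1,3,4,2,3,4)]
  by (simp_all add: add_divide_distrib diff_divide_distrib)

lemma taylor_coeff_cmult: "taylor_coeff r j (\<lambda>\<mu>. c * f \<mu>) = c * taylor_coeff r j f"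
  unfolding taylor_coeff_def by (simp add: fourier_coeff_cmult)

lemma taylor_coeff_cong:
  assumes "\<And>\<mu>. \<mu> \<in> ball 0 \<mu>0 \<Longrightarrow> f \<mu> = g \<mu>" "0 < r" "r < \<mu>0"
  shows "taylor_coeff r j f = taylor_coeff r j g"
  unfolding taylor_coeff_def using assms(1)[OF circle_in_ball[OF assms(2,3)]] by simp

lemma taylor_coeff_ident: "0 < r \<Longrightarrow> taylor_coeff r j (\<lambda>\<mu>. \<mu>) = (if j = 1 then 1 else 0)"
  using fourier_coeff_exp[of 1 "int j"] by (simp add: taylor_coeff_def fourier_coeff_cmult)

lemma taylor_coeff_mult:
  assumes f: "f holomorphic_on ball 0 \<mu>0" and g: "g holomorphic_on ball 0 \<mu>0" and r: "0 < r" "r < \<mu>0"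
  shows "taylor_coeff r j (\<lambda>\<mu>. f \<mu> * g \<mu>) = (\<Sum>i\<le>j. taylor_coeff r i f * taylor_coeff r (j - i) g)"
proof -
  have "(\<lambda>\<mu>. f \<mu> * g \<mu>) holomorphic_on ball 0 \<mu>0" by (intro holomorphic_intros f g)
  then have "taylor_coeff r j (\<lambda>\<mu>. f \<mu> * g \<mu>) = (deriv ^^ j) (\<lambda>\<mu>. f \<mu> * g \<mu>) 0 / fact j"
    by (rule taylor_coeff_eq) (use r in auto)
  also have "\<dots> = (\<Sum>i\<le>j. of_nat (j choose i) * (deriv ^^ i) f 0 * (deriv ^^ (j - i)) g 0) / fact j"
    using higher_deriv_mult[OF f g open_ball, of 0 j] r by (simp add: atLeast0AtMost)
  also have "\<dots> = (\<Sum>i\<le>j. taylor_coeff r i f * taylor_coeff r (j - i) g)"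
    unfolding sum_divide_distrib
  proof (rule sum.cong)
    fix i assume "i \<in> {..j}"
    then show "of_nat (j choose i) * (deriv ^^ i) f 0 * (deriv ^^ (j - i)) g 0 / fact j = taylor_coeff r i f * taylor_coeff r (j - i) g"
      by (simp add: taylor_coeff_eq[OF f r] taylor_coeff_eq[OF g r] binomial_fact)
  qed simp
  finally show ?thesis .
qed

lemma norm_taylor_coeff_le:
  assumes "h holomorphic_on ball 0 \<mu>0" "0 < r" "r < \<mu>0" "\<And>\<mu>. norm \<mu> = r \<Longrightarrow> norm (h \<mu>) \<le> B"
  shows "norm (taylor_coeff r j h) \<le> B / r ^ j"
  unfolding taylor_coeff_def norm_divide norm_power
  using norm_fourier_coeff_le[OF continuous_on_circle[OF assms(1,2,3)], of B "int j"] assms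
  by (simp add: norm_mult divide_right_mono)

context
  fixes F :: "complex \<Rightarrow> complex \<Rightarrow> complex \<Rightarrow> complex" and D :: "complex set" and \<sigma> \<mu>0 r :: real
  assumes F: "regular F D (strip \<sigma>) (ball 0 \<mu>0)" and \<sigma>: "\<sigma> > 0" and r: "0 < r" "r < \<mu>0"
begin

lemma continuous_on_taylor_coeff:
  "continuous_on (D \<times> strip \<sigma>) (\<lambda>(z, \<tau>). taylor_coeff r j (F z \<tau>))"
proof -
  have "continuous_on ((D \<times> strip \<sigma>) \<times> UNIV) (\<lambda>(p, s). F (fst p) (snd p) (of_real r * exp (\<i> * of_real s)))"
    unfolding case_prod_unfold
    by (rule regular_compose[OF F]) (use r in \<open>auto intro!: continuous_intros simp: norm_mult\<close>)
  then have "continuous_on (D \<times> strip \<sigma>) (\<lambda>p. taylor_coeff r j (F (fst p) (snd p)))"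
    unfolding taylor_coeff_def using r by (intro continuous_on_divide continuous_on_fourier_coeff continuous_on_const) auto
  then show ?thesis by (simp add: case_prod_unfold)
qed

lemma continuous_on_taylor_coeff_real:
  assumes "z \<in> D"
  shows "continuous_on S (\<lambda>t. taylor_coeff r j (F z (of_real t)))"
proof -
  have "continuous_on S (\<lambda>t. (\<lambda>(z, \<tau>). taylor_coeff r j (F z \<tau>)) (z, complex_of_real t))"
    by (rule continuous_on_compose2[OF continuous_on_taylor_coeff])
      (use assms of_real_in_strip[OF \<sigma>] in \<open>auto intro!: continuous_intros\<close>)
  then show ?thesis by simp
qed

lemma taylor_coeff_deriv1:
  assumes "z \<in> D" "\<tau> \<in> strip \<sigma>"
  shows "((\<lambda>z. taylor_coeff r j (F z \<tau>)) has_field_derivative taylor_coeff r j (\<lambda>\<mu>. deriv (\<lambda>z. F z \<tau> \<mu>) z)) (at z)"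
  unfolding taylor_coeff_def
proof (rule DERIV_cdivide, rule has_field_derivative_fourier_coeff[OF regularD(1)[OF F] assms(1)])
  let ?c = "\<lambda>s. of_real r * exp (\<i> * of_real s)"
  note R = regularD[OF F]
  show "((\<lambda>z. F z \<tau> (?c s)) has_field_derivative deriv (\<lambda>z. F z \<tau> (?c s)) z) (at z)" if "z \<in> D" for z s
    by (rule holomorphic_derivI[OF R(5)[OF assms(2) circle_in_ball[OF r]] R(1) that])
  show "continuous_on {0..2 * pi} (\<lambda>s. F z \<tau> (?c s))" if "z \<in> D" for z
    by (rule continuous_on_circle[OF R(7)[OF that assms(2)] r])
  show "continuous_on (D \<times> UNIV) (\<lambda>(z, s). deriv (\<lambda>z. F z \<tau> (?c s)) z)"
    unfolding case_prod_unfold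
    by (rule regular_compose[OF regular_deriv1[OF F]]) (use assms r in \<open>auto intro!: continuous_intros simp: norm_mult\<close>)
qed

lemma taylor_coeff_deriv2:
  assumes "z \<in> D" "\<tau> \<in> strip \<sigma>"
  shows "((\<lambda>\<tau>. taylor_coeff r j (F z \<tau>)) has_field_derivative taylor_coeff r j (\<lambda>\<mu>. deriv (\<lambda>\<tau>. F z \<tau> \<mu>) \<tau>)) (at \<tau>)"
  unfolding taylor_coeff_def
proof (rule DERIV_cdivide, rule has_field_derivative_fourier_coeff[OF regularD(2)[OF F] assms(2)])
  let ?c = "\<lambda>s. of_real r * exp (\<i> * of_real s)"
  note R = regularD[OF F]
  show "((\<lambda>\<tau>. F z \<tau> (?c s)) has_field_derivative deriv (\<lambda>\<tau>. F z \<tau> (?c s)) \<tau>) (at \<tau>)" if "\<tau> \<in> strip \<sigma>" for \<tau> s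
    by (rule holomorphic_derivI[OF R(6)[OF assms(1) circle_in_ball[OF r]] R(2) that])
  show "continuous_on {0..2 * pi} (\<lambda>s. F z \<tau> (?c s))" if "\<tau> \<in> strip \<sigma>" for \<tau>
    by (rule continuous_on_circle[OF R(7)[OF assms(1) that] r])
  show "continuous_on (strip \<sigma> \<times> UNIV) (\<lambda>(\<tau>, s). deriv (\<lambda>\<tau>. F z \<tau> (?c s)) \<tau>)"
    unfolding case_prod_unfold
    by (rule regular_compose[OF regular_deriv2[OF F]]) (use assms r in \<open>auto intro!: continuous_intros simp: norm_mult\<close>)
qed

end

lemma mode_deriv1:
  assumes F: "regular F D (strip \<sigma>) (ball 0 \<mu>0)" and \<sigma>: "\<sigma> > 0" and r: "0 < r" "r < \<mu>0" and z: "z \<in> D"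
  shows "((\<lambda>z. mode r j k (F z)) has_field_derivative mode r j k (\<lambda>\<tau> \<mu>. deriv (\<lambda>z. F z \<tau> \<mu>) z)) (at z)"
  unfolding mode_def
proof (rule has_field_derivative_fourier_coeff[OF regularD(1)[OF F] z])
  show "((\<lambda>z. taylor_coeff r j (F z (of_real t))) has_field_derivative taylor_coeff r j (\<lambda>\<mu>. deriv (\<lambda>z. F z (of_real t) \<mu>) z)) (at z)" if "z \<in> D" for z t
    by (rule taylor_coeff_deriv1[OF F \<sigma> r that of_real_in_strip[OF \<sigma>]])
  show "continuous_on {0..2 * pi} (\<lambda>t. taylor_coeff r j (F z (of_real t)))" if "z \<in> D" for z
    by (rule continuous_on_taylor_coeff_real[OF F \<sigma> r that])
  have "continuous_on (D \<times> UNIV) (\<lambda>p. (\<lambda>(z, \<tau>). taylor_coeff r j (\<lambda>\<mu>. deriv (\<lambda>z. F z \<tau> \<mu>) z)) (fst p, complex_of_real (snd p)))"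
    by (rule continuous_on_compose2[OF continuous_on_taylor_coeff[OF regular_deriv1[OF F] \<sigma> r]])
      (use of_real_in_strip[OF \<sigma>] in \<open>auto intro!: continuous_intros\<close>)
  then show "continuous_on (D \<times> UNIV) (\<lambda>(z, t). taylor_coeff r j (\<lambda>\<mu>. deriv (\<lambda>z. F z (of_real t) \<mu>) z))"
    by (simp add: case_prod_unfold)
qed

lemma mode_deriv2:
  assumes F: "regular F D (strip \<sigma>) (ball 0 \<mu>0)" and \<sigma>: "\<sigma> > 0" and r: "0 < r" "r < \<mu>0" and z: "z \<in> D"
    and per: "\<And>\<mu>. \<mu> \<in> ball 0 \<mu>0 \<Longrightarrow> F z (0 + 2 * pi) \<mu> = F z 0 \<mu>"
  shows "mode r j k (\<lambda>\<tau> \<mu>. deriv (\<lambda>\<tau>. F z \<tau> \<mu>) \<tau>) = \<i> * of_int k * mode r j k (F z)"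
  unfolding mode_def
proof (rule fourier_coeff_deriv)
  fix t :: real
  have "((\<lambda>\<tau>. taylor_coeff r j (F z \<tau>)) has_field_derivative taylor_coeff r j (\<lambda>\<mu>. deriv (\<lambda>\<tau>. F z \<tau> \<mu>) (of_real t))) (at (of_real t))"
    by (rule taylor_coeff_deriv2[OF F \<sigma> r z of_real_in_strip[OF \<sigma>]])
  then show "((\<lambda>t. taylor_coeff r j (F z (of_real t))) has_vector_derivative taylor_coeff r j (\<lambda>\<mu>. deriv (\<lambda>\<tau>. F z \<tau> \<mu>) (of_real t))) (at t)"
    by (rule has_vector_derivative_real_field)
  show "continuous_on UNIV (\<lambda>t. taylor_coeff r j (\<lambda>\<mu>. deriv (\<lambda>\<tau>. F z \<tau> \<mu>) (complex_of_real t)))"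
    by (rule continuous_on_taylor_coeff_real[OF regular_deriv2[OF F] \<sigma> r z])
  show "taylor_coeff r j (F z (of_real (2 * pi))) = taylor_coeff r j (F z (of_real 0))"
    by (rule taylor_coeff_cong[OF _ r]) (use per in simp)
qed

text \<open>The integrals over the two circles, in \<open>\<tau>\<close> and in \<open>\<mu>\<close>, can be interchanged.\<close>

lemma mode_eq_higher_deriv:
  assumes F: "regular F D (strip \<sigma>) (ball 0 \<mu>0)" and \<sigma>: "\<sigma> > 0" and r: "0 < r" "r < \<mu>0" and z: "z \<in> D"
  shows "(\<lambda>\<mu>. fourier_coeff (\<lambda>t. F z (of_real t) \<mu>) k) holomorphic_on ball 0 \<mu>0"
    and "(deriv ^^ j) (\<lambda>\<mu>. fourier_coeff (\<lambda>t. F z (of_real t) \<mu>) k) 0 / fact j = mode r j k (F z)"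
proof -
  note R = regularD[OF F]
  have "((\<lambda>\<mu>. fourier_coeff (\<lambda>t. F z (of_real t) \<mu>) k) has_field_derivative fourier_coeff (\<lambda>t. deriv (F z (of_real t)) \<mu>) k) (at \<mu>)"
    if \<mu>: "\<mu> \<in> ball 0 \<mu>0" for \<mu>
  proof (rule has_field_derivative_fourier_coeff[OF open_ball \<mu>])
    show "(F z (of_real t) has_field_derivative deriv (F z (of_real t)) \<mu>) (at \<mu>)" if "\<mu> \<in> ball 0 \<mu>0" for \<mu> t
      by (rule holomorphic_derivI[OF R(7)[OF z of_real_in_strip[OF \<sigma>]] open_ball that])
    show "continuous_on {0..2 * pi} (\<lambda>t. F z (of_real t) \<mu>)" if "\<mu> \<in> ball 0 \<mu>0" for \<mu>
      by (rule regular_compose[OF F]) (use z that of_real_in_strip[OF \<sigma>] in \<open>auto intro!: continuous_intros\<close>)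
    show "continuous_on (ball 0 \<mu>0 \<times> UNIV) (\<lambda>(\<mu>, t). deriv (F z (of_real t)) \<mu>)"
      unfolding case_prod_unfold
      by (rule regular_compose[OF regular_deriv3[OF F]]) (use z of_real_in_strip[OF \<sigma>] in \<open>auto intro!: continuous_intros\<close>)
  qed
  then show hol: "(\<lambda>\<mu>. fourier_coeff (\<lambda>t. F z (of_real t) \<mu>) k) holomorphic_on ball 0 \<mu>0"
    unfolding holomorphic_on_open[OF open_ball] by blast
  have "continuous_on UNIV (\<lambda>(t, s). F z (of_real t) (of_real r * exp (\<i> * of_real s)))"
    unfolding case_prod_unfold
    by (rule regular_compose[OF F]) (use z of_real_in_strip[OF \<sigma>] r in \<open>auto intro!: continuous_intros simp: norm_mult\<close>)
  from fourier_coeff_swap[OF this]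
  have "mode r j k (F z) = taylor_coeff r j (\<lambda>\<mu>. fourier_coeff (\<lambda>t. F z (of_real t) \<mu>) k)"
    unfolding mode_def taylor_coeff_def by (simp add: fourier_coeff_cdiv)
  then show "(deriv ^^ j) (\<lambda>\<mu>. fourier_coeff (\<lambda>t. F z (of_real t) \<mu>) k) 0 / fact j = mode r j k (F z)"
    using taylor_coeff_eq[OF hol r] by simp
qed

section \<open>The modes of the solutions of the inner equation\<close>

lemma inner_solution_regular:
  assumes "inner_solution \<gamma> D \<sigma> \<mu>0 M \<psi>" "open D"
  shows "regular \<psi> D (strip \<sigma>) (ball 0 \<mu>0)"
  using assms by (intro regular_of_holomorphic3 open_strip) (auto simp: inner_solution_def analytic_periodic_def)

lemma inner_solution_periodic:
  assumes sol: "inner_solution \<gamma> D \<sigma> \<mu>0 M \<psi>" and D: "open D" and z: "z \<in> D" and \<tau>: "\<tau> \<in> strip \<sigma>" and \<mu>: "\<mu> \<in> ball 0 \<mu>0"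
  shows "\<psi> z (\<tau> + 2 * pi) \<mu> = \<psi> z \<tau> \<mu>"
    and "deriv (\<lambda>z. \<psi> z (\<tau> + 2 * pi) \<mu>) z = deriv (\<lambda>z. \<psi> z \<tau> \<mu>) z"
proof -
  have per: "\<psi> z (\<tau> + 2 * pi) \<mu> = \<psi> z \<tau> \<mu>" if "z \<in> D" for z
    using sol that \<tau> \<mu> by (auto simp: inner_solution_def analytic_periodic_def)
  show "\<psi> z (\<tau> + 2 * pi) \<mu> = \<psi> z \<tau> \<mu>" by (rule per[OF z])
  have "\<forall>\<^sub>F w in nhds z. w \<in> D" by (rule eventually_nhds_in_open[OF D z])
  then have "\<forall>\<^sub>F w in nhds z. \<psi> w (\<tau> + 2 * pi) \<mu> = \<psi> w \<tau> \<mu>"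
    by eventually_elim (rule per)
  then show "deriv (\<lambda>z. \<psi> z (\<tau> + 2 * pi) \<mu>) z = deriv (\<lambda>z. \<psi> z \<tau> \<mu>) z"
    by (rule deriv_cong_ev) simp
qed

text \<open>The inner equation is expanded in powers of \<open>\<mu>\<close>, which turns the square into a Cauchy product, and then
  integrated against \<open>e\<^bsup>-ik\<tau>\<^esup>\<close>.\<close>

lemma mode_equation:
  assumes sol: "inner_solution \<gamma> D \<sigma> \<mu>0 M \<psi>" and D: "open D" and \<sigma>: "\<sigma> > 0" and r: "0 < r" "r < \<mu>0" and z: "z \<in> D"
    and \<gamma>: "\<gamma> holomorphic_on strip \<sigma>" "\<And>t. \<gamma> (of_real t) = of_real (g t)"
  defines "\<phi> \<equiv> (\<lambda>\<tau> \<mu>. deriv (\<lambda>z. \<psi> z \<tau> \<mu>) z)"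
  shows "\<i> * of_int k * mode r j k (\<psi> z) + mode r j k \<phi> =
    z\<^sup>2 / 8 * (\<Sum>i\<le>j. fourier_coeff (\<lambda>t. taylor_coeff r i (\<phi> (of_real t)) * taylor_coeff r (j - i) (\<phi> (of_real t))) k)
    + (if j = 1 then - 2 * fourier_coeffs g k / z\<^sup>2 else 0)"
proof -
  have R: "regular \<psi> D (strip \<sigma>) (ball 0 \<mu>0)" by (rule inner_solution_regular[OF sol D])
  note R1 = regular_deriv1[OF R] and R2 = regular_deriv2[OF R]
  define \<theta> where "\<theta> = (\<lambda>\<tau> \<mu>. deriv (\<lambda>\<tau>. \<psi> z \<tau> \<mu>) \<tau>)"
  have st: "complex_of_real t \<in> strip \<sigma>" for t by (rule of_real_in_strip[OF \<sigma>])
  have hol\<phi>: "\<phi> (of_real t) holomorphic_on ball 0 \<mu>0" for t unfolding \<phi>_def by (rule regularD(7)[OF R1 z st])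
  have hol\<theta>: "\<theta> (of_real t) holomorphic_on ball 0 \<mu>0" for t unfolding \<theta>_def by (rule regularD(7)[OF R2 z st])
  have c\<phi>: "continuous_on S (\<lambda>t. taylor_coeff r i (\<phi> (of_real t)))" for i S
    unfolding \<phi>_def by (rule continuous_on_taylor_coeff_real[OF R1 \<sigma> r z])
  have c\<theta>: "continuous_on S (\<lambda>t. taylor_coeff r i (\<theta> (of_real t)))" for i S
    unfolding \<theta>_def by (rule continuous_on_taylor_coeff_real[OF R2 \<sigma> r z])
  have cg: "continuous_on S (\<lambda>t. complex_of_real (g t))" for S
  proof -
    have "continuous_on S (\<lambda>t. \<gamma> (of_real t))"
      by (rule continuous_on_compose2[OF holomorphic_on_imp_continuous_on[OF \<gamma>(1)]]) (use st in \<open>auto intro!: continuous_intros\<close>)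
    then show ?thesis by (simp add: \<gamma>(2))
  qed
  have pt: "taylor_coeff r j (\<theta> (of_real t)) + taylor_coeff r j (\<phi> (of_real t)) =
      z\<^sup>2 / 8 * (\<Sum>i\<le>j. taylor_coeff r i (\<phi> (of_real t)) * taylor_coeff r (j - i) (\<phi> (of_real t)))
      + (if j = 1 then - 2 / z\<^sup>2 else 0) * of_real (g t)" for t :: real
  proof -
    have "taylor_coeff r j (\<lambda>\<mu>. \<theta> (of_real t) \<mu> + \<phi> (of_real t) \<mu>) =
        taylor_coeff r j (\<lambda>\<mu>. z\<^sup>2 / 8 * (\<phi> (of_real t) \<mu> * \<phi> (of_real t) \<mu>) + (- 2 / z\<^sup>2 * of_real (g t)) * \<mu>)"
    proof (rule taylor_coeff_cong[OF _ r])
      fix \<mu> :: complex assume \<mu>: "\<mu> \<in> ball 0 \<mu>0"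
      have "\<theta> (of_real t) \<mu> + \<phi> (of_real t) \<mu> = 1 / 8 * z\<^sup>2 * (\<phi> (of_real t) \<mu>)\<^sup>2 - 2 * \<mu> * (\<gamma> (of_real t) / z\<^sup>2)"
        using sol z st[of t] \<mu> unfolding inner_solution_def \<theta>_def \<phi>_def by blast
      then show "\<theta> (of_real t) \<mu> + \<phi> (of_real t) \<mu> = z\<^sup>2 / 8 * (\<phi> (of_real t) \<mu> * \<phi> (of_real t) \<mu>) + (- 2 / z\<^sup>2 * of_real (g t)) * \<mu>"
        by (simp add: \<gamma>(2) power2_eq_square)
    qed
    moreover have "taylor_coeff r j (\<lambda>\<mu>. z\<^sup>2 / 8 * (\<phi> (of_real t) \<mu> * \<phi> (of_real t) \<mu>) + (- 2 / z\<^sup>2 * of_real (g t)) * \<mu>)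
      = taylor_coeff r j (\<lambda>\<mu>. z\<^sup>2 / 8 * (\<phi> (of_real t) \<mu> * \<phi> (of_real t) \<mu>)) + taylor_coeff r j (\<lambda>\<mu>. (- 2 / z\<^sup>2 * of_real (g t)) * \<mu>)"
      by (rule taylor_coeff_add(1)[OF _ _ r]) (intro holomorphic_intros hol\<phi>)+
    ultimately show ?thesis
      by (simp only: taylor_coeff_add(1)[OF hol\<theta> hol\<phi> r] taylor_coeff_cmult taylor_coeff_ident[OF r(1)] taylor_coeff_mult[OF hol\<phi> hol\<phi> r]) simp
  qed
  have "mode r j k \<theta> + mode r j k \<phi> = fourier_coeff (\<lambda>t. taylor_coeff r j (\<theta> (of_real t)) + taylor_coeff r j (\<phi> (of_real t))) k"
    unfolding mode_def by (rule fourier_coeff_add[OF c\<theta> c\<phi>, symmetric])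
  also have "\<dots> = fourier_coeff (\<lambda>t. z\<^sup>2 / 8 * (\<Sum>i\<le>j. taylor_coeff r i (\<phi> (of_real t)) * taylor_coeff r (j - i) (\<phi> (of_real t)))) k
      + fourier_coeff (\<lambda>t. (if j = 1 then - 2 / z\<^sup>2 else 0) * of_real (g t)) k"
    unfolding pt by (intro fourier_coeff_add continuous_intros c\<phi> cg)
  also have "\<dots> = z\<^sup>2 / 8 * (\<Sum>i\<le>j. fourier_coeff (\<lambda>t. taylor_coeff r i (\<phi> (of_real t)) * taylor_coeff r (j - i) (\<phi> (of_real t))) k)
      + (if j = 1 then - 2 / z\<^sup>2 else 0) * fourier_coeffs g k"
    unfolding fourier_coeff_cmult fourier_coeffs_def by (subst fourier_coeff_sum) (intro refl finite_atMost continuous_intros c\<phi>)+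
  finally show ?thesis
    using mode_deriv2[OF R \<sigma> r z, of j k] inner_solution_periodic(1)[OF sol D z st[of 0]] by (simp add: \<theta>_def)
qed

text \<open>The bound of the derivative is proportional to \<open>\<mu>\<close>. Therefore the quadratic term at the order \<open>j\<close> only
  involves orders strictly between \<open>0\<close> and \<open>j\<close>.\<close>

lemma mode_zeroth_derivative:
  assumes sol: "inner_solution \<gamma> D \<sigma> \<mu>0 M \<psi>" and D: "open D" and r: "0 < r" "r < \<mu>0" and z: "z \<in> D" and \<tau>: "\<tau> \<in> strip \<sigma>"
  shows "taylor_coeff r 0 (\<lambda>\<mu>. deriv (\<lambda>z. \<psi> z \<tau> \<mu>) z) = 0"
proof -
  have "taylor_coeff r 0 (\<lambda>\<mu>. deriv (\<lambda>z. \<psi> z \<tau> \<mu>) z) = deriv (\<lambda>z. \<psi> z \<tau> 0) z"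
    using taylor_coeff_eq[OF regularD(7)[OF regular_deriv1[OF inner_solution_regular[OF sol D]] z \<tau>] r, of 0] by simp
  moreover have "norm (deriv (\<lambda>z. \<psi> z \<tau> 0) z) \<le> M * norm (0::complex) / norm z ^ 3"
    using sol z \<tau> r unfolding inner_solution_def by (metis centre_in_ball order.strict_trans)
  ultimately show ?thesis by simp
qed

text \<open>The hypothesis bounds \<open>\<partial>\<^sub>z\<psi>\<close>, not \<open>\<psi>\<close>. The equation then bounds \<open>\<partial>\<^sub>\<tau>\<psi>\<close>, of which \<open>\<psi>\<^bsup>[k]\<^esup>\<close> is \<open>1/(ik)\<close> times
  a Fourier coefficient.\<close>

lemma mode_bounded:
  assumes sol: "inner_solution \<gamma> D \<sigma> \<mu>0 M \<psi>" and D: "open D" and \<sigma>: "\<sigma> > 0" and r: "0 < r" "r < \<mu>0"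
    and \<gamma>: "\<gamma> holomorphic_on strip \<sigma>" and k: "k \<noteq> 0"
  shows "\<exists>B. \<forall>z\<in>D. norm z \<ge> 1 / 2 \<longrightarrow> norm (mode r j k (\<psi> z)) \<le> B"
proof -
  have R: "regular \<psi> D (strip \<sigma>) (ball 0 \<mu>0)" by (rule inner_solution_regular[OF sol D])
  have st: "complex_of_real t \<in> strip \<sigma>" for t by (rule of_real_in_strip[OF \<sigma>])
  have "bounded ((\<lambda>t. \<gamma> (of_real t)) ` {0..2*pi})"
    by (intro compact_imp_bounded compact_continuous_image continuous_on_compose2[OF holomorphic_on_imp_continuous_on[OF \<gamma>]])
      (use st in \<open>auto intro!: continuous_intros\<close>)
  then obtain G where G: "\<And>t. t \<in> {0..2*pi} \<Longrightarrow> norm (\<gamma> (of_real t)) \<le> G"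
    unfolding bounded_iff by blast
  have G0: "G \<ge> 0" using G[of 0] order_trans[OF norm_ge_zero] by force
  define B where "B = (1 / 8 * (16 * (M * r)\<^sup>2) + 2 * r * (G * 4)) + 8 * (M * r)"
  show ?thesis
  proof (intro exI[of _ "B / r ^ j"] ballI impI)
    fix z assume z: "z \<in> D" "norm z \<ge> 1 / 2"
    have nz: "norm z > 0" using z by linarith
    have inv: "1 / norm z ^ n \<le> 2 ^ n" for n
    proof -
      have "(1 / norm z) ^ n \<le> 2 ^ n" using z nz by (intro power_mono) (auto simp: divide_le_eq)
      then show ?thesis by (simp add: power_divide)
    qed
    have le: "norm (deriv (\<lambda>\<tau>. \<psi> z \<tau> \<mu>) (of_real t)) \<le> B" if t: "t \<in> {0..2*pi}" and \<mu>: "norm \<mu> = r" for t \<mu>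
    proof -
      define p where "p = deriv (\<lambda>w. \<psi> w (of_real t) \<mu>) z"
      have m: "\<mu> \<in> ball 0 \<mu>0" using \<mu> r by simp
      have p: "norm p \<le> M * r / norm z ^ 3"
        using sol z(1) st[of t] m \<mu> unfolding inner_solution_def p_def by metis
      have "0 \<le> M * r / norm z ^ 3" by (rule order_trans[OF norm_ge_zero p])
      then have Mr: "M * r \<ge> 0" using zero_less_power[OF nz, of 3] by (simp only: zero_le_divide_iff) linarith
      have "deriv (\<lambda>\<tau>. \<psi> z \<tau> \<mu>) (of_real t) + p = 1 / 8 * z\<^sup>2 * p\<^sup>2 - 2 * \<mu> * (\<gamma> (of_real t) / z\<^sup>2)"
        using sol z(1) st[of t] m unfolding inner_solution_def p_def by blast
      then have "deriv (\<lambda>\<tau>. \<psi> z \<tau> \<mu>) (of_real t) = 1 / 8 * z\<^sup>2 * p\<^sup>2 - 2 * \<mu> * (\<gamma> (of_real t) / z\<^sup>2) - p"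
        by (simp add: eq_diff_eq)
      also have "norm \<dots> \<le> norm (1 / 8 * z\<^sup>2 * p\<^sup>2) + norm (2 * \<mu> * (\<gamma> (of_real t) / z\<^sup>2)) + norm p"
        by (meson add_right_mono norm_triangle_ineq4 order_trans)
      also have "\<dots> \<le> B"
        unfolding B_def
      proof (intro add_mono)
        have "norm (1 / 8 * z\<^sup>2 * p\<^sup>2) = 1 / 8 * (norm z * norm p) ^ 2"
          by (simp add: norm_mult norm_divide norm_power power_mult_distrib)
        also have "\<dots> \<le> 1 / 8 * (norm z * (M * r / norm z ^ 3)) ^ 2"
          using p by (intro mult_left_mono power_mono) auto
        also have "\<dots> = 1 / 8 * ((1 / norm z ^ 4) * (M * r)\<^sup>2)"
          using nz by (simp add: power2_eq_square power3_eq_cube power4_eq_xxxx)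
        also have "\<dots> \<le> 1 / 8 * (2 ^ 4 * (M * r)\<^sup>2)" by (intro mult_left_mono mult_right_mono inv) auto
        finally show "norm (1 / 8 * z\<^sup>2 * p\<^sup>2) \<le> 1 / 8 * (16 * (M * r)\<^sup>2)" by simp
        have "norm (2 * \<mu> * (\<gamma> (of_real t) / z\<^sup>2)) = 2 * r * (norm (\<gamma> (of_real t)) * (1 / norm z ^ 2))"
          using \<mu> by (simp add: norm_mult norm_divide norm_power)
        also have "\<dots> \<le> 2 * r * (G * 2 ^ 2)"
          using G[OF t] inv[of 2] r G0 by (intro mult_left_mono mult_mono) auto
        finally show "norm (2 * \<mu> * (\<gamma> (of_real t) / z\<^sup>2)) \<le> 2 * r * (G * 4)" by simp
        have "norm p \<le> (1 / norm z ^ 3) * (M * r)" using p by simp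
        also have "\<dots> \<le> 2 ^ 3 * (M * r)" using Mr by (intro mult_right_mono inv) auto
        finally show "norm p \<le> 8 * (M * r)" by simp
      qed
      finally show ?thesis .
    qed
    have "norm (mode r j k (\<lambda>\<tau> \<mu>. deriv (\<lambda>\<tau>. \<psi> z \<tau> \<mu>) \<tau>)) \<le> B / r ^ j"
      unfolding mode_def
    proof (rule norm_fourier_coeff_le)
      show "continuous_on {0..2 * pi} (\<lambda>t. taylor_coeff r j (\<lambda>\<mu>. deriv (\<lambda>\<tau>. \<psi> z \<tau> \<mu>) (complex_of_real t)))"
        by (rule continuous_on_taylor_coeff_real[OF regular_deriv2[OF R] \<sigma> r z(1)])
      show "norm (taylor_coeff r j (\<lambda>\<mu>. deriv (\<lambda>\<tau>. \<psi> z \<tau> \<mu>) (complex_of_real t))) \<le> B / r ^ j" if "t \<in> {0..2 * pi}" for t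
        by (rule norm_taylor_coeff_le[OF regularD(7)[OF regular_deriv2[OF R] z(1) st] r le[OF that]])
    qed
    then have "norm (\<i> * of_int k * mode r j k (\<psi> z)) \<le> B / r ^ j"
      using mode_deriv2[OF R \<sigma> r z(1), of j k] inner_solution_periodic(1)[OF sol D z(1) st[of 0]] by simp
    moreover have "1 \<le> \<bar>real_of_int k\<bar>" using k by linarith
    then have "norm (mode r j k (\<psi> z)) \<le> norm (\<i> * of_int k * mode r j k (\<psi> z))"
      by (simp add: norm_mult mult_le_cancel_right1)
    ultimately show "norm (mode r j k (\<psi> z)) \<le> B / r ^ j" by linarith
  qed
qed

lemma harmonics_add:
  assumes "k \<in> harmonics g i" "l \<in> harmonics g j"
  shows "k + l \<in> harmonics g (i + j)"
proof -
  obtain ms ns where "k = sum_list ms" "length ms = i" "set ms \<subseteq> {m. fourier_coeffs g m \<noteq> 0}"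
    "l = sum_list ns" "length ns = j" "set ns \<subseteq> {m. fourier_coeffs g m \<noteq> 0}"
    using assms by (auto simp: harmonics_def)
  then show ?thesis unfolding harmonics_def by (intro CollectI exI[of _ "ms @ ns"]) auto
qed

lemma harmonics_one: "k \<in> harmonics g 1 \<longleftrightarrow> fourier_coeffs g k \<noteq> 0"
  by (auto simp: harmonics_def length_Suc_conv intro!: exI[of _ "[k]"])

text \<open>A product only has frequencies that are sums of frequencies of the factors.\<close>

lemma src_harmonics:
  assumes e: "e \<in> {1, -1}"
  shows "j \<ge> 1 \<Longrightarrow> k \<notin> harmonics g j \<Longrightarrow> z \<in> half e \<Longrightarrow>
    src e (replicate j (fourier_coeffs g)) k z = 0 \<and> resp e (replicate j (fourier_coeffs g)) k z = 0"
proof (induction j arbitrary: k z rule: less_induct)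
  case (less j)
  have src0: "src e (replicate j (fourier_coeffs g)) k z = 0" if z: "z \<in> half e" for z
  proof (cases "j = 1")
    case True
    then show ?thesis using less.prems harmonics_one[of k g] by (simp add: src_single)
  next
    case False
    then have j: "length (replicate j (fourier_coeffs g)) \<ge> 2" using less.prems by simp
    have "(\<Sum>\<^sub>\<infinity>l. resp e (take i (replicate j (fourier_coeffs g))) l z * resp e (drop i (replicate j (fourier_coeffs g))) (k - l) z) = 0"
      if i: "i \<in> {1..<j}" for i
    proof -
      have "resp e (replicate i (fourier_coeffs g)) l z = 0 \<or> resp e (replicate (j - i) (fourier_coeffs g)) (k - l) z = 0" for l
      proof (rule ccontr)
        assume "\<not> ?thesis"
        moreover have "1 \<le> j - i" "j - i < j" "1 \<le> i" "i < j" using i by auto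
        ultimately have "l \<in> harmonics g i" "k - l \<in> harmonics g (j - i)"
          using less.IH[of i l z] less.IH[of "j - i" "k - l" z] z by blast+
        from harmonics_add[OF this] show False using less.prems i by simp
      qed
      then show ?thesis using i by (auto simp: min_def intro!: infsum_0)
    qed
    then show ?thesis unfolding src_step[OF j] by simp
  qed
  then show ?case
    using sol_zero[OF e _ src0 less.prems(3)] less.prems(3) by (cases "k = 0") (auto simp: resp_def)
qed

text \<open>A part of \<open>half e\<close> that, for large \<open>R\<close>, lies in the domain of the solution and contains the rays of its
  points.\<close>

definition quadrant :: "real \<Rightarrow> real \<Rightarrow> complex set" where
  "quadrant e R = {z. e * Re z \<le> 0 \<and> e * Re z + Im z < - R}"

lemma quadrant_subset_half: "R \<ge> 1 \<Longrightarrow> quadrant e R \<subseteq> half e"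
  by (auto simp: quadrant_def half_def)

lemma ray_in_quadrant:
  "e \<in> {1, -1} \<Longrightarrow> z \<in> quadrant e R \<Longrightarrow> t \<ge> 0 \<Longrightarrow> z + of_real t * ray e k \<in> quadrant e R"
  by (auto simp: quadrant_def ray_def algebra_simps)

text \<open>By induction on the order the coefficients of \<open>\<partial>\<^sub>z\<psi>\<close> of lower order agree with the responses, so that the
  coefficient of \<open>\<psi>\<close> is a bounded solution with the source of the recursion. At the orders below \<open>N\<close>
  the frequency \<open>1\<close> is not generated, hence the response, which
  discards it, still agrees with the coefficient of \<open>\<partial>\<^sub>z\<psi>\<close>; at the order \<open>N\<close> only the first claim holds.\<close>

theorem solution_modes:
  assumes sol: "inner_solution \<gamma> D \<sigma> \<mu>0 M \<psi>" and D: "open D" and \<sigma>: "\<sigma> > 0" and r: "0 < r" "r < \<mu>0"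
    and \<gamma>: "\<gamma> holomorphic_on strip \<sigma>" "\<And>t. \<gamma> (of_real t) = of_real (g t)"
    and e: "e \<in> {1, -1}" and R: "R \<ge> 1" and K: "quadrant e R \<subseteq> D"
    and a: "l1 (fourier_coeffs g)" and N: "\<And>i. 1 \<le> i \<Longrightarrow> i < N \<Longrightarrow> 1 \<notin> harmonics g i"
  shows "1 \<le> j \<Longrightarrow> j \<le> N \<Longrightarrow> z \<in> quadrant e R \<Longrightarrow>
    (k \<noteq> 0 \<longrightarrow> mode r j k (\<psi> z) = sol e k (src e (replicate j (fourier_coeffs g)) k) z) \<and>
    (j < N \<longrightarrow> mode r j k (\<lambda>\<tau> \<mu>. deriv (\<lambda>z. \<psi> z \<tau> \<mu>) z) = resp e (replicate j (fourier_coeffs g)) k z)"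
proof (induction j arbitrary: k z rule: less_induct)
  case (less j)
  let ?a = "fourier_coeffs g"
  define \<phi> where "\<phi> z = (\<lambda>\<tau> \<mu>. deriv (\<lambda>z. \<psi> z \<tau> \<mu>) z)" for z
  have Rg: "regular \<psi> D (strip \<sigma>) (ball 0 \<mu>0)" by (rule inner_solution_regular[OF sol D])
  have st: "complex_of_real t \<in> strip \<sigma>" for t by (rule of_real_in_strip[OF \<sigma>])
  have half: "quadrant e R \<subseteq> half e" by (rule quadrant_subset_half[OF R])
  have ctrl: "\<exists>b S. controlled b S (replicate i ?a)" if "i \<ge> 1" for i
    using src_controlledE[of "replicate i ?a"] that a by (metis in_set_replicate not_one_le_zero replicate_empty)
  obtain b S where S: "controlled b S (replicate j ?a)" using ctrl less.prems by blast
  have T0: "taylor_coeff r 0 (\<phi> z (of_real t)) = 0" if "z \<in> quadrant e R" for z t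
    unfolding \<phi>_def using mode_zeroth_derivative[OF sol D r _ st] that K by blast
  have rhs: "\<i> * of_int k * mode r j k (\<psi> z) + mode r j k (\<phi> z) = src e (replicate j ?a) k z" if zK: "z \<in> quadrant e R" for k z
  proof -
    have zD: "z \<in> D" and zh: "z \<in> half e" using zK K half by auto
    let ?T = "\<lambda>i t. taylor_coeff r i (\<phi> z (complex_of_real t))"
    have eq: "\<i> * of_int k * mode r j k (\<psi> z) + mode r j k (\<phi> z) =
        z\<^sup>2 / 8 * (\<Sum>i\<le>j. fourier_coeff (\<lambda>t. ?T i t * ?T (j - i) t) k) + (if j = 1 then - 2 * ?a k / z\<^sup>2 else 0)"
      unfolding \<phi>_def by (rule mode_equation[OF sol D \<sigma> r zD \<gamma>])
    show ?thesis
    proof (cases "j = 1")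
      case True
      have "(\<Sum>i\<le>j. fourier_coeff (\<lambda>t. ?T i t * ?T (j - i) t) k) = 0"
        using True by (simp add: T0[OF zK])
      then show ?thesis using eq True by (simp add: src_single)
    next
      case False
      then have j: "length (replicate j ?a) \<ge> 2" using less.prems by simp
      have "(\<Sum>i\<le>j. fourier_coeff (\<lambda>t. ?T i t * ?T (j - i) t) k) = (\<Sum>i\<in>{1..<j}. fourier_coeff (\<lambda>t. ?T i t * ?T (j - i) t) k)"
      proof (rule sum.mono_neutral_right)
        show "\<forall>i\<in>{..j} - {1..<j}. fourier_coeff (\<lambda>t. ?T i t * ?T (j - i) t) k = 0"
        proof
          fix i assume "i \<in> {..j} - {1..<j}"
          then have "i = 0 \<or> j - i = 0" by auto
          then show "fourier_coeff (\<lambda>t. ?T i t * ?T (j - i) t) k = 0" using T0[OF zK] by auto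
        qed
      qed auto
      also have "\<dots> = (\<Sum>i\<in>{1..<j}. \<Sum>\<^sub>\<infinity>l. resp e (replicate i ?a) l z * resp e (replicate (j - i) ?a) (k - l) z)"
      proof (rule sum.cong)
        fix i assume i: "i \<in> {1..<j}"
        have m: "fourier_coeff (?T i) l = resp e (replicate i ?a) l z" if "i \<in> {1..<j}" for i l
          using less.IH[of i z l] that less.prems zK by (simp add: mode_def \<phi>_def)
        obtain b' S' where S': "controlled b' S' (replicate i ?a)" using ctrl i by (metis atLeastLessThan_iff)
        have "((\<lambda>l. fourier_coeff (?T i) l * fourier_coeff (?T (j - i)) (k - l)) has_sum fourier_coeff (\<lambda>t. ?T i t * ?T (j - i) t) k) UNIV"
        proof (rule fourier_coeff_mult)
          show "continuous_on UNIV (?T i)" "continuous_on UNIV (?T (j - i))"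
            unfolding \<phi>_def by (rule continuous_on_taylor_coeff_real[OF regular_deriv1[OF Rg] \<sigma> r zD])+
          show "?T i (t + 2 * pi) = ?T i t" for t
            using inner_solution_periodic(2)[OF sol D zD st[of t]]
            by (intro taylor_coeff_cong[OF _ r]) (simp add: \<phi>_def)
          show "(\<lambda>l. norm (fourier_coeff (?T i) l)) summable_on UNIV"
            unfolding m[OF i]
          proof (rule summable_on_comparison_test)
            show "(\<lambda>l. 401 / norm z ^ 2 * S' l) summable_on UNIV"
              using S' by (intro summable_on_cmult_right) (simp add: controlled_def)
            show "norm (resp e (replicate i ?a) l z) \<le> 401 / norm z ^ 2 * S' l" for l
              using controlled_resp_le[OF S' e zh, of l] by simp
          qed auto
        qed
        moreover have "j - i \<in> {1..<j}" using i by auto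
        ultimately show "fourier_coeff (\<lambda>t. ?T i t * ?T (j - i) t) k = (\<Sum>\<^sub>\<infinity>l. resp e (replicate i ?a) l z * resp e (replicate (j - i) ?a) (k - l) z)"
          using i by (simp add: m infsumI)
      qed simp
      finally have "\<i> * of_int k * mode r j k (\<psi> z) + mode r j k (\<phi> z)
          = z\<^sup>2 / 8 * (\<Sum>i\<in>{1..<j}. \<Sum>\<^sub>\<infinity>l. resp e (replicate i ?a) l z * resp e (replicate (j - i) ?a) (k - l) z)"
        using eq False by simp
      also have "\<dots> = src e (replicate j ?a) k z"
        unfolding src_step[OF j] length_replicate
        by (intro arg_cong2[where f = "(*)"] refl sum.cong) (auto simp: min_def)
      finally show ?thesis .
    qed
  qed
  have u: "mode r j k (\<psi> z) = sol e k (src e (replicate j ?a) k) z" if k: "k \<noteq> 0" and zK: "z \<in> quadrant e R" for k z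
  proof -
    obtain B where B: "\<And>z. z \<in> D \<Longrightarrow> norm z \<ge> 1 / 2 \<Longrightarrow> norm (mode r j k (\<psi> z)) \<le> B"
      using mode_bounded[OF sol D \<sigma> r \<gamma>(1) k] by blast
    show ?thesis
    proof (rule sol_unique[OF e k controlled_decays[OF S e] half ray_in_quadrant[OF e] _ _ zK])
      fix z assume z: "z \<in> quadrant e R"
      then have "((\<lambda>z. mode r j k (\<psi> z)) has_field_derivative mode r j k (\<phi> z)) (at z)"
        unfolding \<phi>_def using K by (intro mode_deriv1[OF Rg \<sigma> r]) auto
      moreover have "mode r j k (\<phi> z) = src e (replicate j ?a) k z - \<i> * of_int k * mode r j k (\<psi> z)"
        using rhs[OF z, of k] by (simp add: algebra_simps)
      ultimately show "((\<lambda>z. mode r j k (\<psi> z)) has_field_derivative (src e (replicate j ?a) k z - \<i> * of_int k * mode r j k (\<psi> z))) (at z)"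
        by simp
      show "norm (mode r j k (\<psi> z)) \<le> B"
        using B z K half half_norm_ge[OF e, of z] by (meson less_imp_le subsetD)
    qed auto
  qed
  have "mode r j k (\<phi> z) = resp e (replicate j ?a) k z" if "j < N"
  proof -
    have zh: "z \<in> half e" using less.prems half by auto
    have p: "mode r j k (\<phi> z) = src e (replicate j ?a) k z - \<i> * of_int k * mode r j k (\<psi> z)"
      using rhs[OF less.prems(3), of k] by (simp add: algebra_simps)
    show ?thesis
    proof (cases "k = 1")
      case True
      have src0: "src e (replicate j ?a) 1 w = 0" if "w \<in> half e" for w
        using src_harmonics[OF e less.prems(1) N[OF less.prems(1) \<open>j < N\<close>] that] by simp
      have "mode r j 1 (\<psi> z) = 0"
        using u[of 1, OF _ less.prems(3)] sol_zero[OF e _ src0 zh] by simp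
      then show ?thesis using p True src0[OF zh] by (simp add: resp_def)
    next
      case False
      then show ?thesis using p u[OF _ less.prems(3)] by (cases "k = 0") (auto simp: resp_def)
    qed
  qed
  then show ?case using u less.prems by (simp add: \<phi>_def)
qed

lemma solution_mode_one_vanishes:
  assumes sol: "inner_solution \<gamma> D \<sigma> \<mu>0 M \<psi>" and D: "open D" and \<sigma>: "\<sigma> > 0" and r: "0 < r" "r < \<mu>0"
    and \<gamma>: "\<gamma> holomorphic_on strip \<sigma>" "\<And>t. \<gamma> (of_real t) = of_real (g t)"
    and e: "e \<in> {1, -1}" and R: "R \<ge> 1" and K: "quadrant e R \<subseteq> D"
    and a: "l1 (fourier_coeffs g)" and N: "\<And>i. 1 \<le> i \<Longrightarrow> i < N \<Longrightarrow> 1 \<notin> harmonics g i"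
    and j: "j < N" and z: "z \<in> quadrant e R"
  shows "mode r j 1 (\<psi> z) = 0"
proof (cases "j = 0")
  case True
  have zD: "z \<in> D" using z K by auto
  have T0: "taylor_coeff r 0 (\<lambda>\<mu>. deriv (\<lambda>z. \<psi> z (of_real t) \<mu>) z) = 0" for t
    by (rule mode_zeroth_derivative[OF sol D r zD of_real_in_strip[OF \<sigma>]])
  then show ?thesis using mode_equation[OF sol D \<sigma> r zD \<gamma>, of 1 0] True by (simp add: mode_def)
next
  case False
  then have j1: "1 \<le> j" by simp
  have zh: "z \<in> half e" using z quadrant_subset_half[OF R] by auto
  have src0: "src e (replicate j (fourier_coeffs g)) 1 w = 0" if "w \<in> half e" for w
    using src_harmonics[OF e j1 N[OF j1 j] that] by simp
  show ?thesis
    using solution_modes[OF sol D \<sigma> r \<gamma> e R K a N j1 less_imp_le[OF j] z, of 1] sol_zero[OF e _ src0 zh] by simp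
qed

section \<open>The coefficient \<open>\<chi>\<^bsup>[-1]\<^esup>\<close> as a limit\<close>

lemma regular_subset:
  assumes "regular F A B C" "open A'" "A' \<subseteq> A"
  shows "regular F A' B C"
  using assms unfolding regular_def
  by (auto intro: holomorphic_on_subset elim!: continuous_on_subset)

lemma regular_diff:
  assumes "regular F A B C" "regular G A B C"
  shows "regular (\<lambda>x y z. F x y z - G x y z) A B C"
  using assms unfolding regular_def
  by (auto intro!: holomorphic_intros continuous_intros simp: case_prod_unfold)

lemma open_D_minus: "open (D_minus \<rho> \<theta>)"
  unfolding D_minus_def by (intro open_Collect_less continuous_intros)

lemma open_D_plus: "open (D_plus \<rho> \<theta>)"
  unfolding D_plus_def D_minus_def mem_Collect_eq by (intro open_Collect_less continuous_intros)

lemma open_D_in: "open (D_in \<rho> \<theta>)"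
  unfolding D_in_def by (intro open_Int open_D_minus open_D_plus open_Collect_less continuous_intros)

lemma D_in_Im: "\<theta> > 0 \<Longrightarrow> z \<in> D_in \<rho> \<theta> \<Longrightarrow> Im z < - \<rho>"
proof -
  assume \<theta>: "\<theta> > 0" and "z \<in> D_in \<rho> \<theta>"
  then have z: "\<bar>Im z\<bar> > \<theta> * Re z + \<rho>" "\<bar>Im z\<bar> > - (\<theta> * Re z) + \<rho>" "Im z < 0"
    by (auto simp: D_in_def D_plus_def D_minus_def)
  then show ?thesis by linarith
qed

lemma minus_imaginary_in_D_in: "\<rho> > 0 \<Longrightarrow> y > \<rho> \<Longrightarrow> down y \<in> D_in \<rho> \<theta>"
  by (auto simp: D_in_def D_plus_def D_minus_def)

lemma norm_exp_minus_one_le: "norm (exp u - 1) \<le> norm u * exp (norm u)" for u :: complex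
  using Taylor_exp_field[of u 0] by (simp add: mult.commute)

lemma geometric_tail_has_sum:
  fixes x :: real
  assumes "0 \<le> x" "x < 1"
  shows "((\<lambda>k::int. x ^ nat (- k)) has_sum x ^ 2 / (1 - x)) {k. k < - 1}"
proof -
  have "(\<lambda>n. x ^ 2 * x ^ n) sums (x ^ 2 * (1 / (1 - x)))"
    using assms by (intro sums_mult geometric_sums) auto
  moreover have "summable (\<lambda>n. norm (x ^ 2 * x ^ n))"
    using assms by (simp add: norm_mult norm_power summable_geometric)
  ultimately have "((\<lambda>n. x ^ 2 * x ^ n) has_sum x ^ 2 / (1 - x)) UNIV"
    using norm_summable_imp_has_sum by fastforce
  then show ?thesis
  proof (subst has_sum_reindex_bij_witness[where j = "\<lambda>k. nat (- k - 2)" and i = "\<lambda>n. - int n - 2" and T = UNIV and h = "\<lambda>n. x ^ 2 * x ^ n"])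
    fix k :: int assume "k \<in> {k. k < - 1}"
    then have "nat (- k) = 2 + nat (- k - 2)" by auto
    then show "x\<^sup>2 * x ^ nat (- k - 2) = x ^ nat (- k)" by (simp only: power_add)
  qed auto
qed

text \<open>The difference \<open>\<Delta>\<close> is a power series in \<open>e\<^bsup>-iw\<^esup>\<close>, where \<open>w = z - \<tau> + \<mu>\<gg>\<close> is the \<open>phase\<close>.\<close>

context
  fixes \<Delta> \<gg> :: "complex \<Rightarrow> complex \<Rightarrow> complex \<Rightarrow> complex" and chi :: "int \<Rightarrow> complex \<Rightarrow> complex"
    and \<rho> \<theta> \<sigma> \<mu>0 M :: real
  assumes pos: "\<mu>0 > 0" "\<theta> > 0" "\<rho> > 0" "\<sigma> > 0"
    and \<Delta>: "regular \<Delta> (D_in \<rho> \<theta>) (strip \<sigma>) (ball 0 \<mu>0)"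
    and \<gg>: "regular \<gg> (D_in \<rho> \<theta>) (strip \<sigma>) (ball 0 \<mu>0)"
    and per: "\<And>z \<tau> \<mu>. z \<in> D_in \<rho> \<theta> \<Longrightarrow> \<tau> \<in> strip \<sigma> \<Longrightarrow> \<mu> \<in> ball 0 \<mu>0 \<Longrightarrow> \<gg> z (\<tau> + 2 * pi) \<mu> = \<gg> z \<tau> \<mu>"
    and bound: "\<And>z \<tau> \<mu>. z \<in> D_in \<rho> \<theta> \<Longrightarrow> \<tau> \<in> strip \<sigma> \<Longrightarrow> \<mu> \<in> ball 0 \<mu>0 \<Longrightarrow> norm (\<gg> z \<tau> \<mu>) \<le> M / norm z"
    and hol: "\<And>k. k < 0 \<Longrightarrow> chi k holomorphic_on ball 0 \<mu>0"
    and expansion: "\<And>z \<tau> \<mu>. z \<in> D_in \<rho> \<theta> \<Longrightarrow> \<tau> \<in> strip \<sigma> \<Longrightarrow> \<mu> \<in> ball 0 \<mu>0 \<Longrightarrow>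
        ((\<lambda>k. chi k \<mu> * exp (\<i> * of_int k * (z - \<tau> + \<mu> * \<gg> z \<tau> \<mu>))) has_sum \<Delta> z \<tau> \<mu>) {k. k < 0}"
begin

definition phase :: "complex \<Rightarrow> complex \<Rightarrow> real \<Rightarrow> complex" where
  "phase z \<mu> t = z - of_real t + \<mu> * \<gg> z (of_real t) \<mu>"

definition phase' :: "complex \<Rightarrow> complex \<Rightarrow> real \<Rightarrow> complex" where
  "phase' z \<mu> t = 1 - \<mu> * deriv (\<lambda>\<tau>. \<gg> z \<tau> \<mu>) (of_real t)"

lemma real_in_strip: "complex_of_real t \<in> strip \<sigma>"
  by (rule of_real_in_strip[OF pos(4)])

lemma M_nonneg: "M \<ge> 0"
proof -
  have z: "- (\<i> * of_real (\<rho> + 1)) \<in> D_in \<rho> \<theta>" using pos by (intro minus_imaginary_in_D_in) auto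
  have n: "norm (- (\<i> * complex_of_real (\<rho> + 1))) = \<rho> + 1" using pos by (simp add: norm_mult del: of_real_add)
  have "0 \<le> M / norm (- (\<i> * complex_of_real (\<rho> + 1)))"
    using bound[OF z real_in_strip[of 0], of 0] pos norm_ge_zero order_trans by (metis centre_in_ball)
  then show ?thesis unfolding n using pos by (simp add: zero_le_divide_iff)
qed

lemma perturbation_le:
  assumes "z \<in> D_in \<rho> \<theta>" "\<mu> \<in> ball 0 \<mu>0"
  shows "norm (\<mu> * \<gg> z (of_real t) \<mu>) \<le> \<mu>0 * M / \<bar>Im z\<bar>" "norm (\<mu> * \<gg> z (of_real t) \<mu>) \<le> \<mu>0 * M / \<rho>"
proof -
  have Im: "\<bar>Im z\<bar> > \<rho>" using D_in_Im[OF pos(2) assms(1)] pos by linarith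
  have nz: "norm z \<ge> \<bar>Im z\<bar>" by (rule abs_Im_le_cmod)
  have "norm (\<gg> z (of_real t) \<mu>) \<le> M / norm z" by (rule bound[OF assms(1) real_in_strip assms(2)])
  also have "\<dots> \<le> M / \<bar>Im z\<bar>" using Im nz pos(3) by (intro divide_left_mono M_nonneg mult_pos_pos; linarith)
  finally have 1: "norm (\<gg> z (of_real t) \<mu>) \<le> M / \<bar>Im z\<bar>" .
  then have "norm (\<mu> * \<gg> z (of_real t) \<mu>) \<le> \<mu>0 * (M / \<bar>Im z\<bar>)"
    unfolding norm_mult using assms(2) pos by (intro mult_mono) auto
  then show "norm (\<mu> * \<gg> z (of_real t) \<mu>) \<le> \<mu>0 * M / \<bar>Im z\<bar>" by simp
  also have "\<dots> \<le> \<mu>0 * M / \<rho>" using Im pos M_nonneg by (intro divide_left_mono) auto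
  finally show "norm (\<mu> * \<gg> z (of_real t) \<mu>) \<le> \<mu>0 * M / \<rho>" .
qed

lemma Im_phase:
  assumes "z \<in> D_in \<rho> \<theta>" "\<mu> \<in> ball 0 \<mu>0"
  shows "\<bar>Im (phase z \<mu> t) - Im z\<bar> \<le> \<mu>0 * M / \<rho>"
  using order_trans[OF abs_Im_le_cmod perturbation_le(2)[OF assms]] by (simp add: phase_def)

lemma norm_exp_phase: "norm (exp (\<i> * of_int k * phase z \<mu> t)) = exp (- (of_int k * Im (phase z \<mu> t)))"
  by (simp add: norm_exp_eq_Re)

lemma phase_has_derivative:
  assumes "z \<in> D_in \<rho> \<theta>" "\<mu> \<in> ball 0 \<mu>0"
  shows "(phase z \<mu> has_vector_derivative - phase' z \<mu> t) (at t)"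
proof -
  have "((\<lambda>\<tau>. \<gg> z \<tau> \<mu>) has_field_derivative deriv (\<lambda>\<tau>. \<gg> z \<tau> \<mu>) (of_real t)) (at (of_real t))"
    by (rule holomorphic_derivI[OF regularD(6)[OF \<gg> assms] open_strip real_in_strip])
  then have "((\<lambda>\<tau>. z - \<tau> + \<mu> * \<gg> z \<tau> \<mu>) has_field_derivative - phase' z \<mu> t) (at (of_real t))"
    unfolding phase'_def by (auto intro!: derivative_eq_intros)
  then show ?thesis unfolding phase_def[abs_def] by (rule has_vector_derivative_real_field)
qed

lemma continuous_on_phase:
  assumes "z \<in> D_in \<rho> \<theta>" "\<mu> \<in> ball 0 \<mu>0"
  shows "continuous_on S (phase z \<mu>)" "continuous_on S (phase' z \<mu>)"
proof -
  show "continuous_on S (phase z \<mu>)"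
    unfolding phase_def[abs_def]
    by (intro continuous_intros regular_compose[OF \<gg>]) (use assms real_in_strip in auto)
  show "continuous_on S (phase' z \<mu>)"
    unfolding phase'_def[abs_def]
    by (intro continuous_intros regular_compose[OF regular_deriv2[OF \<gg>]]) (use assms real_in_strip in auto)
qed

text \<open>The map \<open>t \<mapsto> w(t)\<close> is a reparametrization of the circle, in which the exponentials of \<open>w\<close> remain
  orthogonal: \<open>e\<^bsup>ijw\<^esup>w'\<close> is the derivative of a periodic function unless \<open>j = 0\<close>.\<close>

lemma phase_orthogonality:
  assumes z: "z \<in> D_in \<rho> \<theta>" and \<mu>: "\<mu> \<in> ball 0 \<mu>0"
  shows "fourier_coeff (\<lambda>t. exp (\<i> * of_int j * phase z \<mu> t) * phase' z \<mu> t) 0 = (if j = 0 then 1 else 0)"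
proof (cases "j = 0")
  case True
  let ?h = "\<lambda>t. \<mu> * \<gg> z (of_real t) \<mu>"
  let ?h' = "\<lambda>t. \<mu> * deriv (\<lambda>\<tau>. \<gg> z \<tau> \<mu>) (complex_of_real t)"
  have ch: "continuous_on S ?h'" for S
    by (intro continuous_intros regular_compose[OF regular_deriv2[OF \<gg>]]) (use z \<mu> real_in_strip in auto)
  have "fourier_coeff ?h' 0 = \<i> * of_int 0 * fourier_coeff ?h 0"
  proof (rule fourier_coeff_deriv)
    have "((\<lambda>\<tau>. \<gg> z \<tau> \<mu>) has_field_derivative deriv (\<lambda>\<tau>. \<gg> z \<tau> \<mu>) (of_real t)) (at (of_real t))" for t
      by (rule holomorphic_derivI[OF regularD(6)[OF \<gg> z \<mu>] open_strip real_in_strip])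
    then show "(?h has_vector_derivative ?h' t) (at t)" for t
      by (intro has_vector_derivative_real_field DERIV_cmult)
    show "?h (2 * pi) = ?h 0" using per[OF z real_in_strip[of 0] \<mu>] by simp
  qed (rule ch)
  moreover have "fourier_coeff (\<lambda>t. 1) 0 = 1" using fourier_coeff_exp[of 0 0] by simp
  ultimately show ?thesis
    using True fourier_coeff_diff[OF continuous_on_const ch, of 1 0] by (simp add: phase'_def)
next
  case False
  let ?h = "\<lambda>t. exp (\<i> * of_int j * phase z \<mu> t)"
  let ?h' = "\<lambda>t. - (\<i> * of_int j) * (exp (\<i> * of_int j * phase z \<mu> t) * phase' z \<mu> t)"
  have "fourier_coeff ?h' 0 = \<i> * of_int 0 * fourier_coeff ?h 0"
  proof (rule fourier_coeff_deriv)
    show "(?h has_vector_derivative ?h' t) (at t)" for t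
    proof -
      have "((\<lambda>w. exp (\<i> * of_int j * w)) has_field_derivative exp (\<i> * of_int j * phase z \<mu> t) * (\<i> * of_int j)) (at (phase z \<mu> t))"
        by (auto intro!: derivative_eq_intros)
      from field_vector_diff_chain_at[OF phase_has_derivative[OF z \<mu>] this]
      show ?thesis by (simp add: o_def mult_ac)
    qed
    show "continuous_on UNIV ?h'" by (intro continuous_intros continuous_on_phase z \<mu>)
    have ph: "phase z \<mu> (2 * pi) = phase z \<mu> 0 - 2 * pi" using per[OF z real_in_strip[of 0] \<mu>] by (simp add: phase_def)
    have "\<i> * of_int j * phase z \<mu> (2 * pi) = \<i> * of_int j * phase z \<mu> 0 + (2 * of_int (- j) * pi) * \<i>"
      unfolding ph by (simp add: algebra_simps)
    then show "?h (2 * pi) = ?h 0" using exp_integer_2pi[of "of_int (- j)"] by (simp only: exp_add) simp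
  qed
  then show ?thesis using False unfolding fourier_coeff_cmult by simp
qed

lemma expansion_phase:
  assumes "z \<in> D_in \<rho> \<theta>" "\<mu> \<in> ball 0 \<mu>0"
  shows "((\<lambda>k. chi k \<mu> * exp (\<i> * of_int k * phase z \<mu> t)) has_sum \<Delta> z (of_real t) \<mu>) {k. k < 0}"
  using expansion[OF assms(1) real_in_strip assms(2)] by (simp add: phase_def)

text \<open>The imaginary parts of \<open>w\<close> and \<open>z\<close> differ by at most \<open>\<mu>\<^sub>0M/\<rho>\<close>. At this depth \<open>w\<close> thus always lies below its values at
  \<open>z = -i(\<rho> + 1)\<close>, and the convergence of the series there implies uniform convergence.\<close>

definition depth :: real where
  "depth = \<rho> + 1 + 2 * (\<mu>0 * M / \<rho>)"

text \<open>The series is integrated against \<open>e\<^bsup>-ilw\<^esup>\<close> along the circle at the depth where it converges uniformly.\<close>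

lemma coefficient_formula:
  assumes \<mu>: "\<mu> \<in> ball 0 \<mu>0" and l: "l < 0"
  defines "z0 \<equiv> - (\<i> * of_real depth)"
  shows "chi l \<mu> = fourier_coeff (\<lambda>t. \<Delta> z0 (of_real t) \<mu> * (exp (- (\<i> * of_int l * phase z0 \<mu> t)) * phase' z0 \<mu> t)) 0"
proof -
  define c where "c = \<mu>0 * M / \<rho>"
  have c0: "c \<ge> 0" using pos M_nonneg by (simp add: c_def)
  define z1 where "z1 = - (\<i> * complex_of_real (\<rho> + 1))"
  have z0: "z0 \<in> D_in \<rho> \<theta>" and z1: "z1 \<in> D_in \<rho> \<theta>"
    unfolding z0_def z1_def using pos c0 by (auto intro!: minus_imaginary_in_D_in simp: depth_def c_def[symmetric] simp del: of_real_add)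
  let ?E = "\<lambda>t. exp (- (\<i> * of_int l * phase z0 \<mu> t)) * phase' z0 \<mu> t"
  let ?f = "\<lambda>k t. chi k \<mu> * exp (\<i> * of_int k * phase z0 \<mu> t)"
  have cE: "continuous_on S ?E" and cf: "continuous_on S (?f k)" for S k
    by (intro continuous_intros continuous_on_phase z0 \<mu>)+
  have "(\<lambda>k. chi k \<mu> * exp (\<i> * of_int k * phase z1 \<mu> 0)) summable_on {k. k < 0}"
    using expansion_phase[OF z1 \<mu>, of 0] by (rule has_sum_imp_summable)
  then have sM: "(\<lambda>k. norm (chi k \<mu> * exp (\<i> * of_int k * phase z1 \<mu> 0))) summable_on {k. k < 0}"
    by (simp add: summable_on_iff_abs_summable_on_complex)
  have ul: "uniform_limit {0..2*pi} (\<lambda>A t. \<Sum>k\<in>A. ?f k t) (\<lambda>t. \<Delta> z0 (of_real t) \<mu>) (finite_subsets_at_top {k. k < 0})"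
  proof (rule Weierstrass_m_test_general'[OF _ expansion_phase[OF z0 \<mu>] sM])
    fix k t assume "k \<in> {k::int. k < 0}"
    then have k: "real_of_int k \<le> 0" by simp
    have "Im (phase z0 \<mu> t) \<le> Im (phase z1 \<mu> 0)"
      using Im_phase[OF z0 \<mu>, of t] Im_phase[OF z1 \<mu>, of 0] by (simp add: z0_def z1_def depth_def c_def[symmetric])
    then have "- (of_int k * Im (phase z0 \<mu> t)) \<le> - (of_int k * Im (phase z1 \<mu> 0))"
      using mult_left_mono_neg[OF _ k] by simp
    then show "norm (?f k t) \<le> norm (chi k \<mu> * exp (\<i> * of_int k * phase z1 \<mu> 0))"
      unfolding norm_mult norm_exp_phase by (intro mult_left_mono) auto
  qed
  have ul2: "uniform_limit {0..2*pi} (\<lambda>A t. (\<Sum>k\<in>A. ?f k t) * ?E t) (\<lambda>t. \<Delta> z0 (of_real t) \<mu> * ?E t) (finite_subsets_at_top {k. k < 0})"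
  proof (rule uniform_lim_mult[OF ul uniform_limit_const])
    have "continuous_on {0..2*pi} (\<lambda>t. \<Delta> z0 (of_real t) \<mu>)"
      by (rule regular_compose[OF \<Delta>]) (use z0 \<mu> real_in_strip in \<open>auto intro!: continuous_intros\<close>)
    then show "bounded ((\<lambda>t. \<Delta> z0 (of_real t) \<mu>) ` {0..2*pi})"
      by (intro compact_imp_bounded compact_continuous_image) auto
    show "bounded (?E ` {0..2*pi})" by (intro compact_imp_bounded compact_continuous_image cE) auto
  qed
  have "((\<lambda>A. fourier_coeff (\<lambda>t. (\<Sum>k\<in>A. ?f k t) * ?E t) 0) \<longlongrightarrow> fourier_coeff (\<lambda>t. \<Delta> z0 (of_real t) \<mu> * ?E t) 0) (finite_subsets_at_top {k. k < 0})"
    by (rule fourier_coeff_uniform_limit(2)[OF ul2]) (auto intro!: continuous_on_mult continuous_on_sum cE cf)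
  moreover have "\<forall>\<^sub>F A in finite_subsets_at_top {k. k < 0}. fourier_coeff (\<lambda>t. (\<Sum>k\<in>A. ?f k t) * ?E t) 0 = chi l \<mu>"
  proof -
    have "\<forall>\<^sub>F A in finite_subsets_at_top {k. k < 0}. finite A \<and> l \<in> A"
      using l by (auto simp: eventually_finite_subsets_at_top intro!: exI[of _ "{l}"])
    then show ?thesis
    proof eventually_elim
      case (elim A)
      have "(\<lambda>t. (\<Sum>k\<in>A. ?f k t) * ?E t) = (\<lambda>t. \<Sum>k\<in>A. chi k \<mu> * (exp (\<i> * of_int (k - l) * phase z0 \<mu> t) * phase' z0 \<mu> t))"
      proof
        fix t
        have "?f k t * ?E t = chi k \<mu> * (exp (\<i> * of_int (k - l) * phase z0 \<mu> t) * phase' z0 \<mu> t)" for k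
          by (simp add: left_diff_distrib right_diff_distrib exp_diff exp_minus divide_inverse mult_ac)
        then show "(\<Sum>k\<in>A. ?f k t) * ?E t = (\<Sum>k\<in>A. chi k \<mu> * (exp (\<i> * of_int (k - l) * phase z0 \<mu> t) * phase' z0 \<mu> t))"
          by (simp only: sum_distrib_right)
      qed
      then have "fourier_coeff (\<lambda>t. (\<Sum>k\<in>A. ?f k t) * ?E t) 0
          = fourier_coeff (\<lambda>t. \<Sum>k\<in>A. chi k \<mu> * (exp (\<i> * of_int (k - l) * phase z0 \<mu> t) * phase' z0 \<mu> t)) 0" by simp
      also have "\<dots> = (\<Sum>k\<in>A. fourier_coeff (\<lambda>t. chi k \<mu> * (exp (\<i> * of_int (k - l) * phase z0 \<mu> t) * phase' z0 \<mu> t)) 0)"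
        using elim by (intro fourier_coeff_sum continuous_intros continuous_on_phase z0 \<mu>) auto
      also have "\<dots> = (\<Sum>k\<in>A. chi k \<mu> * (if k = l then 1 else 0))"
        unfolding fourier_coeff_cmult phase_orthogonality[OF z0 \<mu>] by simp
      also have "\<dots> = chi l \<mu>" using elim by (simp add: if_distrib cong: if_cong)
      finally show ?case .
    qed
  qed
  then have "((\<lambda>A. fourier_coeff (\<lambda>t. (\<Sum>k\<in>A. ?f k t) * ?E t) 0) \<longlongrightarrow> chi l \<mu>) (finite_subsets_at_top {k. k < 0})"
    by (rule tendsto_eventually)
  ultimately show ?thesis using tendsto_unique[OF finite_subsets_at_top_neq_bot] by blast
qed

text \<open>The formula for the coefficients is an integral over a fixed circle, so that the bound is uniform in \<open>\<mu>\<close>.\<close>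

lemma coefficient_bound:
  assumes r: "0 < r" "r < \<mu>0"
  shows "\<exists>C\<ge>0. \<forall>\<mu>\<in>cball 0 r. \<forall>l<0. norm (chi l \<mu>) \<le> C * exp (of_int (- l) * (depth + \<mu>0 * M / \<rho>))"
proof -
  define z0 where "z0 = - (\<i> * complex_of_real depth)"
  have c0: "\<mu>0 * M / \<rho> \<ge> 0" using pos M_nonneg by simp
  have z0: "z0 \<in> D_in \<rho> \<theta>" unfolding z0_def using pos c0 by (intro minus_imaginary_in_D_in) (auto simp: depth_def)
  have "continuous_on (cball 0 r \<times> {0..2*pi}) (\<lambda>p. \<Delta> z0 (of_real (snd p)) (fst p) * phase' z0 (fst p) (snd p))"
    unfolding phase'_def
    by (intro continuous_intros regular_compose[OF \<Delta>] regular_compose[OF regular_deriv2[OF \<gg>]])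
      (use z0 r real_in_strip in auto)
  then have "bounded ((\<lambda>p. \<Delta> z0 (of_real (snd p)) (fst p) * phase' z0 (fst p) (snd p)) ` (cball 0 r \<times> {0..2*pi}))"
    by (intro compact_imp_bounded compact_continuous_image compact_Times) auto
  then obtain C where C: "C > 0" "\<And>\<mu> t. \<mu> \<in> cball 0 r \<Longrightarrow> t \<in> {0..2*pi} \<Longrightarrow> norm (\<Delta> z0 (of_real t) \<mu> * phase' z0 \<mu> t) \<le> C"
    unfolding bounded_pos by fastforce
  show ?thesis
  proof (intro exI[of _ C] conjI ballI allI impI)
    fix \<mu> :: complex and l :: int assume \<mu>: "\<mu> \<in> cball 0 r" and l: "l < 0"
    then have \<mu>': "\<mu> \<in> ball 0 \<mu>0" using r by auto
    show "norm (chi l \<mu>) \<le> C * exp (of_int (- l) * (depth + \<mu>0 * M / \<rho>))"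
      unfolding coefficient_formula[OF \<mu>' l] z0_def[symmetric]
    proof (rule norm_fourier_coeff_le)
      show "continuous_on {0..2 * pi} (\<lambda>t. \<Delta> z0 (complex_of_real t) \<mu> * (exp (- (\<i> * complex_of_int l * phase z0 \<mu> t)) * phase' z0 \<mu> t))"
        by (intro continuous_intros regular_compose[OF \<Delta>] continuous_on_phase z0 \<mu>') (use z0 \<mu>' real_in_strip in auto)
      fix t :: real assume t: "t \<in> {0..2*pi}"
      have "norm (exp (- (\<i> * of_int l * phase z0 \<mu> t))) = exp (of_int (- l) * (- Im (phase z0 \<mu> t)))"
        by (simp add: norm_exp_eq_Re)
      also have "\<dots> \<le> exp (of_int (- l) * (depth + \<mu>0 * M / \<rho>))"
        using Im_phase[OF z0 \<mu>', of t] l unfolding exp_le_cancel_iff by (intro mult_left_mono) (auto simp: z0_def)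
      finally have "norm (\<Delta> z0 (of_real t) \<mu> * phase' z0 \<mu> t) * norm (exp (- (\<i> * of_int l * phase z0 \<mu> t))) \<le> C * exp (of_int (- l) * (depth + \<mu>0 * M / \<rho>))"
        using C \<mu> t by (intro mult_mono) auto
      then show "norm (\<Delta> z0 (complex_of_real t) \<mu> * (exp (- (\<i> * complex_of_int l * phase z0 \<mu> t)) * phase' z0 \<mu> t)) \<le> C * exp (of_int (- l) * (depth + \<mu>0 * M / \<rho>))"
        by (simp add: norm_mult mult_ac)
    qed
  qed (use C in auto)
qed

text \<open>The terms \<open>k \<le> -2\<close> form a geometric tail, of the order of \<open>e\<^bsup>2 Im z\<^esup>\<close>. In the term \<open>k = -1\<close> the
  factor \<open>e\<^bsup>-i\<mu>\<gg>\<^esup>\<close> is \<open>1 + O(1/|z|)\<close>.\<close>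

lemma leading_term:
  assumes r: "0 < r" "r < \<mu>0"
  shows "\<exists>K L Y0. 0 < Y0 \<and> (\<forall>z\<in>D_in \<rho> \<theta>. - Im z \<ge> Y0 \<longrightarrow> (\<forall>\<mu>\<in>cball 0 r.
     norm (exp (\<i> * z) * fourier_coeff (\<lambda>t. \<Delta> z (of_real t) \<mu>) 1 - chi (-1) \<mu>) \<le> K / (- Im z) + L * exp (Im z)))"
proof -
  define c where "c = \<mu>0 * M / \<rho>"
  have c0: "c \<ge> 0" using pos M_nonneg by (simp add: c_def)
  define B where "B = depth + c"
  have B0: "B > 0" using pos c0 by (simp add: B_def depth_def c_def[symmetric])
  obtain C where C: "C \<ge> 0" "\<And>\<mu> l. \<mu> \<in> cball 0 r \<Longrightarrow> l < 0 \<Longrightarrow> norm (chi l \<mu>) \<le> C * exp (of_int (- l) * B)"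
    using coefficient_bound[OF r] unfolding B_def c_def by blast
  show ?thesis
  proof (rule exI[of _ "C * exp B * (\<mu>0 * M * exp c)"], rule exI[of _ "2 * C * exp (2 * (B + c))"], rule exI[of _ "B + c + 1"],
      intro conjI ballI impI)
    show "0 < B + c + 1" using B0 c0 by simp
    fix z \<mu> :: complex assume z: "z \<in> D_in \<rho> \<theta>" "B + c + 1 \<le> - Im z" and \<mu>: "\<mu> \<in> cball 0 r"
    then have \<mu>': "\<mu> \<in> ball 0 \<mu>0" using r by auto
    define Y where "Y = - Im z"
    have Y: "Y \<ge> B + c + 1" using z by (simp add: Y_def)
    have pt: "norm (exp (\<i> * z) * \<Delta> z (of_real t) \<mu> - chi (-1) \<mu> * exp (\<i> * of_int 1 * of_real t)) \<le>
        C * exp B * (\<mu>0 * M * exp c) / Y + 2 * C * exp (2 * (B + c)) * exp (- Y)" for t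
    proof -
      define f where "f k = chi k \<mu> * exp (\<i> * of_int k * phase z \<mu> t)" for k
      have hs: "(f has_sum \<Delta> z (of_real t) \<mu>) {k. k < 0}"
        unfolding f_def by (rule expansion_phase[OF z(1) \<mu>'])
      have "f summable_on {k. k < -1}"
        by (rule summable_on_subset_banach[OF has_sum_imp_summable[OF hs]]) auto
      then obtain T where T: "(f has_sum T) {k. k < -1}" by (auto simp: summable_on_def)
      have "insert (-1) {k. k < -1} = {k::int. k < 0}" by auto
      then have \<Delta>_eq: "\<Delta> z (of_real t) \<mu> = f (-1) + T"
        using has_sum_insert[OF _ T, of "-1"] has_sum_unique[OF hs] by simp
      define x where "x = exp (B + c - Y)"
      have x: "0 < x" "x \<le> 1 / 2"
      proof -
        have "2 \<le> exp (1::real)" using exp_ge_add_one_self[of 1] by simp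
        then have "exp (- 1 :: real) \<le> 1 / 2" by (simp add: exp_minus field_simps)
        moreover have "x \<le> exp (- 1)" using Y by (simp add: x_def)
        ultimately show "x \<le> 1 / 2" by linarith
      qed (simp add: x_def)
      have "norm T \<le> C * (x ^ 2 / (1 - x))"
      proof (rule norm_infsum_le[OF T])
        show "((\<lambda>k. C * x ^ nat (- k)) has_sum C * (x ^ 2 / (1 - x))) {k. k < -1}"
          using x by (intro has_sum_cmult_right geometric_tail_has_sum) auto
        fix k :: int assume "k \<in> {k. k < -1}"
        then have k: "k < 0" by simp
        have "norm (f k) \<le> (C * exp (of_int (- k) * B)) * exp (of_int (- k) * (c - Y))"
          unfolding f_def norm_mult norm_exp_phase
        proof (intro mult_mono C(2)[OF \<mu> k])
          have "of_int (- k) * Im (phase z \<mu> t) \<le> of_int (- k) * (c - Y)"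
            using Im_phase[OF z(1) \<mu>', of t] k by (intro mult_left_mono) (auto simp: c_def Y_def)
          then show "exp (- (of_int k * Im (phase z \<mu> t))) \<le> exp (of_int (- k) * (c - Y))" by simp
        qed (use C in auto)
        also have "\<dots> = C * exp (of_int (- k) * (B + c - Y))"
          by (simp add: exp_add[symmetric] algebra_simps)
        also have "\<dots> = C * x ^ nat (- k)"
          using k by (simp add: x_def exp_of_nat_mult[symmetric])
        finally show "norm (f k) \<le> C * x ^ nat (- k)" .
      qed
      also have "C * (x ^ 2 / (1 - x)) \<le> C * (x ^ 2 / (1 / 2))"
        using x by (intro mult_left_mono divide_left_mono C(1)) auto
      finally have T_le: "norm T \<le> 2 * C * x ^ 2" by simp
      have eY: "norm (exp (\<i> * z)) = exp Y" by (simp add: norm_exp_eq_Re Y_def)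
      have "norm (exp (\<i> * z) * T) \<le> exp Y * (2 * C * x ^ 2)" unfolding norm_mult eY using T_le by simp
      also have "\<dots> = 2 * C * exp (2 * (B + c)) * exp (- Y)"
      proof -
        have "exp Y * x ^ 2 = exp (2 * (B + c)) * exp (- Y)"
          unfolding x_def power2_eq_square by (simp add: exp_add[symmetric] algebra_simps)
        then show ?thesis by (simp add: mult_ac)
      qed
      finally have 1: "norm (exp (\<i> * z) * T) \<le> 2 * C * exp (2 * (B + c)) * exp (- Y)" .
      define p where "p = \<mu> * \<gg> z (of_real t) \<mu>"
      have p: "norm p \<le> \<mu>0 * M / Y" "norm p \<le> c"
        using perturbation_le[OF z(1) \<mu>', of t] Y B0 c0 by (auto simp: p_def c_def Y_def)
      have "exp (\<i> * z) * f (-1) = chi (-1) \<mu> * exp (\<i> * of_int 1 * of_real t) * exp (- (\<i> * p))"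
        unfolding f_def phase_def p_def by (simp add: exp_add[symmetric] exp_diff[symmetric] algebra_simps)
      then have "exp (\<i> * z) * \<Delta> z (of_real t) \<mu> - chi (-1) \<mu> * exp (\<i> * of_int 1 * of_real t)
          = chi (-1) \<mu> * exp (\<i> * of_int 1 * of_real t) * (exp (- (\<i> * p)) - 1) + exp (\<i> * z) * T"
        unfolding \<Delta>_eq by (simp add: algebra_simps)
      also have "norm \<dots> \<le> norm (chi (-1) \<mu>) * norm (exp (- (\<i> * p)) - 1) + norm (exp (\<i> * z) * T)"
        by (rule order_trans[OF norm_triangle_ineq]) (simp add: norm_mult norm_exp_eq_Re)
      also have "\<dots> \<le> (C * exp B) * (\<mu>0 * M / Y * exp c) + 2 * C * exp (2 * (B + c)) * exp (- Y)"
      proof (intro add_mono 1 mult_mono)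
        show "norm (chi (-1) \<mu>) \<le> C * exp B" using C(2)[OF \<mu>, of "-1"] by simp
        have "norm (exp (- (\<i> * p)) - 1) \<le> norm p * exp (norm p)"
          using norm_exp_minus_one_le[of "- (\<i> * p)"] by (simp add: norm_mult)
        also have "\<dots> \<le> \<mu>0 * M / Y * exp c" using p order_trans[OF norm_ge_zero p(1)] by (intro mult_mono) auto
        finally show "norm (exp (- (\<i> * p)) - 1) \<le> \<mu>0 * M / Y * exp c" .
      qed (use C in auto)
      finally show ?thesis by (simp add: mult_ac)
    qed
    have cd: "continuous_on {0..2*pi} (\<lambda>t. exp (\<i> * z) * \<Delta> z (of_real t) \<mu>)"
      by (intro continuous_intros regular_compose[OF \<Delta>]) (use z \<mu>' real_in_strip in auto)
    have ce: "continuous_on {0..2*pi} (\<lambda>t. chi (-1) \<mu> * exp (\<i> * of_int 1 * complex_of_real t))"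
      by (intro continuous_intros)
    have "fourier_coeff (\<lambda>t. exp (\<i> * z) * \<Delta> z (of_real t) \<mu> - chi (-1) \<mu> * exp (\<i> * of_int 1 * of_real t)) 1
        = exp (\<i> * z) * fourier_coeff (\<lambda>t. \<Delta> z (of_real t) \<mu>) 1 - chi (-1) \<mu>"
      unfolding fourier_coeff_diff[OF cd ce] fourier_coeff_cmult fourier_coeff_exp by simp
    moreover have "norm (fourier_coeff (\<lambda>t. exp (\<i> * z) * \<Delta> z (of_real t) \<mu> - chi (-1) \<mu> * exp (\<i> * of_int 1 * of_real t)) 1)
        \<le> C * exp B * (\<mu>0 * M * exp c) / Y + 2 * C * exp (2 * (B + c)) * exp (- Y)"
      by (rule norm_fourier_coeff_le[OF continuous_on_diff[OF cd ce] pt])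
    ultimately show "norm (exp (\<i> * z) * fourier_coeff (\<lambda>t. \<Delta> z (of_real t) \<mu>) 1 - chi (-1) \<mu>)
        \<le> C * exp B * (\<mu>0 * M * exp c) / (- Im z) + 2 * C * exp (2 * (B + c)) * exp (Im z)"
      by (simp add: Y_def)
  qed
qed

text \<open>The convergence in \<open>leading_term\<close> is uniform on the circle \<open>|\<mu>| = r\<close>, over which the Taylor coefficients
  are integrals.\<close>

theorem coefficient_limit:
  assumes r: "0 < r" "r < \<mu>0"
  shows "((\<lambda>z. exp (\<i> * z) * mode r j 1 (\<Delta> z)) \<longlongrightarrow> (deriv ^^ j) (chi (-1)) 0 / fact j) (to_minus_i_infinity \<rho> \<theta>)"
proof -
  obtain K L Y0 where Y0: "0 < Y0" and le: "\<And>z \<mu>. z \<in> D_in \<rho> \<theta> \<Longrightarrow> - Im z \<ge> Y0 \<Longrightarrow> \<mu> \<in> cball 0 r \<Longrightarrow>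
     norm (exp (\<i> * z) * fourier_coeff (\<lambda>t. \<Delta> z (of_real t) \<mu>) 1 - chi (-1) \<mu>) \<le> K / (- Im z) + L * exp (Im z)"
    using leading_term[OF r] by blast
  have chi: "chi (-1) holomorphic_on ball 0 \<mu>0" by (rule hol) simp
  have eq: "taylor_coeff r j (chi (-1)) = (deriv ^^ j) (chi (-1)) 0 / fact j"
    by (rule taylor_coeff_eq[OF chi r])
  have bd: "norm (exp (\<i> * z) * mode r j 1 (\<Delta> z) - (deriv ^^ j) (chi (-1)) 0 / fact j) \<le> (K / (- Im z) + L * exp (Im z)) / r ^ j"
    if z: "z \<in> D_in \<rho> \<theta>" "- Im z \<ge> Y0" for z
  proof -
    let ?h = "\<lambda>\<mu>. fourier_coeff (\<lambda>t. \<Delta> z (of_real t) \<mu>) 1"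
    note m = mode_eq_higher_deriv[OF \<Delta> pos(4) r z(1), where k = 1]
    have "mode r j 1 (\<Delta> z) = taylor_coeff r j ?h" using m(2) taylor_coeff_eq[OF m(1) r] by simp
    then have "exp (\<i> * z) * mode r j 1 (\<Delta> z) - (deriv ^^ j) (chi (-1)) 0 / fact j
        = taylor_coeff r j (\<lambda>\<mu>. exp (\<i> * z) * ?h \<mu> - chi (-1) \<mu>)"
      using taylor_coeff_add(2)[OF holomorphic_on_mult[OF holomorphic_on_const m(1)] chi r, of j "exp (\<i> * z)"]
      by (simp add: eq taylor_coeff_cmult)
    also have "norm \<dots> \<le> (K / (- Im z) + L * exp (Im z)) / r ^ j"
    proof (rule norm_taylor_coeff_le[OF _ r])
      show "(\<lambda>\<mu>. exp (\<i> * z) * ?h \<mu> - chi (-1) \<mu>) holomorphic_on ball 0 \<mu>0"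
        by (intro holomorphic_intros m(1) chi)
    qed (use le[OF z] in simp)
    finally show ?thesis .
  qed
  have F: "filterlim Im at_bot (to_minus_i_infinity \<rho> \<theta>)"
    unfolding to_minus_i_infinity_def by (rule filterlim_mono[OF filterlim_filtercomap]) auto
  have ev: "\<forall>\<^sub>F z in to_minus_i_infinity \<rho> \<theta>. z \<in> D_in \<rho> \<theta> \<and> - Im z \<ge> Y0"
  proof -
    have "\<forall>\<^sub>F z in to_minus_i_infinity \<rho> \<theta>. z \<in> D_in \<rho> \<theta>"
      unfolding to_minus_i_infinity_def by (simp add: eventually_inf_principal)
    moreover have "\<forall>\<^sub>F z in to_minus_i_infinity \<rho> \<theta>. Im z \<le> - Y0"
      using F by (auto simp: filterlim_at_bot)
    ultimately show ?thesis by eventually_elim auto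
  qed
  have lim: "((\<lambda>y::real. (K / (- y) + L * exp y) / r ^ j) \<longlongrightarrow> 0) at_bot"
  proof -
    have 1: "((\<lambda>y::real. K / (- y)) \<longlongrightarrow> 0) at_bot"
      by (rule tendsto_divide_0[OF tendsto_const]) (intro filterlim_at_top_imp_at_infinity filterlim_uminus_at_top_at_bot)
    have 2: "((\<lambda>y::real. L * exp y) \<longlongrightarrow> 0) at_bot" by (rule tendsto_mult_right_zero[OF exp_at_bot])
    show ?thesis using tendsto_divide[OF tendsto_add[OF 1 2] tendsto_const[of "r ^ j"]] r by simp
  qed
  have "((\<lambda>z. exp (\<i> * z) * mode r j 1 (\<Delta> z) - (deriv ^^ j) (chi (-1)) 0 / fact j) \<longlongrightarrow> 0) (to_minus_i_infinity \<rho> \<theta>)"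
    by (rule Lim_null_comparison[OF _ filterlim_compose[OF lim F]]) (use ev in eventually_elim, use bd in auto)
  then show ?thesis by (simp add: LIM_zero_iff)
qed

end

lemma minus_imaginary_to_minus_i_infinity:
  assumes "\<rho> > 0"
  shows "filterlim (\<lambda>y::real. down y) (to_minus_i_infinity \<rho> \<theta>) at_top"
  unfolding to_minus_i_infinity_def
proof (rule filterlim_inf[THEN iffD2], rule conjI)
  show "filterlim (\<lambda>y::real. down y) (filtercomap Im at_bot) at_top"
    unfolding filterlim_filtercomap_iff by (simp add: o_def filterlim_uminus_at_bot_at_top)
  have "\<forall>\<^sub>F y in at_top. down y \<in> D_in \<rho> \<theta>"
    using eventually_gt_at_top[of \<rho>] by eventually_elim (rule minus_imaginary_in_D_in[OF assms])
  then show "filterlim (\<lambda>y::real. down y) (principal (D_in \<rho> \<theta>)) at_top"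
    by (simp add: filterlim_principal)
qed

lemma taylor_remainder_bigo:
  assumes f: "f holomorphic_on ball 0 R" and R: "R > 0" and z: "\<And>j. j < n \<Longrightarrow> (deriv ^^ j) f 0 = 0"
  shows "(\<lambda>\<mu>. f \<mu> - (deriv ^^ n) f 0 / fact n * \<mu> ^ n) \<in> O[nhds 0](\<lambda>\<mu>. \<mu> ^ (n + 1))"
proof -
  define S where "S = cball (0::complex) (R / 2)"
  have S: "S \<subseteq> ball 0 R" using R by (auto simp: S_def)
  have h: "(deriv ^^ i) f holomorphic_on ball 0 R" for i by (rule holomorphic_higher_deriv[OF f open_ball])
  have "bounded ((deriv ^^ Suc n) f ` S)"
    by (intro compact_imp_bounded compact_continuous_image holomorphic_on_imp_continuous_on[OF holomorphic_on_subset[OF h S]]) (simp add: S_def)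
  then obtain B where B: "\<And>x. x \<in> S \<Longrightarrow> norm ((deriv ^^ Suc n) f x) \<le> B" unfolding bounded_iff by blast
  have sum: "(\<Sum>i\<le>n. (deriv ^^ i) f 0 * (x - 0) ^ i / fact i) = (deriv ^^ n) f 0 / fact n * x ^ n" for x :: complex
  proof -
    have "(\<Sum>i\<le>n. (deriv ^^ i) f 0 * (x - 0) ^ i / fact i) = (\<Sum>i\<in>{n}. (deriv ^^ i) f 0 * (x - 0) ^ i / fact i)"
      by (rule sum.mono_neutral_right) (use z in auto)
    then show ?thesis by simp
  qed
  have le: "norm (f x - (deriv ^^ n) f 0 / fact n * x ^ n) \<le> B / fact n * norm (x ^ (n + 1))" if x: "x \<in> S" for x
  proof -
    have "norm ((deriv ^^ 0) f x - (\<Sum>i\<le>n. (deriv ^^ i) f 0 * (x - 0) ^ i / fact i)) \<le> B * norm (x - 0) ^ Suc n / fact n"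
    proof (rule complex_Taylor[where S = S])
      show "((deriv ^^ i) f has_field_derivative (deriv ^^ Suc i) f x) (at x within S)" if "x \<in> S" for i x
        using holomorphic_derivI[OF h open_ball, of x] that S by (auto intro: has_field_derivative_at_within)
    qed (use B x R in \<open>auto simp: S_def\<close>)
    then show ?thesis unfolding sum by (simp add: norm_power norm_mult)
  qed
  show ?thesis
  proof (rule landau_o.bigI[of "\<bar>B\<bar> / fact n + 1"])
    have "\<forall>\<^sub>F x in nhds 0. x \<in> ball (0::complex) (R / 2)"
      by (rule eventually_nhds_in_open) (use R in auto)
    then show "\<forall>\<^sub>F x in nhds 0. norm (f x - (deriv ^^ n) f 0 / fact n * x ^ n) \<le> (\<bar>B\<bar> / fact n + 1) * norm (x ^ (n + 1))"
    proof eventually_elim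
      case (elim x)
      have "norm (f x - (deriv ^^ n) f 0 / fact n * x ^ n) \<le> B / fact n * norm (x ^ (n + 1))"
        by (rule le) (use elim in \<open>auto simp: S_def\<close>)
      also have "\<dots> \<le> (\<bar>B\<bar> / fact n + 1) * norm (x ^ (n + 1))"
      proof (rule mult_right_mono)
        have "B / fact n \<le> \<bar>B\<bar> / fact n" by (rule divide_right_mono) auto
        then show "B / fact n \<le> \<bar>B\<bar> / fact n + 1" by linarith
      qed simp
      finally show ?case .
    qed
  qed (simp add: add_nonneg_pos)
qed

section \<open>Fourier coefficients of the forcing\<close>

lemma summable_on_inverse_square_int: "(\<lambda>k::int. 1 / (of_int k)\<^sup>2 :: real) summable_on UNIV"
proof -
  let ?f = "\<lambda>k::int. 1 / (of_int k)\<^sup>2 :: real"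
  have "summable (\<lambda>n::nat. norm (1 / (real n)\<^sup>2))"
    using inverse_power_summable[of 2, where 'a = real] by (simp add: inverse_eq_divide)
  then have s: "(\<lambda>n::nat. 1 / (real n)\<^sup>2) summable_on UNIV" by (rule norm_summable_imp_summable_on)
  have "?f summable_on range int"
    by (subst summable_on_reindex) (use s in \<open>auto simp: o_def\<close>)
  moreover have "?f summable_on range (\<lambda>n. - int n)"
    by (subst summable_on_reindex) (use s in \<open>auto simp: o_def inj_on_def\<close>)
  ultimately have "?f summable_on range int \<union> range (\<lambda>n. - int n)" by (rule summable_on_union)
  moreover have "range int \<union> range (\<lambda>n. - int n) = UNIV"
    by (auto simp: image_iff) (metis int_cases)
  ultimately show ?thesis by simp
qed

context
  fixes g :: "real \<Rightarrow> real" and \<gamma> :: "complex \<Rightarrow> complex" and \<sigma> :: real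
  assumes \<sigma>: "\<sigma> > 0" and \<gamma>: "\<gamma> holomorphic_on strip \<sigma>" "\<And>t. \<gamma> (of_real t) = of_real (g t)"
    and period: "\<And>t. g (t + 2 * pi) = g t"
begin

lemma has_vector_derivative_on_reals:
  assumes "h holomorphic_on strip \<sigma>"
  shows "((\<lambda>t. h (of_real t)) has_vector_derivative deriv h (of_real t)) (at t)"
  by (rule has_vector_derivative_real_field[OF holomorphic_derivI[OF assms open_strip of_real_in_strip[OF \<sigma>]]])

lemma periodic_derivative:
  assumes h: "h holomorphic_on strip \<sigma>" and per: "\<And>t. h (of_real (t + 2 * pi)) = h (of_real t)"
  shows "deriv h (of_real (t + 2 * pi)) = deriv h (of_real t)"
proof -
  have "((\<lambda>t. t + 2 * pi) has_real_derivative 1) (at t)" by (auto intro!: derivative_eq_intros)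
  then have 1: "((\<lambda>t. t + 2 * pi) has_vector_derivative 1) (at t)"
    by (simp add: has_real_derivative_iff_has_vector_derivative)
  have "((\<lambda>t. h (of_real (t + 2 * pi))) has_vector_derivative deriv h (of_real (t + 2 * pi))) (at t)"
    using vector_diff_chain_at[OF 1 has_vector_derivative_on_reals[OF h]] by (simp add: o_def)
  then have "((\<lambda>t. h (of_real t)) has_vector_derivative deriv h (of_real (t + 2 * pi))) (at t)"
    unfolding per .
  then show ?thesis using vector_derivative_unique_at[OF _ has_vector_derivative_on_reals[OF h]] by blast
qed

lemma continuous_on_reals:
  assumes "h holomorphic_on strip \<sigma>"
  shows "continuous_on S (\<lambda>t. h (complex_of_real t))"
  by (rule continuous_on_compose2[OF holomorphic_on_imp_continuous_on[OF assms]])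
    (use of_real_in_strip[OF \<sigma>] in \<open>auto intro!: continuous_intros\<close>)

text \<open>Two integrations by parts show that the coefficients are \<open>O(1/k\<^sup>2)\<close>.\<close>

lemma l1_fourier_coeffs: "l1 (fourier_coeffs g)"
proof -
  have h1: "deriv \<gamma> holomorphic_on strip \<sigma>" by (rule holomorphic_deriv[OF \<gamma>(1) open_strip])
  have h2: "deriv (deriv \<gamma>) holomorphic_on strip \<sigma>" by (rule holomorphic_deriv[OF h1 open_strip])
  have p0: "\<gamma> (of_real (t + 2 * pi)) = \<gamma> (of_real t)" for t unfolding \<gamma>(2) period ..
  have p1: "deriv \<gamma> (of_real (t + 2 * pi)) = deriv \<gamma> (of_real t)" for t by (rule periodic_derivative[OF \<gamma>(1) p0])
  have f1: "fourier_coeff (\<lambda>t. deriv \<gamma> (of_real t)) k = \<i> * of_int k * fourier_coeff (\<lambda>t. \<gamma> (of_real t)) k" for k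
    by (rule fourier_coeff_deriv[OF has_vector_derivative_on_reals[OF \<gamma>(1)] continuous_on_reals[OF h1]])
      (use p0[of 0] in simp)
  have f2: "fourier_coeff (\<lambda>t. deriv (deriv \<gamma>) (of_real t)) k = \<i> * of_int k * fourier_coeff (\<lambda>t. deriv \<gamma> (of_real t)) k" for k
    by (rule fourier_coeff_deriv[OF has_vector_derivative_on_reals[OF h1] continuous_on_reals[OF h2]])
      (use p1[of 0] in simp)
  have "bounded ((\<lambda>t. deriv (deriv \<gamma>) (of_real t)) ` {0..2*pi})"
    by (intro compact_imp_bounded compact_continuous_image continuous_on_reals h2) auto
  then obtain B where B: "\<And>t. t \<in> {0..2*pi} \<Longrightarrow> norm (deriv (deriv \<gamma>) (of_real t)) \<le> B"
    unfolding bounded_iff by blast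
  have fc: "fourier_coeffs g k = fourier_coeff (\<lambda>t. \<gamma> (of_real t)) k" for k
    unfolding fourier_coeffs_def \<gamma>(2) ..
  have le: "norm (fourier_coeffs g k) \<le> B * (1 / (of_int k)\<^sup>2)" if k: "k \<noteq> 0" for k
  proof -
    have "norm (fourier_coeff (\<lambda>t. deriv (deriv \<gamma>) (of_real t)) k) \<le> B"
      by (rule norm_fourier_coeff_le[OF continuous_on_reals[OF h2] B])
    then have "(of_int k)\<^sup>2 * norm (fourier_coeffs g k) \<le> B"
      unfolding f2 f1 fc by (simp add: norm_mult power2_eq_square mult.assoc flip: abs_mult)
    then show ?thesis using k by (simp add: field_simps)
  qed
  have "(\<lambda>k. B * (1 / (of_int k)\<^sup>2)) summable_on - {0}"
    by (rule summable_on_subset_banach[OF summable_on_cmult_right[OF summable_on_inverse_square_int]]) auto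
  then have "(\<lambda>k. norm (fourier_coeffs g k)) summable_on - {0}"
    by (rule summable_on_comparison_test) (use le in auto)
  then have "(\<lambda>k. norm (fourier_coeffs g k)) summable_on insert 0 (- {0})"
    by (simp only: summable_on_insert_iff)
  moreover have "insert 0 (- {0}) = (UNIV :: int set)" by auto
  ultimately show ?thesis unfolding l1_def by simp
qed

lemma forcing_fourier_series: "((\<lambda>k. fourier_coeffs g k * exp (\<i> * of_int k * of_real t)) has_sum of_real (g t)) UNIV"
  unfolding fourier_coeffs_def
proof (rule fourier_series(1))
  show "continuous_on UNIV (\<lambda>t. complex_of_real (g t))" using continuous_on_reals[OF \<gamma>(1)] by (simp add: \<gamma>(2))
  show "complex_of_real (g (t + 2 * pi)) = complex_of_real (g t)" for t using period by simp
  show "(\<lambda>k. norm (fourier_coeff (\<lambda>t. complex_of_real (g t)) k)) summable_on UNIV"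
    using l1_fourier_coeffs by (simp add: l1_def fourier_coeffs_def)
qed

end

lemma fourier_coeffs_uminus: "fourier_coeffs g (- k) = cnj (fourier_coeffs g k)"
proof -
  have "cnj (integral {0..2*pi} (\<lambda>t. of_real (g t) * exp (- (\<i> * of_int k * of_real t))))
      = integral {0..2*pi} (\<lambda>t. of_real (g t) * exp (- (\<i> * of_int (- k) * of_real t)))"
    unfolding integral_cnj by (simp add: exp_cnj)
  then show ?thesis unfolding fourier_coeffs_def fourier_coeff_def by simp
qed

lemma fourier_coeffs_0:
  assumes "integral {0..2*pi} g = 0" "continuous_on {0..2*pi} g"
  shows "fourier_coeffs g 0 = 0"
proof -
  have "((\<lambda>t. complex_of_real (g t)) has_integral of_real (integral {0..2*pi} g)) {0..2*pi}"
    by (intro has_integral_of_real integrable_integral integrable_continuous_interval assms(2))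
  then show ?thesis using assms(1) by (simp add: fourier_coeffs_def fourier_coeff_def integral_unique)
qed

text \<open>The frequencies generated by the forcing form a subgroup of \<open>\<int>\<close>, as \<open>g\<close> is real and so \<open>G\<^sub>1 = -G\<^sub>1\<close>. If its
  positive generator \<open>d\<close> were not \<open>1\<close>, then \<open>2\<pi>/d\<close> would be a period.\<close>

lemma harmonics_contain_one:
  assumes series: "\<And>t. ((\<lambda>k. fourier_coeffs g k * exp (\<i> * of_int k * of_real t)) has_sum of_real (g t)) UNIV"
    and zero: "fourier_coeffs g 0 = 0" and least: "least_period (2 * pi) g"
  shows "\<exists>l\<ge>1. 1 \<in> harmonics g l"
proof -
  define \<Lambda> where "\<Lambda> = (\<Union>l\<in>{1..}. harmonics g l)"
  have add: "k + l \<in> \<Lambda>" if kl: "k \<in> \<Lambda>" "l \<in> \<Lambda>" for k l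
  proof -
    obtain i j where "i \<ge> 1" "k \<in> harmonics g i" "l \<in> harmonics g j" using kl by (auto simp: \<Lambda>_def)
    then have "i + j \<ge> 1" "k + l \<in> harmonics g (i + j)" by (auto intro: harmonics_add)
    then show ?thesis unfolding \<Lambda>_def by blast
  qed
  have gen: "k \<in> \<Lambda>" if "fourier_coeffs g k \<noteq> 0" for k
    unfolding \<Lambda>_def using that harmonics_one[of k g] by (intro UN_I[of 1]) auto
  have neg: "- k \<in> \<Lambda>" if k: "k \<in> \<Lambda>" for k
  proof -
    obtain l ms where l: "l \<ge> 1" "k = sum_list ms" "length ms = l" "set ms \<subseteq> {m. fourier_coeffs g m \<noteq> 0}"
      using k by (auto simp: \<Lambda>_def harmonics_def)
    have "sum_list (map uminus ms) = - sum_list ms" by (induction ms) auto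
    then have "- k \<in> harmonics g l"
      unfolding harmonics_def using l by (intro CollectI exI[of _ "map uminus ms"]) (auto simp: fourier_coeffs_uminus)
    then show ?thesis unfolding \<Lambda>_def using l(1) by blast
  qed
  have mult: "k + of_nat n * l \<in> \<Lambda>" if kl: "k \<in> \<Lambda>" "l \<in> \<Lambda>" for k l n
  proof (induction n)
    case (Suc n)
    have "k + of_nat (Suc n) * l = (k + of_nat n * l) + l" by (simp add: algebra_simps)
    then show ?case using add[OF Suc kl(2)] by (simp only:)
  qed (use kl in simp)
  have not_period: "\<not> (\<forall>t. g (t + S) = g t)" if "0 < S" "S < 2 * pi" for S
    using least that by (auto simp: least_period_def)
  have "\<exists>m. m \<noteq> 0 \<and> fourier_coeffs g m \<noteq> 0"
  proof (rule ccontr)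
    assume "\<not> ?thesis"
    then have "fourier_coeffs g m = 0" for m using zero by metis
    then have "((\<lambda>k. 0) has_sum complex_of_real (g t)) (UNIV :: int set)" for t using series[of t] by simp
    then have "g t = 0" for t using has_sum_unique[OF _ has_sum_0] by fastforce
    then show False using not_period[of pi] by simp
  qed
  then obtain m where m: "m \<noteq> 0" "m \<in> \<Lambda>" using gen by blast
  have ex: "\<exists>d::nat. d > 0 \<and> int d \<in> \<Lambda>"
  proof (cases "m > 0")
    case True
    then show ?thesis using m by (intro exI[of _ "nat m"]) auto
  next
    case False
    then show ?thesis using m neg[OF m(2)] by (intro exI[of _ "nat (- m)"]) auto
  qed
  define d where "d = (LEAST d::nat. d > 0 \<and> int d \<in> \<Lambda>)"
  have d: "d > 0" "int d \<in> \<Lambda>" using LeastI_ex[OF ex] by (auto simp: d_def)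
  have dvd: "int d dvd k" if k: "fourier_coeffs g k \<noteq> 0" for k
  proof (rule ccontr)
    assume nd: "\<not> int d dvd k"
    have r: "k mod int d \<noteq> 0" "0 \<le> k mod int d" "k mod int d < int d" using nd d by (auto simp: dvd_eq_mod_eq_0)
    have "k mod int d \<in> \<Lambda>"
    proof (cases "k div int d \<ge> 0")
      case True
      then have "k mod int d = k + of_nat (nat (k div int d)) * (- int d)" by (simp add: minus_div_mult_eq_mod[symmetric])
      then show ?thesis using mult[OF gen[OF k] neg[OF d(2)]] by metis
    next
      case False
      then have "k mod int d = k + of_nat (nat (- (k div int d))) * int d" by (simp add: minus_div_mult_eq_mod[symmetric])
      then show ?thesis using mult[OF gen[OF k] d(2)] by metis
    qed
    then have "0 < nat (k mod int d) \<and> int (nat (k mod int d)) \<in> \<Lambda>" using r by simp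
    from Least_le[of "\<lambda>d. d > 0 \<and> int d \<in> \<Lambda>", OF this]
    have "d \<le> nat (k mod int d)" unfolding d_def .
    then show False using r by linarith
  qed
  have "d = 1"
  proof (rule ccontr)
    assume "d \<noteq> 1"
    then have d2: "real d \<ge> 2" using d by linarith
    have "g (t + 2 * pi / real d) = g t" for t
    proof -
      have "fourier_coeffs g k * exp (\<i> * of_int k * of_real (t + 2 * pi / real d)) = fourier_coeffs g k * exp (\<i> * of_int k * of_real t)" for k
      proof (cases "fourier_coeffs g k = 0")
        case False
        then obtain q where q: "k = int d * q" using dvd by (auto simp: dvd_def)
        have "\<i> * of_int k * of_real (t + 2 * pi / real d) = \<i> * of_int k * of_real t + (2 * of_int q * pi) * \<i>"
          using d q by (simp add: field_simps)
        moreover have "exp ((2 * of_int q * pi) * \<i>) = 1" using exp_integer_2pi[of "of_int q"] by simp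
        ultimately show ?thesis by (simp only: exp_add mult_1_right)
      qed simp
      then have "((\<lambda>k. fourier_coeffs g k * exp (\<i> * of_int k * of_real t)) has_sum of_real (g (t + 2 * pi / real d))) UNIV"
        using series[of "t + 2 * pi / real d"] by (simp only:)
      from has_sum_unique[OF this series] show ?thesis by simp
    qed
    moreover have "2 * pi / real d > 0" "2 * pi / real d < 2 * pi" using d2 pi_gt_zero by (auto simp: divide_less_eq)
    ultimately show False using not_period by blast
  qed
  then show ?thesis using d by (auto simp: \<Lambda>_def)
qed

section \<open>The second order coefficient\<close>

lemma has_sum_reflection:
  fixes h :: "int \<Rightarrow> complex"
  assumes h: "h summable_on UNIV" and refl: "\<And>k. h (1 - k) = h k" and "h 0 = 0" "h 1 = 0"
  shows "h summable_on {k. k > 1}" "(h has_sum 2 * infsum h {k. k > 1}) UNIV"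
proof -
  show s: "h summable_on {k. k > 1}" by (rule summable_on_subset_banach[OF h]) auto
  have 1: "(h has_sum infsum h {k. k > 1}) {k. k > 1}" using s by simp
  have "(h has_sum infsum h {k. k > 1}) {k. k > 1} \<longleftrightarrow> (h has_sum infsum h {k. k > 1}) {k. k < 0}"
    by (rule has_sum_reindex_bij_witness[where i = "\<lambda>k. 1 - k" and j = "\<lambda>k. 1 - k"]) (auto simp: refl)
  with 1 have "(h has_sum infsum h {k. k > 1}) {k. k < 0}" by simp
  from has_sum_Un_disjoint[OF 1 this]
  have "(h has_sum 2 * infsum h {k. k > 1}) ({k. k > 1} \<union> {k. k < 0})" by force
  then show "(h has_sum 2 * infsum h {k. k > 1}) UNIV"
  proof (rule has_sum_cong_neutral[THEN iffD1, rotated -1])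
    fix k assume "k \<in> UNIV - ({k. k > 1} \<union> {k. k < (0::int)})"
    then have "k = 0 \<or> k = 1" by auto
    then show "h k = 0" using assms by auto
  qed auto
qed

text \<open>For \<open>k \<noteq> 0\<close> the coefficient \<open>G\<^bsup>[k]\<^esup>\<close> is \<open>g\<^bsup>[k]\<^esup>/(ik)\<close>. The mean of \<open>G\<close>, which is arbitrary, only occurs in products
  with \<open>G\<^bsup>[1]\<^esup> = 0\<close>.\<close>

lemma fourier_coeff_square_primitive:
  assumes G: "\<And>t. (G has_real_derivative g t) (at t)" and cg: "continuous_on UNIV g"
    and mean: "integral {0..2*pi} g = 0" and per: "\<And>t. g (t + 2 * pi) = g t"
    and l1: "l1 (fourier_coeffs g)" and a1: "fourier_coeffs g 1 = 0"
  shows "((\<lambda>l. - (fourier_coeffs g l * fourier_coeffs g (1 - l) / (of_int l * (1 - of_int l)))) has_sum fourier_coeff (\<lambda>t. of_real ((G t)\<^sup>2)) 1) UNIV"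
proof -
  let ?G = "\<lambda>t. complex_of_real (G t)"
  have cG: "continuous_on S ?G" for S
    by (intro continuous_intros continuous_at_imp_continuous_on) (use G DERIV_isCont in blast)
  have G2: "(?G has_vector_derivative of_real (g t)) (at t)" for t
    using G[of t] by (intro has_vector_derivative_of_real) (simp add: has_real_derivative_iff_has_vector_derivative)
  have "(g has_integral (G (2*pi) - G 0)) {0..2*pi}"
    using G by (intro fundamental_theorem_of_calculus)
      (auto simp: has_real_derivative_iff_has_vector_derivative intro: has_vector_derivative_at_within)
  then have G0: "G (2*pi) = G 0" using mean by (simp add: integral_unique)
  have perG: "G (t + 2 * pi) = G t" for t
  proof -
    have "((\<lambda>t. G (t + 2 * pi) - G t) has_real_derivative 0) (at t)" for t
    proof -
      have "((\<lambda>t. G (t + 2 * pi)) has_real_derivative g (t + 2 * pi)) (at t)"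
        using G[of "t + 2 * pi"] by (simp add: DERIV_shift)
      from DERIV_diff[OF this G[of t]] show ?thesis by (simp add: per)
    qed
    then have "G (t + 2 * pi) - G t = G (0 + 2 * pi) - G 0" by (intro DERIV_isconst_all) auto
    then show ?thesis using G0 by simp
  qed
  have coeff: "fourier_coeffs g k = \<i> * of_int k * fourier_coeff ?G k" for k
    unfolding fourier_coeffs_def
    by (rule fourier_coeff_deriv[OF G2]) (use G0 cg in \<open>auto intro!: continuous_intros\<close>)
  have le: "norm (fourier_coeff ?G k) \<le> norm (fourier_coeffs g k)" if "k \<noteq> 0" for k
  proof -
    have "1 \<le> \<bar>real_of_int k\<bar>" using that by linarith
    then show ?thesis unfolding coeff by (simp add: norm_mult mult_le_cancel_right1)
  qed
  have "(\<lambda>k. norm (fourier_coeffs g k)) summable_on - {0}"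
    using l1 unfolding l1_def by (rule summable_on_subset_banach) auto
  then have "(\<lambda>k. norm (fourier_coeff ?G k)) summable_on - {0}"
    by (rule summable_on_comparison_test) (use le in auto)
  then have "(\<lambda>k. norm (fourier_coeff ?G k)) summable_on insert 0 (- {0})"
    by (simp only: summable_on_insert_iff)
  moreover have "insert 0 (- {0}) = (UNIV :: int set)" by auto
  ultimately have sG: "(\<lambda>k. norm (fourier_coeff ?G k)) summable_on UNIV" by simp
  have "((\<lambda>l. fourier_coeff ?G l * fourier_coeff ?G (1 - l)) has_sum fourier_coeff (\<lambda>t. ?G t * ?G t) 1) UNIV"
    by (rule fourier_coeff_mult[OF cG _ sG cG]) (simp add: perG)
  moreover have "fourier_coeff ?G l * fourier_coeff ?G (1 - l) = - (fourier_coeffs g l * fourier_coeffs g (1 - l) / (of_int l * (1 - of_int l)))" for l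
  proof (cases "l = 0 \<or> l = 1")
    case True
    have "fourier_coeff ?G 1 = 0" using a1 coeff[of 1] by simp
    then show ?thesis using True by auto
  next
    case False
    then have nz: "of_int l \<noteq> (0::complex)" "1 - of_int l \<noteq> (0::complex)"
      by (auto simp: eq_commute[of "1::complex"])
    have "fourier_coeffs g l * fourier_coeffs g (1 - l) = - (of_int l * (1 - of_int l) * (fourier_coeff ?G l * fourier_coeff ?G (1 - l)))"
      unfolding coeff by (simp add: algebra_simps)
    then show ?thesis using nz by simp
  qed
  ultimately show ?thesis by (simp add: power2_eq_square)
qed

section \<open>The lowest order of \<open>\<chi>\<^bsup>[-1]\<^esup>\<close>\<close>

lemma quadrant_subset_D_minus:
  assumes "\<theta> > 0" "\<rho> > 0" "R \<ge> \<rho> + \<rho> / \<theta>"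
  shows "quadrant 1 R \<subseteq> D_minus \<rho> \<theta>"
proof
  fix z assume "z \<in> quadrant 1 R"
  then have z: "Re z \<le> 0" "Re z + Im z < - R" by (auto simp: quadrant_def)
  show "z \<in> D_minus \<rho> \<theta>"
  proof (cases "\<theta> * Re z + \<rho> < 0")
    case True
    then show ?thesis unfolding D_minus_def using abs_ge_zero[of "Im z"] by (intro CollectI) linarith
  next
    case False
    then have "- Re z \<le> \<rho> / \<theta>" using assms(1) by (simp add: field_simps)
    then have "Im z < - \<rho>" using z assms(3) by linarith
    moreover have "\<theta> * Re z \<le> 0" using z assms(1) by (simp add: mult_nonneg_nonpos)
    ultimately show ?thesis unfolding D_minus_def by (intro CollectI) linarith
  qed
qed

lemma quadrant_subset_D_plus:
  assumes "\<theta> > 0" "\<rho> > 0" "R \<ge> \<rho> + \<rho> / \<theta>"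
  shows "quadrant (-1) R \<subseteq> D_plus \<rho> \<theta>"
proof
  fix z assume "z \<in> quadrant (-1) R"
  then have "- cnj z \<in> quadrant 1 R" by (auto simp: quadrant_def)
  then have "- cnj z \<in> D_minus \<rho> \<theta>" using quadrant_subset_D_minus[OF assms] by blast
  then show "z \<in> D_plus \<rho> \<theta>" by (auto simp: D_plus_def D_minus_def)
qed

lemma mode_diff:
  assumes "regular F D (strip \<sigma>) (ball 0 \<mu>0)" "regular G D (strip \<sigma>) (ball 0 \<mu>0)" "\<sigma> > 0" "0 < r" "r < \<mu>0" "z \<in> D"
  shows "mode r j k (\<lambda>\<tau> \<mu>. F z \<tau> \<mu> - G z \<tau> \<mu>) = mode r j k (F z) - mode r j k (G z)"
  unfolding mode_def
  using fourier_coeff_diff[OF continuous_on_taylor_coeff_real[OF assms(1,3-6)] continuous_on_taylor_coeff_real[OF assms(2,3-6)], of j j k]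
    taylor_coeff_add(2)[OF regularD(7)[OF assms(1,6) of_real_in_strip[OF assms(3)]] regularD(7)[OF assms(2,6) of_real_in_strip[OF assms(3)]] assms(4,5), of j]
  by simp

text \<open>The limit in \<open>coefficient_limit\<close> is evaluated along the negative imaginary axis, where the coefficients of both
  solutions are given by the recursion. At the orders below \<open>n\<close> they vanish at the frequency \<open>1\<close>; at
  the order \<open>n\<close> their difference is the one in the definition of the splitting functional.\<close>

lemma coefficient_of_minimal_order:
  assumes g: "forcing g" and data: "inner_data g \<mu>0 \<theta> \<rho> \<sigma> M \<psi>m \<psi>p \<gg> chi" and n: "n = n_of g"
  defines "c \<equiv> splitting (replicate n (fourier_coeffs g))"
  shows "n \<ge> 1" "\<And>i. 1 \<le> i \<Longrightarrow> i < n \<Longrightarrow> 1 \<notin> harmonics g i" "l1 (fourier_coeffs g)" "fourier_coeffs g 0 = 0"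
    "continuous_on UNIV g"
    and "chi (-1) holomorphic_on ball 0 \<mu>0"
    and "\<And>j. j < n \<Longrightarrow> (deriv ^^ j) (chi (- 1)) 0 = 0"
    and "(deriv ^^ n) (chi (- 1)) 0 / fact n = c"
    and "((\<lambda>z. 1 / fact n * (exp (\<i> * z) * (deriv ^^ n) (\<lambda>\<mu>. Delta_coeff \<psi>m \<psi>p 1 z \<mu>) 0)) \<longlongrightarrow> c) (to_minus_i_infinity \<rho> \<theta>)"
proof -
  have pos: "\<mu>0 > 0" "\<theta> > 0" "\<rho> > 0" "\<sigma> > 0"
    and an: "analytic_periodic \<gg> (D_in \<rho> \<theta>) \<sigma> \<mu>0"
    and gb: "\<forall>z\<in>D_in \<rho> \<theta>. \<forall>\<tau>\<in>strip \<sigma>. \<forall>\<mu>\<in>ball 0 \<mu>0. norm (\<gg> z \<tau> \<mu>) \<le> M / norm z"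
    and chol: "\<forall>k<0. chi k holomorphic_on ball 0 \<mu>0"
    and ex: "\<forall>z\<in>D_in \<rho> \<theta>. \<forall>\<tau>\<in>strip \<sigma>. \<forall>\<mu>\<in>ball 0 \<mu>0.
        ((\<lambda>k. chi k \<mu> * exp (\<i> * of_int k * (z - \<tau> + \<mu> * \<gg> z \<tau> \<mu>))) has_sum Delta_in \<psi>m \<psi>p z \<tau> \<mu>) {k. k < 0}"
    using data unfolding inner_data_def by blast+
  obtain \<gamma> where \<gamma>: "\<gamma> holomorphic_on strip \<sigma>" "\<And>t. \<gamma> (of_real t) = of_real (g t)"
    and sm: "inner_solution \<gamma> (D_minus \<rho> \<theta>) \<sigma> \<mu>0 M \<psi>m" and sp: "inner_solution \<gamma> (D_plus \<rho> \<theta>) \<sigma> \<mu>0 M \<psi>p"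
    using data unfolding inner_data_def by blast
  have per: "g (t + 2 * pi) = g t" for t using g by (auto simp: forcing_def least_period_def)
  show l1: "l1 (fourier_coeffs g)" by (rule l1_fourier_coeffs[OF pos(4) \<gamma> per])
  have "continuous_on UNIV (\<lambda>t. Re (\<gamma> (of_real t)))" by (intro continuous_intros continuous_on_reals[OF pos(4) \<gamma> per] \<gamma>(1))
  then show cg: "continuous_on UNIV g" by (simp add: \<gamma>(2))
  show a0: "fourier_coeffs g 0 = 0"
    by (rule fourier_coeffs_0) (use g cg in \<open>auto simp: forcing_def intro: continuous_on_subset\<close>)
  have lp: "least_period (2 * pi) g" using g by (simp add: forcing_def)
  have ex_l: "\<exists>l. l \<ge> 1 \<and> 1 \<in> harmonics g l"
    using harmonics_contain_one[OF forcing_fourier_series[OF pos(4) \<gamma> per] a0 lp] .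
  show n1: "n \<ge> 1" using LeastI_ex[OF ex_l] by (simp add: n n_of_def)
  show min: "1 \<notin> harmonics g i" if "1 \<le> i" "i < n" for i
    using not_less_Least[of i "\<lambda>l. l \<ge> 1 \<and> 1 \<in> harmonics g l"] that by (auto simp: n n_of_def)
  define r where "r = \<mu>0 / 2"
  have r: "0 < r" "r < \<mu>0" using pos by (auto simp: r_def)
  define \<Delta> where "\<Delta> = Delta_in \<psi>m \<psi>p"
  have Rm: "regular \<psi>m (D_in \<rho> \<theta>) (strip \<sigma>) (ball 0 \<mu>0)"
    by (rule regular_subset[OF inner_solution_regular[OF sm open_D_minus] open_D_in]) (auto simp: D_in_def)
  have Rp: "regular \<psi>p (D_in \<rho> \<theta>) (strip \<sigma>) (ball 0 \<mu>0)"
    by (rule regular_subset[OF inner_solution_regular[OF sp open_D_plus] open_D_in]) (auto simp: D_in_def)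
  have R\<Delta>: "regular \<Delta> (D_in \<rho> \<theta>) (strip \<sigma>) (ball 0 \<mu>0)"
    using regular_diff[OF Rm Rp] by (simp add: \<Delta>_def Delta_in_def[abs_def])
  have Rg: "regular \<gg> (D_in \<rho> \<theta>) (strip \<sigma>) (ball 0 \<mu>0)"
    using an by (intro regular_of_holomorphic3 open_D_in open_strip) (auto simp: analytic_periodic_def)
  have lim: "((\<lambda>z. exp (\<i> * z) * mode r j 1 (\<Delta> z)) \<longlongrightarrow> (deriv ^^ j) (chi (-1)) 0 / fact j) (to_minus_i_infinity \<rho> \<theta>)" for j
    by (rule coefficient_limit[where M = M, OF pos R\<Delta> Rg _ _ _ _ r])
      (use an gb chol ex in \<open>auto simp: analytic_periodic_def \<Delta>_def\<close>)
  have mode\<Delta>: "mode r j 1 (\<Delta> z) = mode r j 1 (\<psi>m z) - mode r j 1 (\<psi>p z)" if "z \<in> D_in \<rho> \<theta>" for j z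
    using mode_diff[OF Rm Rp pos(4) r that, of j 1] by (simp add: \<Delta>_def Delta_in_def[abs_def])
  define R where "R = max 1 (\<rho> + \<rho> / \<theta>)"
  have R: "R \<ge> 1" "R \<ge> \<rho> + \<rho> / \<theta>" by (auto simp: R_def)
  note Km = quadrant_subset_D_minus[OF pos(2,3) R(2)] and Kp = quadrant_subset_D_plus[OF pos(2,3) R(2)]
  have yK: "down y \<in> quadrant e R" if "y > R" for e y using that by (auto simp: quadrant_def)
  have yD: "down y \<in> D_in \<rho> \<theta>" if "y > R" for y
  proof (rule minus_imaginary_in_D_in[OF pos(3)])
    have "\<rho> / \<theta> \<ge> 0" using pos by simp
    then show "y > \<rho>" using R(2) that by linarith
  qed
  have limy: "((\<lambda>y::real. of_real (exp y) * mode r j 1 (\<Delta> (down y))) \<longlongrightarrow> (deriv ^^ j) (chi (-1)) 0 / fact j) at_top" for j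
  proof -
    have "exp (\<i> * down y) = of_real (exp y)" for y by (simp add: exp_of_real)
    then show ?thesis
      using filterlim_compose[OF lim minus_imaginary_to_minus_i_infinity[OF pos(3)], of j] by simp
  qed
  note modes_m = solution_modes[OF sm open_D_minus pos(4) r \<gamma> _ R(1) Km l1 min]
    and modes_p = solution_modes[OF sp open_D_plus pos(4) r \<gamma> _ R(1) Kp l1 min]
  note vanish_m = solution_mode_one_vanishes[OF sm open_D_minus pos(4) r \<gamma> _ R(1) Km l1 min]
    and vanish_p = solution_mode_one_vanishes[OF sp open_D_plus pos(4) r \<gamma> _ R(1) Kp l1 min]
  show "chi (-1) holomorphic_on ball 0 \<mu>0" using chol by simp
  show "(deriv ^^ j) (chi (- 1)) 0 = 0" if j: "j < n" for j
  proof -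
    have "\<forall>\<^sub>F y in at_top. 0 = of_real (exp y) * mode r j 1 (\<Delta> (down y))"
      using eventually_gt_at_top[of R]
    proof eventually_elim
      case (elim y)
      show ?case using mode\<Delta>[OF yD[OF elim], of j] vanish_m[OF _ _ _ j yK[OF elim]] vanish_p[OF _ _ _ j yK[OF elim]] by simp
    qed
    then have "((\<lambda>y::real. of_real (exp y) * mode r j 1 (\<Delta> (down y))) \<longlongrightarrow> 0) at_top"
      by (rule Lim_transform_eventually[OF tendsto_const])
    then have "(deriv ^^ j) (chi (-1)) 0 / fact j = 0"
      using tendsto_unique[OF trivial_limit_at_top_linorder limy] by blast
    then show ?thesis by simp
  qed
  show eq: "(deriv ^^ n) (chi (- 1)) 0 / fact n = c"
  proof -
    have "replicate n (fourier_coeffs g) \<noteq> []" using n1 by auto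
    then obtain b S where S: "controlled b S (replicate n (fourier_coeffs g))"
      by (rule src_controlledE) (use l1 in auto)
    have "\<forall>\<^sub>F y in at_top. of_real (exp y) * (sol 1 1 (src 1 (replicate n (fourier_coeffs g)) 1) (down y) - sol (-1) 1 (src (-1) (replicate n (fourier_coeffs g)) 1) (down y))
        = of_real (exp y) * mode r n 1 (\<Delta> (down y))"
      using eventually_gt_at_top[of R]
    proof eventually_elim
      case (elim y)
      show ?case
        using mode\<Delta>[OF yD[OF elim], of n] modes_m[OF _ _ _ n1 order_refl yK[OF elim], of 1] modes_p[OF _ _ _ n1 order_refl yK[OF elim], of 1] by simp
    qed
    from Lim_transform_eventually[OF splitting_limit(1)[OF S] this] show ?thesis
      using tendsto_unique[OF trivial_limit_at_top_linorder limy] unfolding c_def by blast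
  qed
  have "\<forall>\<^sub>F z in to_minus_i_infinity \<rho> \<theta>. z \<in> D_in \<rho> \<theta>"
    unfolding to_minus_i_infinity_def by (simp add: eventually_inf_principal)
  then have "\<forall>\<^sub>F z in to_minus_i_infinity \<rho> \<theta>. exp (\<i> * z) * mode r n 1 (\<Delta> z) = 1 / fact n * (exp (\<i> * z) * (deriv ^^ n) (\<lambda>\<mu>. Delta_coeff \<psi>m \<psi>p 1 z \<mu>) 0)"
  proof eventually_elim
    case (elim z)
    show ?case
      using mode_eq_higher_deriv(2)[OF R\<Delta> pos(4) r elim, of n 1] unfolding Delta_coeff_def \<Delta>_def by (simp add: field_simps)
  qed
  from Lim_transform_eventually[OF lim this]
  show "((\<lambda>z. 1 / fact n * (exp (\<i> * z) * (deriv ^^ n) (\<lambda>\<mu>. Delta_coeff \<psi>m \<psi>p 1 z \<mu>) 0)) \<longlongrightarrow> c) (to_minus_i_infinity \<rho> \<theta>)"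
    unfolding eq .
qed

text \<open>The terms of the sum over all integers are symmetric under \<open>k \<mapsto> 1 - k\<close>, which accounts for the factor \<open>2\<close>
  between the two expressions.\<close>

lemma second_order_coefficient:
  fixes g :: "real \<Rightarrow> real" and s :: complex and h :: "int \<Rightarrow> complex"
  assumes l1: "l1 (fourier_coeffs g)" and a: "fourier_coeffs g 0 = 0" "fourier_coeffs g 1 = 0"
  defines "h \<equiv> \<lambda>k. fourier_coeffs g k * fourier_coeffs g (1 - k) / (of_int k * (1 - of_int k))"
  shows "h summable_on {k. k > 1}"
    and "splitting [fourier_coeffs g, fourier_coeffs g] = - (4 * complex_of_real pi / 3) * (\<Sum>\<^sub>\<infinity>k\<in>{k. k > 1}. h k)"
    and "((\<lambda>k. - h k) has_sum s) UNIV \<Longrightarrow> splitting [fourier_coeffs g, fourier_coeffs g] = 2 * pi / 3 * s"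
proof -
  have hs: "((\<lambda>l. - (2 * pi / 3) * h l) has_sum splitting [fourier_coeffs g, fourier_coeffs g]) UNIV"
    unfolding h_def by (rule splitting_pair[OF l1 a])
  have "(\<lambda>l. - (3 / (2 * pi)) * (- (2 * pi / 3) * h l)) summable_on UNIV"
    by (rule summable_on_cmult_right[OF has_sum_imp_summable[OF hs]])
  then have s: "h summable_on UNIV" by (simp add: mult.assoc[symmetric])
  have refl: "h (1 - k) = h k" for k by (simp add: h_def mult_ac)
  have z: "h 0 = 0" "h 1 = 0" by (auto simp: h_def)
  note R = has_sum_reflection[OF s refl z]
  show "h summable_on {k. k > 1}" by (rule R(1))
  show "splitting [fourier_coeffs g, fourier_coeffs g] = - (4 * complex_of_real pi / 3) * (\<Sum>\<^sub>\<infinity>k\<in>{k. k > 1}. h k)"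
    using has_sum_unique[OF hs has_sum_cmult_right[OF R(2), of "- (2 * pi / 3)"]] by simp
  assume "((\<lambda>k. - h k) has_sum s) UNIV"
  from has_sum_unique[OF hs] has_sum_cmult_right[OF this, of "2 * pi / 3"]
  show "splitting [fourier_coeffs g, fourier_coeffs g] = 2 * pi / 3 * s" by simp
qed

theorem theorem2p4:
  shows "\<exists>F :: nat \<Rightarrow> (int \<Rightarrow> complex) \<Rightarrow> complex.
    (\<forall>n\<ge>1. \<forall>s>0. coeff_analytic s (F n)) \<and>
    (\<forall>g \<mu>0 \<theta> \<rho> \<sigma> M \<psi>m \<psi>p \<gg> chi n.
       forcing g \<and> inner_data g \<mu>0 \<theta> \<rho> \<sigma> M \<psi>m \<psi>p \<gg> chi \<and> n = n_of g \<longrightarrow>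
       (\<forall>j\<in>{1..n - 1}. (deriv ^^ j) (chi (- 1)) 0 = 0) \<and>
       (\<exists>chi_n :: complex.
          (\<lambda>\<mu>. chi (- 1) \<mu> - chi_n * \<mu> ^ n) \<in> O[nhds 0](\<lambda>\<mu>. \<mu> ^ (n + 1)) \<and>
          chi_n = F n (fourier_coeffs g) \<and>
          ((\<lambda>z. 1 / fact n * (exp (\<i> * z) * (deriv ^^ n) (\<lambda>\<mu>. Delta_coeff \<psi>m \<psi>p 1 z \<mu>) 0))
             \<longlongrightarrow> chi_n) (to_minus_i_infinity \<rho> \<theta>) \<and>
          (n = 1 \<longrightarrow> chi_n = 4 * pi * fourier_coeffs g 1) \<and>
          (n = 2 \<longrightarrow>
             (\<lambda>k. fourier_coeffs g k * fourier_coeffs g (1 - k) / (of_int k * (1 - of_int k)))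
               summable_on {k. k > 1} \<and>
             chi_n = - (4 * pi / 3) *
               (\<Sum>\<^sub>\<infinity>k\<in>{k. k > 1}. fourier_coeffs g k * fourier_coeffs g (1 - k) / (of_int k * (1 - of_int k))) \<and>
             (\<forall>G :: real \<Rightarrow> real. (\<forall>t. (G has_real_derivative g t) (at t)) \<longrightarrow>
                chi_n = 2 * pi / 3 * fourier_coeff (\<lambda>t. of_real ((G t)\<^sup>2)) 1))))"
proof (rule exI[of _ "\<lambda>n a. splitting (replicate n a)"], intro conjI allI impI)
  show "coeff_analytic s (\<lambda>a. splitting (replicate n a))" if "n \<ge> 1" "s > 0" for n s
    by (rule coeff_analytic_splitting[OF that])
next
  fix g \<mu>0 \<theta> \<rho> \<sigma> M \<psi>m \<psi>p \<gg> chi n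
  assume A: "forcing g \<and> inner_data g \<mu>0 \<theta> \<rho> \<sigma> M \<psi>m \<psi>p \<gg> chi \<and> n = n_of g"
  then have A1: "forcing g" and A2: "inner_data g \<mu>0 \<theta> \<rho> \<sigma> M \<psi>m \<psi>p \<gg> chi" and A3: "n = n_of g" by auto
  note E = coefficient_of_minimal_order[OF A1 A2 A3]
  show "\<forall>j\<in>{1..n - 1}. (deriv ^^ j) (chi (- 1)) 0 = 0"
    using E(1,7) by auto
  have \<mu>0: "\<mu>0 > 0" using A2 by (simp add: inner_data_def)
  have a1: "fourier_coeffs g 1 = 0" if "n = 2"
    using E(2)[of 1] that harmonics_one[of 1 g] by simp
  have rep: "replicate 2 x = [x, x]" for x :: "int \<Rightarrow> complex" by (simp add: numeral_2_eq_2)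
  note S2 = second_order_coefficient[OF E(3,4) a1]
  show "\<exists>chi_n :: complex.
          (\<lambda>\<mu>. chi (- 1) \<mu> - chi_n * \<mu> ^ n) \<in> O[nhds 0](\<lambda>\<mu>. \<mu> ^ (n + 1)) \<and>
          chi_n = splitting (replicate n (fourier_coeffs g)) \<and>
          ((\<lambda>z. 1 / fact n * (exp (\<i> * z) * (deriv ^^ n) (\<lambda>\<mu>. Delta_coeff \<psi>m \<psi>p 1 z \<mu>) 0))
             \<longlongrightarrow> chi_n) (to_minus_i_infinity \<rho> \<theta>) \<and>
          (n = 1 \<longrightarrow> chi_n = 4 * pi * fourier_coeffs g 1) \<and>
          (n = 2 \<longrightarrow>
             (\<lambda>k. fourier_coeffs g k * fourier_coeffs g (1 - k) / (of_int k * (1 - of_int k)))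
               summable_on {k. k > 1} \<and>
             chi_n = - (4 * pi / 3) *
               (\<Sum>\<^sub>\<infinity>k\<in>{k. k > 1}. fourier_coeffs g k * fourier_coeffs g (1 - k) / (of_int k * (1 - of_int k))) \<and>
             (\<forall>G :: real \<Rightarrow> real. (\<forall>t. (G has_real_derivative g t) (at t)) \<longrightarrow>
                chi_n = 2 * pi / 3 * fourier_coeff (\<lambda>t. of_real ((G t)\<^sup>2)) 1))"
  proof (intro exI[of _ "splitting (replicate n (fourier_coeffs g))"] conjI impI allI refl)
    show "(\<lambda>\<mu>. chi (- 1) \<mu> - splitting (replicate n (fourier_coeffs g)) * \<mu> ^ n) \<in> O[nhds 0](\<lambda>\<mu>. \<mu> ^ (n + 1))"
      using taylor_remainder_bigo[OF E(6) \<mu>0, of n] E(7) unfolding E(8) by blast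
    show "((\<lambda>z. 1 / fact n * (exp (\<i> * z) * (deriv ^^ n) (\<lambda>\<mu>. Delta_coeff \<psi>m \<psi>p 1 z \<mu>) 0))
             \<longlongrightarrow> splitting (replicate n (fourier_coeffs g))) (to_minus_i_infinity \<rho> \<theta>)"
      by (rule E(9))
    show "splitting (replicate n (fourier_coeffs g)) = 4 * pi * fourier_coeffs g 1" if "n = 1"
      using splitting_single[OF E(3)] that by simp
    show "(\<lambda>k. fourier_coeffs g k * fourier_coeffs g (1 - k) / (of_int k * (1 - of_int k))) summable_on {k. k > 1}" if "n = 2"
      by (rule S2(1)[OF that])
    show "splitting (replicate n (fourier_coeffs g)) = - (4 * pi / 3) *
        (\<Sum>\<^sub>\<infinity>k\<in>{k. k > 1}. fourier_coeffs g k * fourier_coeffs g (1 - k) / (of_int k * (1 - of_int k)))" if "n = 2"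
      using S2(2)[OF that] that by (simp add: rep)
    show "splitting (replicate n (fourier_coeffs g)) = 2 * pi / 3 * fourier_coeff (\<lambda>t. of_real ((G t)\<^sup>2)) 1"
      if n2: "n = 2" and G: "\<forall>t. (G has_real_derivative g t) (at t)" for G :: "real \<Rightarrow> real"
    proof -
      have "integral {0..2*pi} g = 0" "\<And>t. g (t + 2 * pi) = g t" using A1 by (auto simp: forcing_def least_period_def)
      from fourier_coeff_square_primitive[OF _ E(5) this E(3) a1[OF n2], of G] G
      have "((\<lambda>l. - (fourier_coeffs g l * fourier_coeffs g (1 - l) / (of_int l * (1 - of_int l)))) has_sum fourier_coeff (\<lambda>t. of_real ((G t)\<^sup>2)) 1) UNIV"
        by blast
      from S2(3)[OF n2 this] show ?thesis using n2 by (simp add: rep)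
    qed
  qed
qed

end
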